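(* Fix a dimension $d\ge 1$ and let $G$ be a graph with $n\ge d+2$ vertices and $m$ edges. If $G$ is $(d+1)$-connected, then the set $\mathrm{Gstr}$ of general position $d$-dimensional stress matrices for $G$ is an irreducible real quasi-projective variety of dimension $m-\binom{d+1}{2}$. If $G$ is not $(d+1)$-connected, then $\mathrm{Gstr}$ is empty.
   Context: Graphs are finite and simple, with vertex set $\{1,\dots,n\}$. A graph is $k$-connected if it has at least $k+1$ vertices and remains connected after deleting any set of fewer than $k$ vertices. $\mathrm{Gstr}$ is the set of real symmetric $n\times n$ matrices $\Omega$ such that $\Omega_{ij}=0$ whenever $i\ne j$ and $\{i,j\}$ is not an edge of $G$; the all-ones vector is in the kernel of $\Omega$; $\operatorname{rank}\Omega=n-d-1$; and every subset of $n-d-1$ columns of $\Omega$ is linearly independent. Algebraic sets in $\mathbb{R}^N$ are the common zero sets of finitely many polynomials. A (real) quasi-projective variety is a Zariski open subset of an algebraic set, i.e. an algebraic set minus an algebraic set. An algebraic set is irreducible if it is not the union of two proper algebraic subsets; a semi-algebraic set (in particular a quasi-projective variety) is irreducible if its Zariski closure is. The dimension of a real semi-algebraic set is the largest $t$ such that some Euclidean-open subset of it is a smooth $t$-dimensional submanifold. *)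

theory Defs
  imports "HOL-Analysis.Analysis"
begin

section \<open>Finite simple graphs\<close>

text \<open>
  The vertex set is the whole finite type \<open>'v\<close>, so \<open>n\<close> is \<open>CARD('v)\<close>; a graph is given by its
  set of edges, each edge being an unordered pair of distinct vertices.
\<close>

definition simple_graph :: "'v set set \<Rightarrow> bool" where
  "simple_graph E \<longleftrightarrow> (\<forall>e\<in>E. card e = 2)"

text \<open>Connectedness of the subgraph induced by the vertices in \<open>W\<close>.\<close>

definition connected_induced :: "'v set set \<Rightarrow> 'v set \<Rightarrow> bool" where
  "connected_induced E W \<longleftrightarrow>
     (\<forall>u\<in>W. \<forall>v\<in>W. (u, v) \<in> {(x, y). x \<in> W \<and> y \<in> W \<and> {x, y} \<in> E}\<^sup>*)"

definition k_connected :: "nat \<Rightarrow> 'v::finite set set \<Rightarrow> bool" where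
  "k_connected k E \<longleftrightarrow>
     CARD('v) \<ge> k + 1 \<and> (\<forall>S. card S < k \<longrightarrow> connected_induced E (UNIV - S))"


section \<open>General position stress matrices\<close>

text \<open>
  Linear independence of the columns indexed by \<open>S\<close> is that of an indexed family: repeated columns
  count as dependent, hence the injectivity requirement.
\<close>

definition Gstr :: "nat \<Rightarrow> 'v::finite set set \<Rightarrow> (real^'v^'v) set" where
  "Gstr d E = {\<Omega>.
     transpose \<Omega> = \<Omega> \<and>
     (\<forall>i j. i \<noteq> j \<and> {i, j} \<notin> E \<longrightarrow> \<Omega> $ i $ j = 0) \<and>
     \<Omega> *v (\<chi> i. 1) = 0 \<and>
     rank \<Omega> = CARD('v) - d - 1 \<and>
     (\<forall>S. card S = CARD('v) - d - 1 \<longrightarrow>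
        inj_on (\<lambda>j. column j \<Omega>) S \<and> independent ((\<lambda>j. column j \<Omega>) ` S))}"


section \<open>Real algebraic sets\<close>

definition algebraic_set :: "'a::euclidean_space set \<Rightarrow> bool" where
  "algebraic_set A \<longleftrightarrow>
     (\<exists>F. finite F \<and> (\<forall>f\<in>F. real_polynomial_function f) \<and> A = {x. \<forall>f\<in>F. f x = 0})"

definition quasi_projective_variety :: "'a::euclidean_space set \<Rightarrow> bool" where
  "quasi_projective_variety S \<longleftrightarrow>
     (\<exists>A B. algebraic_set A \<and> algebraic_set B \<and> S = A - B)"

definition irreducible_algebraic_set :: "'a::euclidean_space set \<Rightarrow> bool" where
  "irreducible_algebraic_set A \<longleftrightarrow>
     algebraic_set A \<and>
     \<not> (\<exists>B C. algebraic_set B \<and> algebraic_set C \<and> B \<subset> A \<and> C \<subset> A \<and> A = B \<union> C)"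

definition zariski_closure :: "'a::euclidean_space set \<Rightarrow> 'a set" where
  "zariski_closure S = \<Inter> {A. algebraic_set A \<and> S \<subseteq> A}"

definition zariski_irreducible :: "'a::euclidean_space set \<Rightarrow> bool" where
  "zariski_irreducible S \<longleftrightarrow> irreducible_algebraic_set (zariski_closure S)"


section \<open>Smooth submanifolds and dimension\<close>

text \<open>
  \<open>C_diff_on k f U\<close>: for open \<open>U\<close>, the map \<open>f\<close> is \<open>k\<close> times continuously differentiable on \<open>U\<close>,
  expressed through iterated directional derivatives.
\<close>

fun C_diff_on ::
    "nat \<Rightarrow> ('a::euclidean_space \<Rightarrow> 'b::euclidean_space) \<Rightarrow> 'a set \<Rightarrow> bool" where
  "C_diff_on 0 f U \<longleftrightarrow> continuous_on U f"
| "C_diff_on (Suc k) f U \<longleftrightarrow>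
     (\<forall>x\<in>U. f differentiable (at x)) \<and>
     (\<forall>v. C_diff_on k (\<lambda>x. frechet_derivative f (at x) v) U)"

definition smooth_on_open ::
    "('a::euclidean_space \<Rightarrow> 'b::euclidean_space) \<Rightarrow> 'a set \<Rightarrow> bool" where
  "smooth_on_open f U \<longleftrightarrow> open U \<and> (\<forall>k. C_diff_on k f U)"

text \<open>
  Embedded submanifolds of the ambient Euclidean space: near each of its points, \<open>M\<close> is carried
  onto an open piece of a \<open>t\<close>-dimensional linear subspace by a diffeomorphism \<open>\<phi>\<close> between open
  subsets of the ambient space.
\<close>

definition smooth_submanifold :: "nat \<Rightarrow> 'a::euclidean_space set \<Rightarrow> bool" where
  "smooth_submanifold t M \<longleftrightarrow>
     (\<forall>x\<in>M. \<exists>U V (\<phi> :: 'a \<Rightarrow> 'a) \<psi> L.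
        x \<in> U \<and> homeomorphism U V \<phi> \<psi> \<and> smooth_on_open \<phi> U \<and> smooth_on_open \<psi> V \<and>
        subspace L \<and> dim L = t \<and> \<phi> ` (M \<inter> U) = L \<inter> V)"

definition contains_open_submanifold :: "'a::euclidean_space set \<Rightarrow> nat \<Rightarrow> bool" where
  "contains_open_submanifold S t \<longleftrightarrow>
     (\<exists>W. W \<noteq> {} \<and> openin (top_of_set S) W \<and> smooth_submanifold t W)"

text \<open>
  Dimension is a relation, so that no value has to be invented for the empty set, which is related
  to no \<open>t\<close>. (The empty set is a submanifold of every dimension, hence \<open>W \<noteq> {}\<close> above.)
\<close>

definition has_dimension :: "'a::euclidean_space set \<Rightarrow> nat \<Rightarrow> bool" where
  "has_dimension S t \<longleftrightarrow>
     contains_open_submanifold S t \<and> (\<forall>t'. contains_open_submanifold S t' \<longrightarrow> t' \<le> t)"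

end

theory Submission
  imports Defs
begin

text \<open>
  Write \<open>r = n - d - 1\<close>. A symmetric matrix of rank at most \<open>r\<close> all of whose principal \<open>r\<close>-minors are
  nonzero can be built one vertex at a time: attaching a vertex \<open>u\<close> amounts to choosing a vector in the
  solution space of a linear system with one equation for each earlier non-neighbour of \<open>u\<close>. These
  equations are independent when \<open>G\<close> is \<open>(d+1)\<close>-connected, so every stage is a vector bundle over the
  previous one with polynomial sections, hence irreducible; this makes no reference to the signature.
  That general position can be reached in the first place follows from the Lovasz--Saks--Schrijver idea
  that the order of the vertices does not matter generically, since two adjacent vertices may be attached
  in either order and the graph induced on more than \<open>r\<close> vertices is connected. Rescaling by a kernel
  vector then imposes that the all-ones vector lies in the kernel.

  Near each of its points, \<open>Gstr\<close> is cut out of the space of symmetric matrices supported on \<open>G\<close> by the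
  vanishing of a Schur complement and of \<open>r\<close> row sums. General position makes these equations transversal,
  so that \<open>Gstr\<close> is a submanifold whose dimension is found by counting them.

  If deleting at most \<open>d\<close> vertices separates \<open>G\<close>, a kernel vector that vanishes on the separator splits
  into two kernel vectors, and one of these has too small a support.
\<close>

section \<open>Smooth inverse functions and level sets\<close>

text \<open>Irreducibility is handled as primality of the vanishing ideal: two polynomials that are
  each nonzero somewhere on the set are nonzero at a common point. In this form it passes to
  polynomial images, open subsets and bundles, and it also produces generic points: finitely many
  nonvanishing conditions that can each be met can be met together. Returning to Zariski closures
  meets one obstacle: a closure is an arbitrary intersection, while an algebraic set has finitely
  many equations, hence the Hilbert basis theorem.

  The value r = n - d - 1 ties connectivity to linear algebra. Deleting fewer than d + 1 vertices
  leaves more than r, so every induced subgraph on more than r vertices is connected; and minimum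
  degree d + 1 leaves at most r non-neighbours, so the equations for a new vertex fit into one
  nonzero r-minor.

  The dimension count is (n + m) - ((d + 1) + binom(d + 1, 2)) - r = m - binom(d + 1, 2): free
  entries, entries of the symmetric Schur complement, row sums.\<close>

lemma C_diff_on_cong:
  assumes "open U" "\<And>x. x \<in> U \<Longrightarrow> f x = g x"
  shows "C_diff_on k f U \<longleftrightarrow> C_diff_on k g U"
  using assms(2)
proof (induction k arbitrary: f g)
  case 0
  then show ?case by (auto intro: continuous_on_cong)
next
  case (Suc k)
  have der: "(f has_derivative f') (at x) \<longleftrightarrow> (g has_derivative f') (at x)" if "x \<in> U" for x f'
    using Suc.prems has_derivative_transform_within_open[OF _ assms(1) that] by metis
  have "frechet_derivative f (at x) = frechet_derivative g (at x)" if "x \<in> U" for x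
    unfolding frechet_derivative_def using der[OF that] by simp
  then have "C_diff_on k (\<lambda>x. frechet_derivative f (at x) v) U
      \<longleftrightarrow> C_diff_on k (\<lambda>x. frechet_derivative g (at x) v) U" for v
    by (intro Suc.IH) simp
  moreover have "f differentiable (at x) \<longleftrightarrow> g differentiable (at x)" if "x \<in> U" for x
    unfolding differentiable_def using der[OF that] by simp
  ultimately show ?case by simp
qed

text \<open>\<open>frechet_derivative\<close> is a choice term; by uniqueness of derivatives an
  explicit family can stand in for it.\<close>

lemma C_diff_on_SucI:
  assumes "open U" "\<And>x. x \<in> U \<Longrightarrow> (f has_derivative f' x) (at x)"
    and "\<And>v. C_diff_on k (\<lambda>x. f' x v) U"
  shows "C_diff_on (Suc k) f U"
proof -
  have "C_diff_on k (\<lambda>x. frechet_derivative f (at x) v) U" for v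
    using assms(3)[of v] C_diff_on_cong[OF assms(1), of "\<lambda>x. f' x v" "\<lambda>x. frechet_derivative f (at x) v" k]
      frechet_derivative_at[OF assms(2)] by simp
  then show ?thesis
    using assms(2) by (auto simp: differentiable_def)
qed

lemma C_diff_on_SucD: "C_diff_on (Suc k) f U \<Longrightarrow> C_diff_on k f U"
proof (induction k arbitrary: f)
  case 0
  then show ?case
    by (auto intro!: continuous_at_imp_continuous_on differentiable_imp_continuous_within)
qed auto

lemma C_diff_on_const: "open U \<Longrightarrow> C_diff_on k (\<lambda>x. c) U"
proof (induction k arbitrary: c)
  case (Suc k)
  then show ?case by (intro C_diff_on_SucI[where f'="\<lambda>_ _. 0"]) simp_all
qed auto

lemma C_diff_on_Suc_has_derivative:
  assumes "C_diff_on (Suc k) f U" "x \<in> U"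
  shows "(f has_derivative frechet_derivative f (at x)) (at x)"
  using assms by (simp add: frechet_derivative_works)

lemma C_diff_on_add:
  assumes "open U" "C_diff_on k f U" "C_diff_on k g U"
  shows "C_diff_on k (\<lambda>x. f x + g x) U"
  using assms(2,3)
proof (induction k arbitrary: f g)
  case 0
  then show ?case by (auto intro: continuous_intros)
next
  case (Suc k)
  show ?case
    by (rule C_diff_on_SucI[OF assms(1)
          has_derivative_add[OF C_diff_on_Suc_has_derivative[OF Suc.prems(1)]
            C_diff_on_Suc_has_derivative[OF Suc.prems(2)]]])
      (use Suc in simp_all)
qed

lemma C_diff_on_scaleR:
  fixes f :: "'a::euclidean_space \<Rightarrow> real"
  assumes "open U" "C_diff_on k f U" "C_diff_on k g U"
  shows "C_diff_on k (\<lambda>x. f x *\<^sub>R g x) U"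
  using assms(2,3)
proof (induction k arbitrary: f g)
  case 0
  then show ?case by (auto intro: continuous_intros)
next
  case (Suc k)
  show ?case
  proof (rule C_diff_on_SucI[OF assms(1)
          has_derivative_scaleR[OF C_diff_on_Suc_has_derivative[OF Suc.prems(1)]
            C_diff_on_Suc_has_derivative[OF Suc.prems(2)]]])
    fix v
    \<comment> \<open>The product rule leaves \<open>f\<close> and \<open>g\<close>
      undifferentiated, hence the descent to order \<open>k\<close>.\<close>
    have "C_diff_on k f U" "C_diff_on k g U"
      using Suc.prems C_diff_on_SucD by blast+
    then show "C_diff_on k (\<lambda>x. f x *\<^sub>R frechet_derivative g (at x) v +
            frechet_derivative f (at x) v *\<^sub>R g x) U"
      using Suc.prems by (intro C_diff_on_add assms(1) Suc.IH) simp_all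
  qed
qed

lemma C_diff_on_mult:
  fixes f g :: "'a::euclidean_space \<Rightarrow> real"
  shows "open U \<Longrightarrow> C_diff_on k f U \<Longrightarrow> C_diff_on k g U \<Longrightarrow> C_diff_on k (\<lambda>x. f x * g x) U"
  using C_diff_on_scaleR[of U k f g] by simp

lemma C_diff_on_bounded_linear:
  assumes "open U" "bounded_linear h" "C_diff_on k f U"
  shows "C_diff_on k (\<lambda>x. h (f x)) U"
  using assms(3)
proof (induction k arbitrary: f)
  case 0
  then show ?case using bounded_linear.continuous_on[OF assms(2)] by auto
next
  case (Suc k)
  show ?case
    by (rule C_diff_on_SucI[OF assms(1)
          bounded_linear.has_derivative[OF assms(2) C_diff_on_Suc_has_derivative[OF Suc.prems]]])
      (use Suc in simp_all)
qed

lemma C_diff_on_sum: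
  assumes "open U" "\<And>i. i \<in> I \<Longrightarrow> C_diff_on k (f i) U"
  shows "C_diff_on k (\<lambda>x. \<Sum>i\<in>I. f i x) U"
  using assms(2)
  by (induction I rule: infinite_finite_induct) (auto simp: C_diff_on_const C_diff_on_add assms(1))

lemma C_diff_on_real_polynomial_compose:
  assumes "open U" "real_polynomial_function p" "C_diff_on k f U"
  shows "C_diff_on k (\<lambda>x. p (f x)) U"
  using assms(2)
proof induction
  case (linear h)
  then show ?case by (rule C_diff_on_bounded_linear[OF assms(1) _ assms(3)])
qed (simp_all add: C_diff_on_const C_diff_on_add C_diff_on_mult assms(1))

lemma C_diff_on_ident: "open U \<Longrightarrow> C_diff_on k (\<lambda>x. x) U"
proof (cases k)
  case (Suc j)
  moreover assume "open U"
  ultimately show ?thesis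
    by (auto intro!: C_diff_on_SucI[where f'="\<lambda>_ h. h"] C_diff_on_const simp del: C_diff_on.simps)
qed simp

lemma C_diff_on_polynomial_compose:
  assumes "open U" "polynomial_function p" "C_diff_on k f U"
  shows "C_diff_on k (\<lambda>x. p (f x)) U"
proof -
  have "C_diff_on k (\<lambda>x. \<Sum>b\<in>Basis. (p (f x) \<bullet> b) *\<^sub>R b) U"
  proof (intro C_diff_on_sum assms(1))
    fix b :: 'c assume b: "b \<in> Basis"
    have "real_polynomial_function (\<lambda>x. p x \<bullet> b)"
      using assms(2) b polynomial_function_iff_Basis_inner by blast
    from C_diff_on_bounded_linear[OF assms(1) bounded_linear_scaleR_left[of b]
        C_diff_on_real_polynomial_compose[OF assms(1) this assms(3)]]
    show "C_diff_on k (\<lambda>x. (p (f x) \<bullet> b) *\<^sub>R b) U" .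
  qed
  then show ?thesis by (simp add: euclidean_representation)
qed

lemma smooth_on_open_polynomial:
  assumes "open U" "polynomial_function p" shows "smooth_on_open p U"
  unfolding smooth_on_open_def
  using assms(1) C_diff_on_polynomial_compose[OF assms C_diff_on_ident[OF assms(1)]] by blast

section \<open>Derivatives of polynomial maps and of inverses of families of linear maps\<close>

lemma real_polynomial_has_derivative:
  assumes "real_polynomial_function f"
  shows "\<exists>f'. (\<forall>x. (f has_derivative f' x) (at x)) \<and> (\<forall>v. real_polynomial_function (\<lambda>x. f' x v))"
  using assms
proof induction
  case (linear f)
  then show ?case
    by (intro exI[of _ "\<lambda>_. f"]) (auto intro: bounded_linear_imp_has_derivative)
next
  case (const c)
  then show ?case by (intro exI[of _ "\<lambda>_ _. 0"]) auto
next
  case (add f g)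
  then obtain f' g' where 
    "\<forall>x. (f has_derivative f' x) (at x)" "\<forall>v. real_polynomial_function (\<lambda>x. f' x v)"
    "\<forall>x. (g has_derivative g' x) (at x)" "\<forall>v. real_polynomial_function (\<lambda>x. g' x v)" by blast
  then show ?case 
    by (intro exI[of _ "\<lambda>x v. f' x v + g' x v"]) (auto intro: has_derivative_add)
next
  case (mult f g)
  then obtain f' g' where 
    "\<forall>x. (f has_derivative f' x) (at x)" "\<forall>v. real_polynomial_function (\<lambda>x. f' x v)"
    "\<forall>x. (g has_derivative g' x) (at x)" "\<forall>v. real_polynomial_function (\<lambda>x. g' x v)" by blast
  then show ?case using mult(1,2)
    by (intro exI[of _ "\<lambda>x v. f x * g' x v + f' x v * g x"])
      (intro conjI allI has_derivative_mult real_polynomial_function.intros(3,4); blast)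
qed

lemma polynomial_has_derivative:
  fixes p :: "'a::euclidean_space \<Rightarrow> 'b::euclidean_space"
  assumes "polynomial_function p"
  obtains p' where "\<And>x. (p has_derivative p' x) (at x)" "\<And>v. polynomial_function (\<lambda>x. p' x v)"
proof -
  have "\<forall>b\<in>Basis. \<exists>f'. (\<forall>x. ((\<lambda>x. p x \<bullet> b) has_derivative f' x) (at x)) \<and>
      (\<forall>v. real_polynomial_function (\<lambda>x. f' x v))"
    using assms real_polynomial_has_derivative polynomial_function_iff_Basis_inner by blast
  then obtain F where F: "\<And>b x. b \<in> Basis \<Longrightarrow> ((\<lambda>x. p x \<bullet> b) has_derivative F b x) (at x)"
     "\<And>b v. b \<in> Basis \<Longrightarrow> real_polynomial_function (\<lambda>x. F b x v)" by metis
  show ?thesis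
  proof
    show "(p has_derivative (\<lambda>v. \<Sum>b\<in>Basis. F b x v *\<^sub>R b)) (at x)" for x
      unfolding has_derivative_componentwise_within[of p] using F(1) by (simp add: inner_sum_left_Basis)
    show "polynomial_function (\<lambda>x. \<Sum>b\<in>Basis. F b x v *\<^sub>R b)" for v
      using F(2) by (auto simp: polynomial_function_iff_Basis_inner inner_sum_left_Basis)
  qed
qed



text \<open>A product rule in which the second factor is merely continuous: the scalar factor
  vanishes at \<open>y0\<close> and absorbs its variation. It lets an inverse be differentiated when
  only its continuity is known.\<close>

lemma has_derivative_scaleR_continuous:
  fixes q :: "'a::euclidean_space \<Rightarrow> real" and k :: "'a \<Rightarrow> 'b::euclidean_space"
  assumes q: "(q has_derivative q') (at y0)" "q y0 = 0" and k: "isCont k y0"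
  shows "((\<lambda>y. q y *\<^sub>R k y) has_derivative (\<lambda>w. q' w *\<^sub>R k y0)) (at y0)"
proof -
  have bl: "bounded_linear q'" using q(1) by (rule has_derivative_bounded_linear)
  obtain B where B: "\<And>w. norm (q' w) \<le> norm w * B"
    using bounded_linear.bounded[OF bl] by blast
  have q0: "((\<lambda>y. norm (q y - q' (y - y0)) / norm (y - y0)) \<longlongrightarrow> 0) (at y0)"
    using q by (simp add: has_derivative_iff_norm)
  have k0: "((\<lambda>y. k y) \<longlongrightarrow> k y0) (at y0)" using k by (simp add: isCont_def)
  have "((\<lambda>y. (norm (q y - q' (y - y0)) / norm (y - y0)) * norm (k y) + B * norm (k y - k y0))
      \<longlongrightarrow> 0 * norm (k y0) + B * norm (k y0 - k y0)) (at y0)"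
    by (intro tendsto_intros q0 k0)
  then have lim: "((\<lambda>y. (norm (q y - q' (y - y0)) / norm (y - y0)) * norm (k y) + B * norm (k y - k y0))
      \<longlongrightarrow> 0) (at y0)" by simp
  have "((\<lambda>y. norm (q y *\<^sub>R k y - q' (y - y0) *\<^sub>R k y0) / norm (y - y0)) \<longlongrightarrow> 0) (at y0)"
  proof (rule real_tendsto_sandwich[OF _ _ tendsto_const lim])
    show "\<forall>\<^sub>F y in at y0. norm (q y *\<^sub>R k y - q' (y - y0) *\<^sub>R k y0) / norm (y - y0)
        \<le> (norm (q y - q' (y - y0)) / norm (y - y0)) * norm (k y) + B * norm (k y - k y0)"
      unfolding eventually_at_filter
    proof (intro always_eventually allI impI)
      fix y assume "y \<noteq> y0"
      then have pos: "norm (y - y0) > 0" by simp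
      have eq: "q y *\<^sub>R k y - q' (y - y0) *\<^sub>R k y0
          = (q y - q' (y - y0)) *\<^sub>R k y + q' (y - y0) *\<^sub>R (k y - k y0)"
        by (simp add: algebra_simps)
      have "norm (q y *\<^sub>R k y - q' (y - y0) *\<^sub>R k y0)
          \<le> norm (q y - q' (y - y0)) * norm (k y) + norm (q' (y - y0)) * norm (k y - k y0)"
        unfolding eq by (rule order_trans[OF norm_triangle_ineq]) simp
      also have "\<dots> \<le> norm (q y - q' (y - y0)) * norm (k y) + (norm (y - y0) * B) * norm (k y - k y0)"
        by (intro add_left_mono mult_right_mono B) simp
      finally show "norm (q y *\<^sub>R k y - q' (y - y0) *\<^sub>R k y0) / norm (y - y0)
        \<le> (norm (q y - q' (y - y0)) / norm (y - y0)) * norm (k y) + B * norm (k y - k y0)"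
        using pos by (simp add: field_simps)
    qed
  qed simp
  moreover have "bounded_linear (\<lambda>w. q' w *\<^sub>R k y0)"
    by (rule bounded_linear_compose[OF bounded_linear_scaleR_left bl])
  ultimately show ?thesis using q(2) by (simp add: has_derivative_iff_norm)
qed

lemma linear_expand_Basis:
  fixes x :: "'a::euclidean_space"
  assumes "linear h" shows "h x = (\<Sum>b\<in>Basis. (x \<bullet> b) *\<^sub>R h b)"
proof -
  have "h x = h (\<Sum>b\<in>Basis. (x \<bullet> b) *\<^sub>R b)" by (simp add: euclidean_representation)
  also have "\<dots> = (\<Sum>b\<in>Basis. (x \<bullet> b) *\<^sub>R h b)"
    using assms by (simp add: linear_sum linear_cmul)
  finally show ?thesis .
qed

text \<open>Near \<open>y0\<close> the maps \<open>A y\<close> are bounded below by half the bound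
  for \<open>A y0\<close>, and \<open>A y\<close> sends \<open>J y v - J y0 v\<close> to
  \<open>v - A y (J y0 v)\<close>, which tends to 0.\<close>

lemma isCont_inverse_family:
  fixes A J :: "'a::euclidean_space \<Rightarrow> 'b::euclidean_space \<Rightarrow> 'b"
  assumes "open V" "y0 \<in> V" and cont: "\<And>v. isCont (\<lambda>y. A y v) y0"
    and lin: "\<And>y. y \<in> V \<Longrightarrow> linear (A y)"
    and AJ: "\<And>y v. y \<in> V \<Longrightarrow> A y (J y v) = v"
    and JA: "\<And>y v. y \<in> V \<Longrightarrow> J y (A y v) = v"
  shows "isCont (\<lambda>y. J y v) y0"
proof -
  have "inj (A y0)" using JA[OF assms(2)] by (metis injI)
  then obtain c where c: "c > 0" "\<And>x. norm (A y0 x) \<ge> c * norm x"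
    using linear_inj_bounded_below_pos[OF lin[OF assms(2)]] by metis
  \<comment> \<open>A bound for the operator norm of \<open>A y - A y0\<close>, computed from
    finitely many continuous functions.\<close>
  define S where "S y = (\<Sum>b\<in>Basis. norm (A y b - A y0 b))" for y
  have "isCont S y0" unfolding S_def using cont by (intro continuous_intros) auto
  then have "(S \<longlongrightarrow> 0) (at y0)" by (simp add: isCont_def S_def)
  then have ev: "\<forall>\<^sub>F y in at y0. S y < c / 2" using c by (intro order_tendstoD) auto
  have evV: "\<forall>\<^sub>F y in at y0. y \<in> V" using assms(1,2) by (simp add: eventually_at_in_open')
  define u where "u = J y0 v"
  have low: "norm (A y x) \<ge> c / 2 * norm x" if "S y < c / 2" "y \<in> V" for x y
  proof -
    have ls: "linear (\<lambda>x. A y x - A y0 x)" using lin that assms(2) by (intro linear_compose_sub) auto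
    have "norm (A y x - A y0 x) \<le> (\<Sum>b\<in>Basis. norm ((x \<bullet> b) *\<^sub>R (A y b - A y0 b)))"
      by (subst linear_expand_Basis[OF ls, of x]) (rule norm_sum)
    also have "\<dots> \<le> (\<Sum>b\<in>Basis. norm x * norm (A y b - A y0 b))"
      by (intro sum_mono) (auto intro!: mult_right_mono Basis_le_norm)
    also have "\<dots> = norm x * S y" by (simp add: S_def sum_distrib_left)
    also have "\<dots> \<le> norm x * (c / 2)" using that by (intro mult_left_mono) auto
    finally have "norm (A y x - A y0 x) \<le> norm x * (c / 2)" .
    moreover have "norm (A y0 x) \<le> norm (A y x) + norm (A y x - A y0 x)"
      using norm_triangle_sub norm_minus_commute by metis
    ultimately show ?thesis using c(2)[of x] by (simp add: algebra_simps)
  qed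
  have "((\<lambda>y. J y v - u) \<longlongrightarrow> 0) (at y0)"
  proof (rule Lim_null_comparison)
    show "\<forall>\<^sub>F y in at y0. norm (J y v - u) \<le> (2 / c) * norm (v - A y u)"
      using ev evV
    proof eventually_elim
      case (elim y)
      have "A y (J y v - u) = v - A y u" using lin[OF elim(2)] AJ[OF elim(2)] by (simp add: linear_diff)
      then have "c / 2 * norm (J y v - u) \<le> norm (v - A y u)" using low[OF elim, of "J y v - u"] by simp
      then show ?case using c(1) by (simp add: field_simps)
    qed
    have "((\<lambda>y. A y u) \<longlongrightarrow> A y0 u) (at y0)" using cont by (simp add: isCont_def)
    then have "((\<lambda>y. (2 / c) * norm (v - A y u)) \<longlongrightarrow> (2 / c) * norm (v - A y0 u)) (at y0)"
      by (intro tendsto_intros)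
    then show "((\<lambda>y. (2 / c) * norm (v - A y u)) \<longlongrightarrow> 0) (at y0)"
      using AJ[OF assms(2)] by (simp add: u_def)
  qed
  then show ?thesis by (simp add: isCont_def u_def LIM_zero_iff)
qed

text \<open>The resolvent identity J(y0) - J(y) = J(y) (A(y) - A(y0)) J(y0), expanded in a basis,
  writes \<open>J y v\<close> as a constant minus products of a scalar that vanishes at
  \<open>y0\<close> and a continuous \<open>J y b\<close>. The result is the usual derivative - J A'
  J.\<close>

lemma has_derivative_inverse_family:
  fixes A J :: "'a::euclidean_space \<Rightarrow> 'b::euclidean_space \<Rightarrow> 'b"
  assumes V: "open V" "y0 \<in> V" and der: "\<And>v. ((\<lambda>y. A y v) has_derivative A' v) (at y0)"
    and lin: "\<And>y. y \<in> V \<Longrightarrow> linear (A y)" "\<And>y. y \<in> V \<Longrightarrow> linear (J y)"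
    and AJ: "\<And>y v. y \<in> V \<Longrightarrow> A y (J y v) = v"
    and JA: "\<And>y v. y \<in> V \<Longrightarrow> J y (A y v) = v"
  shows "((\<lambda>y. J y v) has_derivative
           (\<lambda>w. - (\<Sum>e\<in>Basis. \<Sum>b\<in>Basis. ((J y0 v \<bullet> e) * (A' e w \<bullet> b)) *\<^sub>R J y0 b))) (at y0)"
proof -
  define u where "u = J y0 v"
  have cont: "isCont (\<lambda>y. J y b) y0" for b
    using isCont_inverse_family[OF V _ lin(1) AJ JA] has_derivative_continuous[OF der] by simp
  have eq: "J y0 v - (\<Sum>e\<in>Basis. \<Sum>b\<in>Basis. ((u \<bullet> e) * ((A y e - A y0 e) \<bullet> b)) *\<^sub>R J y b) = J y v"
    if y: "y \<in> V" for y
  proof -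
    have "(\<Sum>e\<in>Basis. \<Sum>b\<in>Basis. ((u \<bullet> e) * ((A y e - A y0 e) \<bullet> b)) *\<^sub>R J y b)
        = (\<Sum>e\<in>Basis. (u \<bullet> e) *\<^sub>R (\<Sum>b\<in>Basis. ((A y e - A y0 e) \<bullet> b) *\<^sub>R J y b))"
      by (simp add: scaleR_sum_right)
    also have "\<dots> = (\<Sum>e\<in>Basis. (u \<bullet> e) *\<^sub>R J y (A y e - A y0 e))"
      by (intro sum.cong arg_cong[where f="scaleR _"] linear_expand_Basis[OF lin(2)[OF y], symmetric] refl)
    also have "\<dots> = J y (\<Sum>e\<in>Basis. (u \<bullet> e) *\<^sub>R (A y e - A y0 e))"
      using lin(2)[OF y] by (simp add: linear_sum linear_cmul)
    also have "(\<Sum>e\<in>Basis. (u \<bullet> e) *\<^sub>R (A y e - A y0 e)) = A y u - A y0 u"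
      by (rule linear_expand_Basis[OF linear_compose_sub[OF lin(1)[OF y] lin(1)[OF V(2)]], symmetric])
    also have "J y (A y u - A y0 u) = u - J y v"
      using lin(2)[OF y] JA[OF y] AJ[OF V(2)] by (simp add: linear_diff u_def)
    finally show ?thesis by (simp add: u_def)
  qed
  have "((\<lambda>y. J y0 v - (\<Sum>e\<in>Basis. \<Sum>b\<in>Basis. ((u \<bullet> e) * ((A y e - A y0 e) \<bullet> b)) *\<^sub>R J y b))
      has_derivative (\<lambda>w. 0 - (\<Sum>e\<in>Basis. \<Sum>b\<in>Basis. ((u \<bullet> e) * (A' e w \<bullet> b)) *\<^sub>R J y0 b))) (at y0)"
  proof (intro has_derivative_diff has_derivative_const has_derivative_sum has_derivative_scaleR_continuous cont)
    fix e b
    have "((\<lambda>y. (u \<bullet> e) * ((A y e - A y0 e) \<bullet> b)) has_derivative (\<lambda>w. (u \<bullet> e) * ((A' e w - 0) \<bullet> b))) (at y0)"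
      by (intro has_derivative_mult_right has_derivative_inner_left has_derivative_diff has_derivative_const der)
    then show "((\<lambda>y. (u \<bullet> e) * ((A y e - A y0 e) \<bullet> b)) has_derivative (\<lambda>w. (u \<bullet> e) * (A' e w \<bullet> b))) (at y0)"
      by simp
  qed simp
  then have "((\<lambda>y. J y v) has_derivative (\<lambda>w. 0 - (\<Sum>e\<in>Basis. \<Sum>b\<in>Basis. ((u \<bullet> e) * (A' e w \<bullet> b)) *\<^sub>R J y0 b))) (at y0)"
    by (rule has_derivative_transform_within_open[OF _ V]) (rule eq)
  then show ?thesis by (simp add: u_def)
qed

text \<open>Bootstrapping: the derivative of \<open>q\<close> is the family \<open>J\<close> of
  inverses, and the derivative of \<open>J\<close> is polynomial in \<open>J\<close> and in second
  derivatives of \<open>p\<close> along \<open>q\<close>. Hence order \<open>k\<close> for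
  \<open>q\<close> and \<open>J\<close> together gives order \<open>Suc k\<close> for both.\<close>

lemma smooth_inverse_polynomial:
  fixes p q :: "'a::euclidean_space \<Rightarrow> 'a"
  assumes "open V" and p: "polynomial_function p"
    and p': "\<And>x. (p has_derivative p' x) (at x)"
    and q: "\<And>y. y \<in> V \<Longrightarrow> (q has_derivative inv (p' (q y))) (at y)"
    and bij: "\<And>y. y \<in> V \<Longrightarrow> bij (p' (q y))"
  shows "smooth_on_open q V"
proof -
  obtain p1 where p1: "\<And>x. (p has_derivative p1 x) (at x)" "\<And>v. polynomial_function (\<lambda>x. p1 x v)"
    using polynomial_has_derivative[OF p] by blast
  have "p1 = p'" using has_derivative_unique[OF p1(1) p'] by auto
  then have pol: "polynomial_function (\<lambda>x. p' x v)" for v using p1(2) by simp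
  have "\<forall>v. \<exists>p2. (\<forall>x. ((\<lambda>x. p' x v) has_derivative p2 x) (at x)) \<and> (\<forall>w. polynomial_function (\<lambda>x. p2 x w))"
    using polynomial_has_derivative[OF pol] by metis
  then obtain p2 where p2: "\<And>v x. ((\<lambda>x. p' x v) has_derivative p2 v x) (at x)"
    "\<And>v w. polynomial_function (\<lambda>x. p2 v x w)" by metis
  define J where "J y = inv (p' (q y))" for y
  have linA: "linear (p' x)" for x using p' has_derivative_linear by blast
  have linJ: "linear (J y)" if "y \<in> V" for y
    using q[OF that] has_derivative_linear by (auto simp: J_def)
  have AJ: "p' (q y) (J y v) = v" if "y \<in> V" for y v
    using bij[OF that] by (simp add: J_def bij_is_surj surj_f_inv_f)
  have JA: "J y (p' (q y) v) = v" if "y \<in> V" for y v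
    using bij[OF that] by (simp add: J_def bij_is_inj inv_f_f)
  have derA: "((\<lambda>y. p' (q y) v) has_derivative (\<lambda>w. p2 v (q y) (J y w))) (at y)" if "y \<in> V" for y v
    using has_derivative_compose[OF q[OF that] p2(1)] by (simp add: J_def)
  \<comment> \<open>The varying direction moves into scalar coefficients, so only polynomial maps
    with a fixed direction \<open>c\<close> are composed with \<open>q\<close>.\<close>
  have p2lin: "p2 e x w = (\<Sum>c\<in>Basis. (w \<bullet> c) *\<^sub>R p2 e x c)" for e x w
    by (rule linear_expand_Basis) (use p2(1) has_derivative_linear in blast)
  define D where "D v w y = (\<Sum>e\<in>Basis. \<Sum>b\<in>Basis.
      ((J y v \<bullet> e) * ((\<Sum>c\<in>Basis. (J y w \<bullet> c) *\<^sub>R p2 e (q y) c) \<bullet> b)) *\<^sub>R J y b)" for v w y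
  have derJ: "((\<lambda>y. J y v) has_derivative (\<lambda>w. (- 1) *\<^sub>R D v w y)) (at y)" if "y \<in> V" for y v
  proof -
    have "((\<lambda>y. J y v) has_derivative (\<lambda>w. - (\<Sum>e\<in>Basis. \<Sum>b\<in>Basis.
        ((J y v \<bullet> e) * (p2 e (q y) (J y w) \<bullet> b)) *\<^sub>R J y b))) (at y)"
      by (rule has_derivative_inverse_family[OF assms(1) that derA[OF that] linA linJ AJ JA])
    moreover have "p2 e (q y) (J y w) = (\<Sum>c\<in>Basis. (J y w \<bullet> c) *\<^sub>R p2 e (q y) c)" for e w
      by (rule p2lin)
    ultimately show ?thesis by (simp add: D_def)
  qed
  have "C_diff_on k q V \<and> (\<forall>v. C_diff_on k (\<lambda>y. J y v) V)" for k
  proof (induction k)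
    case 0
    have "continuous_on V q"
      using q has_derivative_continuous by (blast intro: continuous_at_imp_continuous_on)
    moreover have "continuous_on V (\<lambda>y. J y v)" for v
      using derJ has_derivative_continuous by (blast intro: continuous_at_imp_continuous_on)
    ultimately show ?case by simp
  next
    case (Suc k)
    have "C_diff_on (Suc k) q V"
      by (rule C_diff_on_SucI[OF assms(1) q]) (use Suc in \<open>auto simp: J_def\<close>)
    moreover have "C_diff_on (Suc k) (\<lambda>y. J y v) V" for v
    proof (rule C_diff_on_SucI[OF assms(1) derJ])
      fix w
      have in1: "C_diff_on k (\<lambda>y. J y u \<bullet> e) V" for u e
        using C_diff_on_bounded_linear[OF assms(1) bounded_linear_inner_left[of e]] Suc by blast
      have "C_diff_on k (\<lambda>y. p2 e (q y) c) V" for e c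
        using C_diff_on_polynomial_compose[OF assms(1) p2(2)[of e c]] Suc by blast
      then have "C_diff_on k (\<lambda>y. \<Sum>c\<in>Basis. (J y w \<bullet> c) *\<^sub>R p2 e (q y) c) V" for e
        using in1 by (auto intro!: C_diff_on_sum C_diff_on_scaleR assms(1))
      then have in2: "C_diff_on k (\<lambda>y. (\<Sum>c\<in>Basis. (J y w \<bullet> c) *\<^sub>R p2 e (q y) c) \<bullet> b) V" for e b
        using C_diff_on_bounded_linear[OF assms(1) bounded_linear_inner_left[of b]] by blast
      show "C_diff_on k (\<lambda>y. (- 1) *\<^sub>R D v w y) V"
        unfolding D_def
        using Suc in1 in2
        by (intro C_diff_on_scaleR C_diff_on_const C_diff_on_sum C_diff_on_mult assms(1)) auto
    qed
    ultimately show ?case by blast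
  qed
  then show ?thesis using assms(1) by (simp add: smooth_on_open_def)
qed

text \<open>
  The chart is \<open>x \<mapsto> x + h (F x - D x)\<close> for a linear right inverse \<open>h\<close> of the derivative \<open>D\<close> of
  \<open>F\<close> at \<open>x\<^sub>0\<close>: its derivative at \<open>x\<^sub>0\<close> is the identity, and it carries the zeros of \<open>F\<close> on the
  subspace \<open>H\<close> to the kernel of \<open>D\<close> on \<open>H\<close>.
\<close>

lemma level_set_chart:
  fixes F :: "'a::euclidean_space \<Rightarrow> 'b::euclidean_space" and O' :: "'a set"
  assumes H: "subspace H" and F: "polynomial_function F" and O: "open O'" "x0 \<in> O'"
    and D: "(F has_derivative D) (at x0)"
    and FH: "F ` H \<subseteq> D ` H"
  shows "\<exists>U V (\<phi> :: 'a \<Rightarrow> 'a) \<psi> L. x0 \<in> U \<and> U \<subseteq> O' \<and> open U \<and> open V \<and> homeomorphism U V \<phi> \<psi> \<and>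
     smooth_on_open \<phi> U \<and> smooth_on_open \<psi> V \<and> subspace L \<and> dim L + dim (D ` H) = dim H \<and>
     \<phi> ` ({x\<in>H. F x = 0} \<inter> U) = L \<inter> V"
proof -
  have linD: "linear D" using D has_derivative_linear by blast
  obtain h where h: "linear h" "\<And>y. h y \<in> H" "\<And>y. y \<in> D ` H \<Longrightarrow> D (h y) = y"
    using linear_exists_right_inverse_on[OF linD H] by blast
  define \<phi> where "\<phi> x = x + h (F x - D x)" for x
  have polh: "polynomial_function h" and polD: "polynomial_function D"
    using h(1) linD by (auto intro: polynomial_function_bounded_linear linear_conv_bounded_linear[THEN iffD1])
  have pol: "polynomial_function \<phi>"
    unfolding \<phi>_def using polynomial_function_compose[OF polynomial_function_diff[OF F polD] polh]
    by (intro polynomial_function_add polynomial_function_id) (simp add: o_def)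
  obtain p' where p': "\<And>x. (\<phi> has_derivative p' x) (at x)" "\<And>v. polynomial_function (\<lambda>x. p' x v)"
    using polynomial_has_derivative[OF pol] by blast
  have "(\<phi> has_derivative (\<lambda>v. v + h (D v - D v))) (at x0)"
    unfolding \<phi>_def
    by (intro has_derivative_add has_derivative_ident has_derivative_diff D
        bounded_linear_imp_has_derivative bounded_linear.has_derivative[of h])
      (use h(1) linD linear_conv_bounded_linear in auto)
  then have p'0: "p' x0 = (\<lambda>v. v)"
    using has_derivative_unique[OF p'(1)] h(1) by (simp add: linear_0)
  define f' where "f' x = Blinfun (p' x)" for x
  have f'_app: "blinfun_apply (f' x) = p' x" for x
    unfolding f'_def using p'(1) has_derivative_bounded_linear bounded_linear_Blinfun_apply by blast
  have contf: "continuous_on O' f'"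
    by (rule continuous_on_blinfun_componentwise)
      (use p'(2) in \<open>auto simp: f'_app intro: continuous_on_polymonial_function\<close>)
  have der: "\<And>x. x \<in> O' \<Longrightarrow> (\<phi> has_derivative blinfun_apply (f' x)) (at x)" using p' f'_app by simp
  have inv0: "id_blinfun o\<^sub>L f' x0 = id_blinfun"
    by (rule blinfun_eqI) (simp add: f'_app p'0)
  obtain U V \<psi> g' where UV: "open U" "U \<subseteq> O'" "x0 \<in> U" "open V" "homeomorphism U V \<phi> \<psi>"
    "\<And>y. y \<in> V \<Longrightarrow> (\<psi> has_derivative (g' y)) (at y)"
    "\<And>y. y \<in> V \<Longrightarrow> g' y = inv (blinfun_apply (f'(\<psi> y)))"
    "\<And>y. y \<in> V \<Longrightarrow> bij (blinfun_apply (f'(\<psi> y)))"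
    using inverse_function_theorem[OF O(1) der contf O(2) inv0] by metis
  \<comment> \<open>The inverse function theorem supplies only the first derivative of
    \<open>\<psi>\<close>.\<close>
  have smooth: "smooth_on_open \<psi> V"
    by (rule smooth_inverse_polynomial[OF UV(4) pol p'(1)]) (use UV(6-8) f'_app in auto)
  define L where "L = {x\<in>H. D x = 0}"
  have subL: "subspace L"
    unfolding L_def using H linD by (auto simp: subspace_def linear_0 linear_add linear_cmul)
  have dimL: "dim L + dim (D ` H) = dim H"
  proof -
    have subR: "subspace (D ` H)" using linear_subspace_image[OF linD H] .
    \<comment> \<open>\<open>H\<close> is the direct sum of the kernel of \<open>D\<close> on
      \<open>H\<close> and the image of its right inverse, via z = (z - h (D z)) + h (D z).\<close>
    have "{x + y |x y. x \<in> L \<and> y \<in> h ` D ` H} = H"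
    proof
      show "{x + y |x y. x \<in> L \<and> y \<in> h ` D ` H} \<subseteq> H"
        using h(2) H by (auto simp: L_def subspace_add)
      show "H \<subseteq> {x + y |x y. x \<in> L \<and> y \<in> h ` D ` H}"
      proof
        fix z assume z: "z \<in> H"
        then have "z - h (D z) \<in> L"
          using h H linD by (simp add: L_def subspace_diff linear_diff)
        then have "\<exists>x y. z = x + y \<and> x \<in> L \<and> y \<in> h ` D ` H"
          using z by (intro exI[of _ "z - h (D z)"] exI[of _ "h (D z)"]) simp
        then show "z \<in> {x + y |x y. x \<in> L \<and> y \<in> h ` D ` H}" by blast
      qed
    qed
    moreover have "L \<inter> h ` D ` H = {0}"
    proof -
      have "0 \<in> h ` D ` H" 
        using subspace_0[OF linear_subspace_image[OF h(1) subR]] .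
      moreover have "y = 0" if "y \<in> L" "y \<in> h ` D ` H" for y
        using that h(3) linear_0[OF h(1)] by (auto simp: L_def)
      ultimately show ?thesis using subspace_0[OF subL] by blast
    qed
    moreover have "dim (h ` D ` H) = dim (D ` H)"
    proof (rule dim_image_eq[OF h(1)])
      show "inj_on h (span (D ` H))"
        using h(3) subR by (metis inj_on_inverseI span_eq_iff)
    qed
    ultimately show ?thesis
      using dim_sums_Int[OF subL linear_subspace_image[OF h(1) subR]] by simp
  qed
  have iff: "\<phi> x \<in> L \<longleftrightarrow> x \<in> {x\<in>H. F x = 0}" for x
  proof -
    have inH: "\<phi> x \<in> H \<longleftrightarrow> x \<in> H"
      unfolding \<phi>_def using h(2) H by (metis add_diff_cancel_right' subspace_add subspace_diff)
    have "D (\<phi> x) = F x" if "x \<in> H"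
    proof -
      have "F x - D x \<in> D ` H"
        using FH that linear_subspace_image[OF linD H] by (simp add: image_subset_iff subspace_diff)
      then show ?thesis by (simp add: \<phi>_def linear_add[OF linD] h(3))
    qed
    then show ?thesis using inH by (auto simp: L_def)
  qed
  have "\<phi> ` ({x\<in>H. F x = 0} \<inter> U) = L \<inter> V"
  proof
    show "\<phi> ` ({x\<in>H. F x = 0} \<inter> U) \<subseteq> L \<inter> V"
      using iff UV(5) by (auto simp: homeomorphism_def)
    show "L \<inter> V \<subseteq> \<phi> ` ({x\<in>H. F x = 0} \<inter> U)"
    proof
      fix y assume y: "y \<in> L \<inter> V"
      then have "\<psi> y \<in> U" "\<phi> (\<psi> y) = y" using UV(5) by (auto simp: homeomorphism_def)
      then show "y \<in> \<phi> ` ({x\<in>H. F x = 0} \<inter> U)" using iff[of "\<psi> y"] y by (metis IntD1 IntI image_eqI)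
    qed
  qed
  then show ?thesis
    using UV smooth smooth_on_open_polynomial[OF UV(1) pol] subL dimL by blast
qed

text \<open>A transition map between charts of \<open>W\<close> and of \<open>S\<close> is a
  continuous injection of a nonempty open piece of one model subspace into the other, so invariance
  of dimension applies.\<close>

lemma submanifold_dim_le:
  fixes S :: "'a::euclidean_space set"
  assumes t: "smooth_submanifold t S" and W: "W \<noteq> {}" "openin (top_of_set S) W" "smooth_submanifold t' W"
  shows "t' \<le> t"
proof -
  obtain x where x: "x \<in> W" using W by blast
  obtain T where T: "open T" "W = S \<inter> T" using W(2) by (auto simp: openin_open)
  have "x \<in> S" using x T by blast
  obtain U V \<phi> \<psi> L where c: "x \<in> U" "homeomorphism U V \<phi> (\<psi>::'a\<Rightarrow>'a)" "smooth_on_open \<phi> U"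
     "smooth_on_open \<psi> V" "subspace L" "dim L = t" "\<phi> ` (S \<inter> U) = L \<inter> V"
    using t \<open>x \<in> S\<close> unfolding smooth_submanifold_def by metis
  obtain U' V' \<phi>' \<psi>' L' where c': "x \<in> U'" "homeomorphism U' V' \<phi>' (\<psi>'::'a\<Rightarrow>'a)" "smooth_on_open \<phi>' U'"
     "smooth_on_open \<psi>' V'" "subspace L'" "dim L' = t'" "\<phi>' ` (W \<inter> U') = L' \<inter> V'"
    using W(3) x unfolding smooth_submanifold_def by metis
  have op: "open U" "open V" "open U'" "open V'"
    using c(3,4) c'(3,4) by (auto simp: smooth_on_open_def)
  \<comment> \<open>The part of the model of \<open>W\<close> on which the transition map
    \<open>\<phi> \<circ> \<psi>'\<close> is defined.\<close>
  define Z where "Z = \<phi>' ` (W \<inter> U' \<inter> U)"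
  have Zeq: "Z = L' \<inter> (V' \<inter> \<psi>' -` U)"
  proof
    show "Z \<subseteq> L' \<inter> (V' \<inter> \<psi>' -` U)"
      using c'(7) c'(2) unfolding Z_def by (auto simp: homeomorphism_def)
    show "L' \<inter> (V' \<inter> \<psi>' -` U) \<subseteq> Z"
    proof
      fix y assume y: "y \<in> L' \<inter> (V' \<inter> \<psi>' -` U)"
      then obtain z where z: "z \<in> W \<inter> U'" "y = \<phi>' z" using c'(7) by blast
      then have "\<psi>' y = z" using c'(2) by (auto simp: homeomorphism_def)
      then show "y \<in> Z" using z y by (auto simp: Z_def)
    qed
  qed
  have "continuous_on V' \<psi>'" using c'(2) by (simp add: homeomorphism_def)
  then have "open (V' \<inter> \<psi>' -` U)"
    using op continuous_open_preimage by blast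
  then have oZ: "openin (top_of_set L') Z" using Zeq openin_open_Int by metis
  have Zsub: "\<psi>' ` Z \<subseteq> S \<inter> U"
  proof -
    have "\<psi>' (\<phi>' z) = z" if "z \<in> U'" for z using c'(2) that by (auto simp: homeomorphism_def)
    then show ?thesis using T by (auto simp: Z_def)
  qed
  have ZV: "Z \<subseteq> V'" using Zeq by blast
  have "dim L' \<le> dim L"
  proof (rule invariance_of_dimension_subspaces[OF oZ c'(5) c(5)])
    show "continuous_on Z (\<phi> \<circ> \<psi>')"
    proof (rule continuous_on_compose)
      show "continuous_on Z \<psi>'" using c'(2) ZV by (auto simp: homeomorphism_def intro: continuous_on_subset)
      show "continuous_on (\<psi>' ` Z) \<phi>" using c(2) Zsub by (auto simp: homeomorphism_def intro: continuous_on_subset)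
    qed
    show "\<phi> \<circ> \<psi>' \<in> Z \<rightarrow> L" using Zsub c(7) by fastforce
    show "inj_on (\<phi> \<circ> \<psi>') Z"
    proof (rule comp_inj_on)
      show "inj_on \<psi>' Z" using c'(2) ZV by (intro inj_on_inverseI[of _ \<phi>']) (auto simp: homeomorphism_def)
      show "inj_on \<phi> (\<psi>' ` Z)" using c(2) Zsub by (intro inj_on_inverseI[of _ \<psi>]) (auto simp: homeomorphism_def)
    qed
    show "Z \<noteq> {}" using x c c' by (auto simp: Z_def)
  qed
  then show ?thesis using c c' by simp
qed

section \<open>Real polynomial functions form a Noetherian ring\<close>

definition function_subring :: "('a \<Rightarrow> real) set \<Rightarrow> bool" where
  "function_subring K \<longleftrightarrow> (\<forall>c. (\<lambda>x. c) \<in> K) \<and>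
     (\<forall>f\<in>K. \<forall>g\<in>K. (\<lambda>x. f x + g x) \<in> K \<and> (\<lambda>x. f x * g x) \<in> K)"

definition function_ideal :: "('a \<Rightarrow> real) set \<Rightarrow> ('a \<Rightarrow> real) set \<Rightarrow> bool" where
  "function_ideal K I \<longleftrightarrow> I \<subseteq> K \<and> (\<lambda>x. 0) \<in> I \<and>
     (\<forall>f\<in>I. \<forall>g\<in>I. (\<lambda>x. f x + g x) \<in> I) \<and> (\<forall>k\<in>K. \<forall>f\<in>I. (\<lambda>x. k x * f x) \<in> I)"

text \<open>Finite generation is phrased by minimality among ideals, so that linear combinations of
  generators never have to be written out.\<close>

definition noetherian_functions :: "('a \<Rightarrow> real) set \<Rightarrow> bool" where
  "noetherian_functions K \<longleftrightarrow> (\<forall>I. function_ideal K I \<longrightarrow>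
     (\<exists>B. finite B \<and> B \<subseteq> I \<and> (\<forall>I'. function_ideal K I' \<and> B \<subseteq> I' \<longrightarrow> I \<subseteq> I')))"

text \<open>The ring K[\<xi>] as functions, that is, the image of the polynomial ring over
  \<open>K\<close>; \<open>\<xi>\<close> may satisfy relations over \<open>K\<close>.\<close>

definition adjoin_function :: "('a \<Rightarrow> real) set \<Rightarrow> ('a \<Rightarrow> real) \<Rightarrow> ('a \<Rightarrow> real) set" where
  "adjoin_function K \<xi> = {f. \<exists>n c. (\<forall>i. c i \<in> K) \<and> f = (\<lambda>x. \<Sum>i\<le>n. c i x * \<xi> x ^ i)}"

text \<open>
  The coefficients at \<open>\<xi>\<^sup>m\<close> of the elements of \<open>I\<close> that can be written with degree at most \<open>m\<close> in
  \<open>\<xi>\<close>; such a representation need not be unique.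
\<close>

definition leading_coeffs ::
    "('a \<Rightarrow> real) set \<Rightarrow> ('a \<Rightarrow> real) \<Rightarrow> ('a \<Rightarrow> real) set \<Rightarrow> nat \<Rightarrow> ('a \<Rightarrow> real) set" where
  "leading_coeffs K \<xi> I m =
     {c m |c. (\<forall>i. c i \<in> K) \<and> (\<lambda>x. \<Sum>i\<le>m. c i x * \<xi> x ^ i) \<in> I}"

lemma leading_coeffs_iff:
  "k \<in> leading_coeffs K \<xi> I m \<longleftrightarrow>
     (\<exists>c. (\<forall>i. c i \<in> K) \<and> (\<lambda>x. \<Sum>i\<le>m. c i x * \<xi> x ^ i) \<in> I \<and> c m = k)"
  unfolding leading_coeffs_def mem_Collect_eq by metis

lemma
  assumes "function_subring K" "f \<in> K" "g \<in> K"
  shows function_subring_add: "(\<lambda>x. f x + g x) \<in> K"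
    and function_subring_mult: "(\<lambda>x. f x * g x) \<in> K"
  using assms by (simp_all add: function_subring_def)

lemma function_subring_const: "function_subring K \<Longrightarrow> (\<lambda>x. c) \<in> K"
  by (simp add: function_subring_def)

lemma function_ideal_add:
  "function_ideal K I \<Longrightarrow> f \<in> I \<Longrightarrow> g \<in> I \<Longrightarrow> (\<lambda>x. f x + g x) \<in> I"
  by (simp add: function_ideal_def)

lemma function_ideal_mult:
  "function_ideal K I \<Longrightarrow> k \<in> K \<Longrightarrow> f \<in> I \<Longrightarrow> (\<lambda>x. k x * f x) \<in> I"
  by (simp add: function_ideal_def)

lemma function_subring_sum:
  assumes "function_subring K" "\<And>i. i \<in> A \<Longrightarrow> f i \<in> K"
  shows "(\<lambda>x. \<Sum>i\<in>A. f i x) \<in> K"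
  using assms(2)
  by (induction A rule: infinite_finite_induct) (use assms(1) in \<open>auto simp: function_subring_def\<close>)

lemma adjoin_function_base: "function_subring K \<Longrightarrow> k \<in> K \<Longrightarrow> k \<in> adjoin_function K \<xi>"
  unfolding adjoin_function_def by (auto intro!: exI[of _ 0] exI[of _ "\<lambda>_. k"])

lemma adjoin_function_generator:
  assumes "function_subring K" shows "\<xi> \<in> adjoin_function K \<xi>"
proof -
  have "(\<lambda>x. \<Sum>i\<le>1. (if i = 1 then 1 else 0) * \<xi> x ^ i) = \<xi>"
    by (simp add: atMost_Suc)
  then show ?thesis
    unfolding adjoin_function_def using assms
    by (intro CollectI exI[of _ "1::nat"] exI[of _ "\<lambda>i x. if i = 1 then 1 else 0"])
      (auto simp: function_subring_def)
qed

lemma adjoin_functionI: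
  assumes K: "function_subring K" and c: "\<And>i. i \<le> n \<Longrightarrow> c i \<in> K"
    and f: "\<And>x. f x = (\<Sum>i\<le>n. c i x * \<xi> x ^ i)"
  shows "f \<in> adjoin_function K \<xi>"
proof -
  have "\<forall>i. (if i \<le> n then c i else (\<lambda>x. 0)) \<in> K"
    using c K by (auto simp: function_subring_def)
  moreover have "f = (\<lambda>x. \<Sum>i\<le>n. (if i \<le> n then c i else (\<lambda>x. 0)) x * \<xi> x ^ i)"
    using f by (auto intro!: sum.cong)
  ultimately show ?thesis unfolding adjoin_function_def
    by (intro CollectI exI[of _ n] exI[of _ "\<lambda>i. if i \<le> n then c i else (\<lambda>x. 0)"] conjI)
qed

lemma function_subring_adjoin:
  assumes K: "function_subring K"
  shows "function_subring (adjoin_function K \<xi>)"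
proof -
  have "(\<lambda>x. f x + g x) \<in> adjoin_function K \<xi> \<and> (\<lambda>x. f x * g x) \<in> adjoin_function K \<xi>"
    if fg: "f \<in> adjoin_function K \<xi>" "g \<in> adjoin_function K \<xi>" for f g
  proof -
    obtain n c where c: "\<And>i. c i \<in> K" "f = (\<lambda>x. \<Sum>i\<le>n. c i x * \<xi> x ^ i)"
      using fg(1) by (auto simp: adjoin_function_def)
    obtain m d where d: "\<And>i. d i \<in> K" "g = (\<lambda>x. \<Sum>i\<le>m. d i x * \<xi> x ^ i)"
      using fg(2) by (auto simp: adjoin_function_def)
    define c' where "c' i = (if i \<le> n then c i else (\<lambda>x. 0))" for i
    define d' where "d' i = (if i \<le> m then d i else (\<lambda>x. 0))" for i
    have cd: "c' i \<in> K" "d' i \<in> K" for i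
      using c(1) d(1) K by (auto simp: c'_def d'_def function_subring_def)
    have f: "f x = (\<Sum>i\<le>n+m. c' i x * \<xi> x ^ i)" for x
      unfolding c(2) by (rule sum.mono_neutral_cong_left) (auto simp: c'_def)
    have g: "g x = (\<Sum>i\<le>n+m. d' i x * \<xi> x ^ i)" for x
      unfolding d(2) by (rule sum.mono_neutral_cong_left) (auto simp: d'_def)
    have "(\<lambda>x. f x + g x) \<in> adjoin_function K \<xi>"
    proof (rule adjoin_functionI[OF K])
      show "(\<lambda>x. c' i x + d' i x) \<in> K" for i using cd K by (simp add: function_subring_def)
      show "f x + g x = (\<Sum>i\<le>n+m. (c' i x + d' i x) * \<xi> x ^ i)" for x
        by (simp add: f g sum.distrib algebra_simps)
    qed
    moreover have "(\<lambda>x. f x * g x) \<in> adjoin_function K \<xi>"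
    proof (rule adjoin_functionI[OF K])
      show "(\<lambda>x. \<Sum>j\<le>k. c' j x * d' (k - j) x) \<in> K" for k
        using cd K by (intro function_subring_sum) (auto simp: function_subring_def)
      have *: "f x * g x = (\<Sum>k\<le>n+m. (\<Sum>j\<le>k. c' j x * d' (k - j) x) * \<xi> x ^ k)" for x
      proof -
        have "f x = (\<Sum>i\<le>n. c' i x * \<xi> x ^ i)" "g x = (\<Sum>i\<le>m. d' i x * \<xi> x ^ i)"
          unfolding c(2) d(2) by (auto simp: c'_def d'_def)
        then show ?thesis
          using polynomial_product[of n "\<lambda>i. c' i x" m "\<lambda>i. d' i x" "\<xi> x"]
          by (simp add: c'_def d'_def)
      qed
      then show "f x * g x = (\<Sum>k\<le>n+m. (\<lambda>x. \<Sum>j\<le>k. c' j x * d' (k - j) x) x * \<xi> x ^ k)" for x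
        by simp
    qed
    ultimately show ?thesis ..
  qed
  then show ?thesis
    using K adjoin_function_base[OF K] by (auto simp: function_subring_def)
qed

lemma function_ideal_leading_coeffs:
  assumes K: "function_subring K" and I: "function_ideal (adjoin_function K \<xi>) I"
  shows "function_ideal K (leading_coeffs K \<xi> I m)"
  unfolding function_ideal_def
proof (intro conjI ballI)
  show "leading_coeffs K \<xi> I m \<subseteq> K" by (auto simp: leading_coeffs_def)
  show "(\<lambda>x. 0) \<in> leading_coeffs K \<xi> I m"
    unfolding leading_coeffs_def using I K
    by (intro CollectI exI[of _ "\<lambda>_ _. 0"]) (simp add: function_ideal_def function_subring_def)
next
  fix f g assume "f \<in> leading_coeffs K \<xi> I m" "g \<in> leading_coeffs K \<xi> I m"
  then obtain c d where c: "\<And>i. c i \<in> K" "(\<lambda>x. \<Sum>i\<le>m. c i x * \<xi> x ^ i) \<in> I" "f = c m"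
    and d: "\<And>i. d i \<in> K" "(\<lambda>x. \<Sum>i\<le>m. d i x * \<xi> x ^ i) \<in> I" "g = d m"
    by (auto simp: leading_coeffs_def)
  have "(\<lambda>x. (\<Sum>i\<le>m. c i x * \<xi> x ^ i) + (\<Sum>i\<le>m. d i x * \<xi> x ^ i)) \<in> I"
    using c(2) d(2) I by (simp add: function_ideal_def)
  then have "(\<lambda>x. \<Sum>i\<le>m. (c i x + d i x) * \<xi> x ^ i) \<in> I"
    by (simp add: sum.distrib algebra_simps)
  then show "(\<lambda>x. f x + g x) \<in> leading_coeffs K \<xi> I m"
    unfolding leading_coeffs_def using c d K
    by (intro CollectI exI[of _ "\<lambda>i x. c i x + d i x"]) (simp add: function_subring_def)
next
  fix k f assume k: "k \<in> K" and "f \<in> leading_coeffs K \<xi> I m"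
  then obtain c where c: "\<And>i. c i \<in> K" "(\<lambda>x. \<Sum>i\<le>m. c i x * \<xi> x ^ i) \<in> I" "f = c m"
    by (auto simp: leading_coeffs_def)
  have "(\<lambda>x. k x * (\<Sum>i\<le>m. c i x * \<xi> x ^ i)) \<in> I"
    using c(2) I adjoin_function_base[OF K k] by (simp add: function_ideal_def)
  then have "(\<lambda>x. \<Sum>i\<le>m. (k x * c i x) * \<xi> x ^ i) \<in> I"
    by (simp add: sum_distrib_left algebra_simps)
  then show "(\<lambda>x. k x * f x) \<in> leading_coeffs K \<xi> I m"
    unfolding leading_coeffs_def using c k K
    by (intro CollectI exI[of _ "\<lambda>i x. k x * c i x"]) (simp add: function_subring_def)
qed

lemma leading_coeffs_Suc:
  assumes K: "function_subring K" and I: "function_ideal (adjoin_function K \<xi>) I"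
  shows "leading_coeffs K \<xi> I m \<subseteq> leading_coeffs K \<xi> I (Suc m)"
proof
  fix f assume "f \<in> leading_coeffs K \<xi> I m"
  then obtain c where c: "\<And>i. c i \<in> K" "(\<lambda>x. \<Sum>i\<le>m. c i x * \<xi> x ^ i) \<in> I" "f = c m"
    by (auto simp: leading_coeffs_def)
  define c' where "c' i = (case i of 0 \<Rightarrow> (\<lambda>x. 0) | Suc j \<Rightarrow> c j)" for i
  have "(\<lambda>x. \<xi> x * (\<Sum>i\<le>m. c i x * \<xi> x ^ i)) \<in> I"
    using c(2) I adjoin_function_generator[OF K] by (simp add: function_ideal_def)
  moreover have "\<xi> x * (\<Sum>i\<le>m. c i x * \<xi> x ^ i) = (\<Sum>i\<le>Suc m. c' i x * \<xi> x ^ i)" for x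
    by (subst sum.atMost_Suc_shift) (simp add: c'_def sum_distrib_left algebra_simps)
  ultimately have "(\<lambda>x. \<Sum>i\<le>Suc m. c' i x * \<xi> x ^ i) \<in> I" by simp
  then show "f \<in> leading_coeffs K \<xi> I (Suc m)"
    unfolding leading_coeffs_def using c K
    by (intro CollectI exI[of _ c']) (auto simp: c'_def function_subring_def split: nat.split)
qed

lemma leading_coeffs_mono_degree:
  assumes "function_subring K" "function_ideal (adjoin_function K \<xi>) I" "m \<le> n"
  shows "leading_coeffs K \<xi> I m \<subseteq> leading_coeffs K \<xi> I n"
  using lift_Suc_mono_le[of "leading_coeffs K \<xi> I"] leading_coeffs_Suc[OF assms(1,2)] assms(3) by blast

text \<open>Induction on the degree: subtracting an element of \<open>I0\<close> with the same
  leading coefficient lowers the degree, and \<open>I0 \<subseteq> I\<close> keeps the difference in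
  \<open>I\<close>.\<close>

lemma ideal_subset_if_leading_coeffs_subset:
  assumes K: "function_subring K" and I: "function_ideal (adjoin_function K \<xi>) I"
    and I0: "function_ideal (adjoin_function K \<xi>) I0" "I0 \<subseteq> I"
    and lead: "\<And>n. leading_coeffs K \<xi> I n \<subseteq> leading_coeffs K \<xi> I0 n"
  shows "I \<subseteq> I0"
proof -
  have "(\<lambda>x. \<Sum>i\<le>n. c i x * \<xi> x ^ i) \<in> I0"
    if "\<And>i. c i \<in> K" "(\<lambda>x. \<Sum>i\<le>n. c i x * \<xi> x ^ i) \<in> I" for n c
    using that
  proof (induction n arbitrary: c)
    case 0
    then have "c 0 \<in> leading_coeffs K \<xi> I0 0"
      using lead[of 0] by (auto simp: leading_coeffs_def)
    then show ?case by (auto simp: leading_coeffs_def)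
  next
    case (Suc n)
    have "c (Suc n) \<in> leading_coeffs K \<xi> I0 (Suc n)"
      using lead[of "Suc n"] Suc.prems by (auto simp: leading_coeffs_def)
    then obtain d where "(\<forall>i. d i \<in> K) \<and> (\<lambda>x. \<Sum>i\<le>Suc n. d i x * \<xi> x ^ i) \<in> I0 \<and>
        d (Suc n) = c (Suc n)"
      unfolding leading_coeffs_iff by (rule exE)
    then have d: "\<And>i. d i \<in> K" "(\<lambda>x. \<Sum>i\<le>Suc n. d i x * \<xi> x ^ i) \<in> I0"
      "d (Suc n) = c (Suc n)" by blast+
    have m1: "(\<lambda>x. - 1) \<in> adjoin_function K \<xi>"
      using function_subring_adjoin[OF K] by (simp add: function_subring_def)
    have "(\<lambda>x. (- 1) * (\<Sum>i\<le>Suc n. d i x * \<xi> x ^ i)) \<in> I"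
      by (rule function_ideal_mult[OF I m1 subsetD[OF I0(2) d(2)]])
    then have "(\<lambda>x. (\<Sum>i\<le>Suc n. c i x * \<xi> x ^ i) + (- 1) * (\<Sum>i\<le>Suc n. d i x * \<xi> x ^ i)) \<in> I"
      by (rule function_ideal_add[OF I Suc.prems(2)])
    moreover have "(\<Sum>i\<le>Suc n. c i x * \<xi> x ^ i) + (- 1) * (\<Sum>i\<le>Suc n. d i x * \<xi> x ^ i)
        = (\<Sum>i\<le>n. (c i x + (- 1) * d i x) * \<xi> x ^ i)" for x
      using d(3) by (simp add: sum_subtractf algebra_simps)
    ultimately have "(\<lambda>x. \<Sum>i\<le>n. (c i x + (- 1) * d i x) * \<xi> x ^ i) \<in> I" by simp
    moreover have "(\<lambda>x. c i x + (- 1) * d i x) \<in> K" for i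
      by (intro function_subring_add[OF K Suc.prems(1)] function_subring_mult[OF K _ d(1)]
          function_subring_const[OF K])
    ultimately have "(\<lambda>x. \<Sum>i\<le>n. (c i x + (- 1) * d i x) * \<xi> x ^ i) \<in> I0"
      using Suc.IH[of "\<lambda>i x. c i x + (- 1) * d i x"] by simp
    then have "(\<lambda>x. (\<Sum>i\<le>n. (c i x + (- 1) * d i x) * \<xi> x ^ i) + (\<Sum>i\<le>Suc n. d i x * \<xi> x ^ i)) \<in> I0"
      by (rule function_ideal_add[OF I0(1) _ d(2)])
    moreover have "(\<Sum>i\<le>n. (c i x + (- 1) * d i x) * \<xi> x ^ i) + (\<Sum>i\<le>Suc n. d i x * \<xi> x ^ i)
        = (\<Sum>i\<le>Suc n. c i x * \<xi> x ^ i)" for x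
      using d(3) by (simp add: sum_subtractf algebra_simps)
    ultimately show ?case by simp
  qed
  then have "f \<in> I0" if "f \<in> adjoin_function K \<xi>" "f \<in> I" for f
    using that by (auto simp: adjoin_function_def)
  then show ?thesis using I by (auto simp: function_ideal_def)
qed

text \<open>The inductive step of Hilbert's basis theorem. The leading coefficient ideals increase
  with the degree and become constant from some \<open>M\<close> on; lifts of generators of those of
  degree at most \<open>M\<close> generate \<open>I\<close>.\<close>

lemma noetherian_functions_adjoin:
  assumes K: "function_subring K" and noeth: "noetherian_functions K"
  shows "noetherian_functions (adjoin_function K \<xi>)"
  unfolding noetherian_functions_def
proof (intro allI impI)
  let ?K' = "adjoin_function K \<xi>"
  fix I assume I: "function_ideal ?K' I"
  let ?J = "leading_coeffs K \<xi> I"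
  note idJ = function_ideal_leading_coeffs[OF K I]
  note mono = leading_coeffs_mono_degree[OF K I]
  have "function_ideal K (\<Union>m. ?J m)"
    unfolding function_ideal_def
  proof (intro conjI ballI)
    show "(\<Union>m. ?J m) \<subseteq> K" "(\<lambda>x. 0) \<in> (\<Union>m. ?J m)"
      using idJ unfolding function_ideal_def by blast+
    fix f g assume "f \<in> (\<Union>m. ?J m)" "g \<in> (\<Union>m. ?J m)"
    then obtain m n where "f \<in> ?J m" "g \<in> ?J n" by blast
    then have "f \<in> ?J (max m n)" "g \<in> ?J (max m n)"
      using mono[of m "max m n"] mono[of n "max m n"] by auto
    then show "(\<lambda>x. f x + g x) \<in> (\<Union>m. ?J m)"
      using function_ideal_add[OF idJ[of "max m n"]] by blast
  next
    fix k f assume "k \<in> K" "f \<in> (\<Union>m. ?J m)"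
    then show "(\<lambda>x. k x * f x) \<in> (\<Union>m. ?J m)"
      using function_ideal_mult[OF idJ] by blast
  qed
  then obtain B where B: "finite B" "B \<subseteq> (\<Union>m. ?J m)"
    "\<And>I'. function_ideal K I' \<Longrightarrow> B \<subseteq> I' \<Longrightarrow> (\<Union>m. ?J m) \<subseteq> I'"
    using noeth unfolding noetherian_functions_def by meson
  have "\<exists>M. B \<subseteq> ?J M"
    using B(1,2)
  proof (induction B)
    case (insert b B)
    then obtain M n where "B \<subseteq> ?J M" "b \<in> ?J n" by auto
    then have "insert b B \<subseteq> ?J (max M n)"
      using mono[of M "max M n"] mono[of n "max M n"] by auto
    then show ?case by blast
  qed auto
  then obtain M where "B \<subseteq> ?J M" by blast
  then have stable: "?J n \<subseteq> ?J M" for n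
    using B(3)[OF idJ[of M]] by blast
  have "\<forall>m. \<exists>B. finite B \<and> B \<subseteq> ?J m \<and> (\<forall>I'. function_ideal K I' \<and> B \<subseteq> I' \<longrightarrow> ?J m \<subseteq> I')"
    using noeth idJ unfolding noetherian_functions_def by blast
  then obtain C where C: "\<And>m. finite (C m)" "\<And>m. C m \<subseteq> ?J m"
    "\<And>m I'. function_ideal K I' \<Longrightarrow> C m \<subseteq> I' \<Longrightarrow> ?J m \<subseteq> I'" by metis
  let ?rep = "\<lambda>m b g. g \<in> I \<and> (\<exists>c. (\<forall>i. c i \<in> K) \<and> c m = b \<and> g = (\<lambda>x. \<Sum>i\<le>m. c i x * \<xi> x ^ i))"
  have "\<forall>b\<in>C m. \<exists>g. ?rep m b g" for m
    using subsetD[OF C(2)] unfolding leading_coeffs_iff by blast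
  then have "\<forall>m. \<exists>g. \<forall>b\<in>C m. ?rep m b (g b)"
    by (intro allI bchoice)
  then obtain g where "\<forall>m. \<forall>b\<in>C m. ?rep m b (g m b)"
    by (rule choice[THEN exE])
  then have g: "\<And>m b. b \<in> C m \<Longrightarrow> g m b \<in> I"
    "\<And>m b. b \<in> C m \<Longrightarrow> \<exists>c. (\<forall>i. c i \<in> K) \<and> c m = b \<and> g m b = (\<lambda>x. \<Sum>i\<le>m. c i x * \<xi> x ^ i)"
    by blast+
  define G where "G = (\<Union>m\<in>{..M}. g m ` C m)"
  have "finite G" "G \<subseteq> I" using C(1) g(1) by (auto simp: G_def)
  moreover have "I \<subseteq> I'" if I': "function_ideal ?K' I'" "G \<subseteq> I'" for I'
  proof -
    \<comment> \<open>The comparison by leading coefficients needs an ideal inside \<open>I\<close>,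
      so \<open>I'\<close> is replaced by \<open>I \<inter> I'\<close>.\<close>
    have I0: "function_ideal ?K' (I \<inter> I')" using I I'(1) by (auto simp: function_ideal_def)
    have le: "?J m \<subseteq> leading_coeffs K \<xi> (I \<inter> I') m" if "m \<le> M" for m
    proof (rule C(3)[OF function_ideal_leading_coeffs[OF K I0]], rule subsetI)
      fix b assume b: "b \<in> C m"
      then have "g m b \<in> I \<inter> I'" using g(1)[OF b] I'(2) that b unfolding G_def by blast
      then show "b \<in> leading_coeffs K \<xi> (I \<inter> I') m"
        using g(2)[OF b] by (auto simp: leading_coeffs_iff)
    qed
    have "?J n \<subseteq> leading_coeffs K \<xi> (I \<inter> I') n" for n
    proof (cases "n \<le> M")
      case False
      then show ?thesis
        using stable[of n] le[of M] leading_coeffs_mono_degree[OF K I0, of M n] by force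
    qed (rule le)
    then have "I \<subseteq> I \<inter> I'" by (intro ideal_subset_if_leading_coeffs_subset[OF K I I0]) auto
    then show ?thesis by blast
  qed
  ultimately show "\<exists>B. finite B \<and> B \<subseteq> I \<and> (\<forall>I'. function_ideal ?K' I' \<and> B \<subseteq> I' \<longrightarrow> I \<subseteq> I')"
    by blast
qed

text \<open>The constants form a field, so an ideal is zero or contains a unit.\<close>

lemma noetherian_constant_functions: "noetherian_functions (range (\<lambda>c x. c))"
  unfolding noetherian_functions_def
proof (intro allI impI)
  let ?K = "range (\<lambda>(c::real) (x::'a). c)"
  fix I assume I: "function_ideal ?K I"
  show "\<exists>B. finite B \<and> B \<subseteq> I \<and> (\<forall>I'. function_ideal ?K I' \<and> B \<subseteq> I' \<longrightarrow> I \<subseteq> I')"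
  proof (cases "I \<subseteq> {\<lambda>x. 0}")
    case True
    then show ?thesis by (intro exI[of _ "{}"]) (auto simp: function_ideal_def)
  next
    case False
    then obtain f where f: "f \<in> I" "f \<noteq> (\<lambda>x. 0)" by blast
    moreover obtain b where "f = (\<lambda>x. b)" using f(1) I by (auto simp: function_ideal_def)
    ultimately have b: "(\<lambda>x. b) \<in> I" "b \<noteq> 0" by auto
    have "I \<subseteq> I'" if "function_ideal ?K I'" "(\<lambda>x. b) \<in> I'" for I'
    proof
      fix f assume "f \<in> I"
      then obtain c where c: "f = (\<lambda>x. c)" using I by (auto simp: function_ideal_def)
      have "(\<lambda>x. (c / b) * b) \<in> I'" by (rule function_ideal_mult[OF that(1) _ that(2)]) simp
      then show "f \<in> I'" using b c by simp
    qed
    then show ?thesis using b by (intro exI[of _ "{\<lambda>x. b}"]) auto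
  qed
qed

text \<open>Adjoining the coordinate functions one at a time to the constants ends with exactly the
  real polynomial functions.\<close>

theorem noetherian_real_polynomial_functions:
  "noetherian_functions {f :: 'a::euclidean_space \<Rightarrow> real. real_polynomial_function f}"
proof -
  have "\<exists>K. function_subring K \<and> noetherian_functions K \<and> (\<forall>b\<in>A. (\<lambda>x. x \<bullet> b) \<in> K) \<and>
       K \<subseteq> {f. real_polynomial_function f}" if "finite A" for A :: "'a set"
    using that
  proof induction
    case empty
    show ?case
      using noetherian_constant_functions
      by (intro exI[of _ "range (\<lambda>c x. c)"]) (auto simp: function_subring_def)
  next
    case (insert a A)
    then obtain K where K: "function_subring K" "noetherian_functions K"
      "\<And>b. b \<in> A \<Longrightarrow> (\<lambda>x. x \<bullet> b) \<in> K" "K \<subseteq> {f. real_polynomial_function f}" by blast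
    let ?K = "adjoin_function K (\<lambda>x. x \<bullet> a)"
    have "real_polynomial_function (\<lambda>x. x \<bullet> a)" using bounded_linear_inner_left by blast
    then have "?K \<subseteq> {f. real_polynomial_function f}"
      using K(4) by (auto simp: adjoin_function_def intro!: real_polynomial_function_sum
          real_polynomial_function.intros(4) real_polynomial_function_power)
    then show ?case
      using function_subring_adjoin[OF K(1)] noetherian_functions_adjoin[OF K(1,2)]
        adjoin_function_generator[OF K(1)] adjoin_function_base[OF K(1) K(3)]
      by (intro exI[of _ ?K]) auto
  qed
  from this[OF finite_Basis] obtain K :: "('a \<Rightarrow> real) set" where K: "function_subring K" "noetherian_functions K"
      "\<And>b. b \<in> Basis \<Longrightarrow> (\<lambda>x. x \<bullet> b) \<in> K" "K \<subseteq> {f. real_polynomial_function f}" by blast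
  have "f \<in> K" if "real_polynomial_function f" for f
    using that
  proof induction
    case (linear f)
    have "f = (\<lambda>x. \<Sum>b\<in>Basis. f b * (x \<bullet> b))"
    proof
      fix x
      have "f x = f (\<Sum>b\<in>Basis. (x \<bullet> b) *\<^sub>R b)" by (simp add: euclidean_representation)
      also have "\<dots> = (\<Sum>b\<in>Basis. f b * (x \<bullet> b))"
        using linear by (simp add: bounded_linear.linear linear_sum linear_cmul mult.commute)
      finally show "f x = (\<Sum>b\<in>Basis. f b * (x \<bullet> b))" .
    qed
    moreover have "(\<lambda>x. \<Sum>b\<in>Basis. f b * (x \<bullet> b)) \<in> K"
      using K(1,3) by (intro function_subring_sum) (auto simp: function_subring_def)
    ultimately show ?case by simp
  qed (use K(1) in \<open>auto simp: function_subring_def\<close>)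
  then have "K = {f. real_polynomial_function f}" using K(4) by blast
  then show ?thesis using K(2) by simp
qed

section \<open>Irreducibility\<close>

text \<open>Contrapositive of primality: if a product of polynomials vanishes on \<open>T\<close>,
  one factor does. The empty set qualifies, so nonemptiness is always tracked separately.\<close>

definition poly_irreducible :: "'a::real_normed_vector set \<Rightarrow> bool" where
  "poly_irreducible T \<longleftrightarrow> (\<forall>f g. real_polynomial_function f \<and> real_polynomial_function g \<and>
     (\<exists>x\<in>T. f x \<noteq> 0) \<and> (\<exists>x\<in>T. g x \<noteq> 0) \<longrightarrow> (\<exists>x\<in>T. f x \<noteq> 0 \<and> g x \<noteq> 0))"

lemma poly_irreducibleD:
  assumes "poly_irreducible T" "real_polynomial_function f" "real_polynomial_function g"
    "x \<in> T" "f x \<noteq> 0" "y \<in> T" "g y \<noteq> 0"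
  obtains z where "z \<in> T" "f z \<noteq> 0" "g z \<noteq> 0"
  using assms unfolding poly_irreducible_def by blast

lemma polynomial_compose:
  "polynomial_function g \<Longrightarrow> real_polynomial_function f \<Longrightarrow> real_polynomial_function (\<lambda>x. f (g x))"
  using real_polynomial_function_compose[of g f] by (simp add: o_def)

lemma polynomial_function_Pair:
  assumes "polynomial_function f" "polynomial_function g"
  shows "polynomial_function (\<lambda>x. (f x, g x))"
  unfolding polynomial_function_def
proof (intro allI impI)
  fix h :: "'b \<times> 'c \<Rightarrow> real" assume h: "bounded_linear h"
  have bl: "bounded_linear (\<lambda>y. h (y, 0))" "bounded_linear (\<lambda>z. h (0, z))"
    by (rule bounded_linear_compose[OF h bounded_linear_Pair[OF bounded_linear_ident bounded_linear_zero]],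
        rule bounded_linear_compose[OF h bounded_linear_Pair[OF bounded_linear_zero bounded_linear_ident]])
  have "real_polynomial_function ((\<lambda>y. h (y, 0)) \<circ> f)" "real_polynomial_function ((\<lambda>z. h (0, z)) \<circ> g)"
    using assms bl unfolding polynomial_function_def by simp_all
  from real_polynomial_function.intros(3)[OF this]
  have "real_polynomial_function (\<lambda>x. h (f x, 0) + h (0, g x))" by (simp add: o_def)
  moreover have "h (f x, 0) + h (0, g x) = h (f x, g x)" for x
    using linear_add[OF bounded_linear.linear[OF h], of "(f x, 0)" "(0, g x)"] by simp
  ultimately show "real_polynomial_function (h \<circ> (\<lambda>x. (f x, g x)))" by (simp add: o_def)
qed

lemma finite_zeros_real_polynomial:
  fixes f :: "real \<Rightarrow> real"
  assumes "real_polynomial_function f" "f a \<noteq> 0"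
  shows "finite {t. f t = 0}"
proof -
  obtain c n where f: "f = (\<lambda>x. \<Sum>i\<le>n. c i * x ^ i)"
    using assms(1) real_polynomial_function_iff_sum by blast
  then have "\<exists>i\<le>n. c i \<noteq> 0" using assms(2) by (metis (no_types, lifting) atMost_iff mult_zero_left sum.neutral)
  then show ?thesis using polyfun_finite_roots[of c n] f by simp
qed

text \<open>On the segment between the two given points each polynomial becomes a nonzero polynomial
  in one variable, with finitely many zeros.\<close>

lemma poly_irreducible_convex:
  assumes "convex S" shows "poly_irreducible S"
  unfolding poly_irreducible_def
proof (intro allI impI, elim conjE bexE)
  fix f g x y
  assume fg: "real_polynomial_function f" "real_polynomial_function g"
    and x: "x \<in> S" "f x \<noteq> 0" and y: "y \<in> S" "g y \<noteq> 0"
  have pol: "polynomial_function (\<lambda>t::real. x + t *\<^sub>R (y - x))"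
    by (intro polynomial_function_add polynomial_function_const polynomial_function_bounded_linear
        bounded_linear_scaleR_left)
  have "finite {t::real. f (x + t *\<^sub>R (y - x)) = 0}"
    using finite_zeros_real_polynomial[OF polynomial_compose[OF pol fg(1)], of 0] x by simp
  moreover have "finite {t::real. g (x + t *\<^sub>R (y - x)) = 0}"
    using finite_zeros_real_polynomial[OF polynomial_compose[OF pol fg(2)], of 1] y by simp
  ultimately have "finite ({t::real. f (x + t *\<^sub>R (y - x)) = 0} \<union> {t. g (x + t *\<^sub>R (y - x)) = 0})"
    by simp
  moreover have "infinite {0..1::real}" by (simp add: infinite_Icc)
  ultimately have "{0..1} - ({t::real. f (x + t *\<^sub>R (y - x)) = 0} \<union> {t. g (x + t *\<^sub>R (y - x)) = 0}) \<noteq> {}"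
    by (intro infinite_imp_nonempty Diff_infinite_finite)
  then obtain t where t: "t \<in> {0..1}" "f (x + t *\<^sub>R (y - x)) \<noteq> 0" "g (x + t *\<^sub>R (y - x)) \<noteq> 0"
    by blast
  have "x + t *\<^sub>R (y - x) = (1 - t) *\<^sub>R x + t *\<^sub>R y" by (simp add: algebra_simps)
  then have "x + t *\<^sub>R (y - x) \<in> S" using convexD_alt[OF assms x(1) y(1), of t] t(1) by simp
  then show "\<exists>x\<in>S. f x \<noteq> 0 \<and> g x \<noteq> 0" using t by blast
qed

lemma poly_irreducible_image:
  assumes "poly_irreducible T" "polynomial_function \<phi>"
  shows "poly_irreducible (\<phi> ` T)"
  unfolding poly_irreducible_def
proof (intro allI impI, elim conjE bexE)
  fix f g x y
  assume fg: "real_polynomial_function f" "real_polynomial_function g"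
    and x: "x \<in> \<phi> ` T" "f x \<noteq> 0" and y: "y \<in> \<phi> ` T" "g y \<noteq> 0"
  then obtain a b where "a \<in> T" "f (\<phi> a) \<noteq> 0" "b \<in> T" "g (\<phi> b) \<noteq> 0" by blast
  then show "\<exists>x\<in>\<phi> ` T. f x \<noteq> 0 \<and> g x \<noteq> 0"
    using poly_irreducibleD[OF assms(1) polynomial_compose[OF assms(2) fg(1)]
        polynomial_compose[OF assms(2) fg(2)]] by blast
qed

lemma poly_irreducible_open:
  assumes "poly_irreducible T" "real_polynomial_function h"
  shows "poly_irreducible {x\<in>T. h x \<noteq> 0}"
  unfolding poly_irreducible_def
proof (intro allI impI, elim conjE bexE)
  fix f g x y
  assume fg: "real_polynomial_function f" "real_polynomial_function g"
    and x: "x \<in> {x\<in>T. h x \<noteq> 0}" "f x \<noteq> 0" and y: "y \<in> {x\<in>T. h x \<noteq> 0}" "g y \<noteq> 0"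
  note mul = real_polynomial_function.intros(4)[OF fg(1) assms(2)] real_polynomial_function.intros(4)[OF fg(2) assms(2)]
  obtain z where "z \<in> T" "f z * h z \<noteq> 0" "g z * h z \<noteq> 0"
    by (rule poly_irreducibleD[OF assms(1) mul, of x y]) (use x y in auto)
  then show "\<exists>x\<in>{x\<in>T. h x \<noteq> 0}. f x \<noteq> 0 \<and> g x \<noteq> 0" by auto
qed

text \<open>Sections through the two given points turn both conditions into conditions on the base.
  At a common base point, the two section values then lie in one convex fibre.\<close>

lemma poly_irreducible_bundle:
  assumes T: "poly_irreducible T" and conv: "\<And>x. x \<in> T \<Longrightarrow> convex (F x)"
    and sec: "\<And>x0 y0. x0 \<in> T \<Longrightarrow> y0 \<in> F x0 \<Longrightarrow>
      \<exists>s. polynomial_function s \<and> s x0 = y0 \<and> (\<forall>x\<in>T. s x \<in> F x)"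
  shows "poly_irreducible (Sigma T F)"
  unfolding poly_irreducible_def
proof (intro allI impI, elim conjE bexE)
  fix f g p q
  assume fg: "real_polynomial_function f" "real_polynomial_function g"
    and p: "p \<in> Sigma T F" "f p \<noteq> 0" and q: "q \<in> Sigma T F" "g q \<noteq> 0"
  obtain x1 y1 where p1: "p = (x1, y1)" "x1 \<in> T" "y1 \<in> F x1" using p(1) by blast
  obtain x2 y2 where q1: "q = (x2, y2)" "x2 \<in> T" "y2 \<in> F x2" using q(1) by blast
  obtain s1 where s1: "polynomial_function s1" "s1 x1 = y1" "\<And>x. x \<in> T \<Longrightarrow> s1 x \<in> F x"
    using sec[OF p1(2,3)] by blast
  obtain s2 where s2: "polynomial_function s2" "s2 x2 = y2" "\<And>x. x \<in> T \<Longrightarrow> s2 x \<in> F x"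
    using sec[OF q1(2,3)] by blast
  obtain z where z: "z \<in> T" "f (z, s1 z) \<noteq> 0" "g (z, s2 z) \<noteq> 0"
  proof (rule poly_irreducibleD[OF T, where x=x1 and y=x2])
    show "real_polynomial_function (\<lambda>x. f (x, s1 x))" "real_polynomial_function (\<lambda>x. g (x, s2 x))"
      by (intro polynomial_compose[OF polynomial_function_Pair[OF polynomial_function_id]] s1(1) s2(1) fg)+
  qed (use p p1 q q1 s1(2) s2(2) in auto)
  have pz: "polynomial_function (\<lambda>y. (z, y))"
    by (intro polynomial_function_Pair polynomial_function_const polynomial_function_id)
  obtain y where "y \<in> F z" "f (z, y) \<noteq> 0" "g (z, y) \<noteq> 0"
    using poly_irreducibleD[OF poly_irreducible_convex[OF conv[OF z(1)]]
        polynomial_compose[OF pz fg(1)] polynomial_compose[OF pz fg(2)] s1(3)[OF z(1)] z(2) s2(3)[OF z(1)] z(3)]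
    by blast
  then show "\<exists>x\<in>Sigma T F. f x \<noteq> 0 \<and> g x \<noteq> 0" using z(1) by blast
qed

lemma algebraic_set_zero: "real_polynomial_function f \<Longrightarrow> algebraic_set {x. f x = 0}"
  unfolding algebraic_set_def by (rule exI[of _ "{f}"]) auto

text \<open>Finitely many generators of the vanishing ideal of \<open>S\<close> cut out the whole
  intersection.\<close>

lemma algebraic_set_zariski_closure: "algebraic_set (zariski_closure S)"
proof -
  let ?K = "{f :: 'a \<Rightarrow> real. real_polynomial_function f}"
  define I where "I = {f \<in> ?K. \<forall>x\<in>S. f x = 0}"
  have "function_ideal ?K I" by (auto simp: function_ideal_def I_def)
  then obtain B where B: "finite B" "B \<subseteq> I" "\<And>I'. function_ideal ?K I' \<Longrightarrow> B \<subseteq> I' \<Longrightarrow> I \<subseteq> I'"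
    using noetherian_real_polynomial_functions unfolding noetherian_functions_def by meson
  have alg: "algebraic_set {x. \<forall>f\<in>B. f x = 0}"
    unfolding algebraic_set_def using B by (auto simp: I_def)
  have "zariski_closure S = {x. \<forall>f\<in>B. f x = 0}"
  proof
    show "zariski_closure S \<subseteq> {x. \<forall>f\<in>B. f x = 0}"
      unfolding zariski_closure_def by (rule Inter_lower) (use alg B(2) in \<open>auto simp: I_def\<close>)
    show "{x. \<forall>f\<in>B. f x = 0} \<subseteq> zariski_closure S"
      unfolding zariski_closure_def
    proof (intro Inter_greatest subsetI)
      fix A x assume A: "A \<in> {A. algebraic_set A \<and> S \<subseteq> A}" and x: "x \<in> {x. \<forall>f\<in>B. f x = 0}"
      then obtain F where F: "\<forall>f\<in>F. real_polynomial_function f" "A = {x. \<forall>f\<in>F. f x = 0}"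
        unfolding algebraic_set_def by blast
      \<comment> \<open>The polynomials vanishing at \<open>x\<close> form an ideal containing the
        generators, hence containing \<open>I\<close>.\<close>
      have "I \<subseteq> {f \<in> ?K. f x = 0}"
        by (rule B(3)) (use B(2) x in \<open>auto simp: function_ideal_def I_def\<close>)
      moreover have "F \<subseteq> I" using F A by (auto simp: I_def)
      ultimately show "x \<in> A" using F by auto
    qed
  qed
  then show ?thesis using alg by simp
qed

text \<open>A proper algebraic subset of the closure has an equation that does not vanish on all of
  \<open>S\<close>. Equations of two such subsets are nonzero at a common point of \<open>S\<close>,
  which neither subset contains.\<close>

lemma zariski_irreducible_if_poly_irreducible:
  assumes "poly_irreducible S" shows "zariski_irreducible S"
  unfolding zariski_irreducible_def irreducible_algebraic_set_def
proof (intro conjI notI algebraic_set_zariski_closure)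
  let ?Z = "zariski_closure S"
  have SZ: "S \<subseteq> ?Z" by (auto simp: zariski_closure_def)
  have nz: "\<exists>f. real_polynomial_function f \<and> (\<forall>x\<in>B. f x = 0) \<and> (\<exists>x\<in>S. f x \<noteq> 0)"
    if B: "algebraic_set B" "B \<subset> ?Z" for B
  proof -
    obtain x where x: "x \<in> ?Z" "x \<notin> B" using B(2) by blast
    then obtain f where f: "real_polynomial_function f" "\<forall>x\<in>B. f x = 0" "f x \<noteq> 0"
      using B(1) unfolding algebraic_set_def by blast
    have "\<exists>x\<in>S. f x \<noteq> 0"
      using f(3) x(1) algebraic_set_zero[OF f(1)] unfolding zariski_closure_def by blast
    then show ?thesis using f by blast
  qed
  assume "\<exists>B C. algebraic_set B \<and> algebraic_set C \<and> B \<subset> ?Z \<and> C \<subset> ?Z \<and> ?Z = B \<union> C"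
  then obtain B C where BC: "algebraic_set B" "algebraic_set C" "B \<subset> ?Z" "C \<subset> ?Z" "?Z = B \<union> C" by blast
  obtain f where f: "real_polynomial_function f" "\<forall>x\<in>B. f x = 0" "\<exists>x\<in>S. f x \<noteq> 0"
    using nz[OF BC(1,3)] by blast
  obtain g where g: "real_polynomial_function g" "\<forall>x\<in>C. g x = 0" "\<exists>x\<in>S. g x \<noteq> 0"
    using nz[OF BC(2,4)] by blast
  obtain z where "z \<in> S" "f z \<noteq> 0" "g z \<noteq> 0"
    using assms f g unfolding poly_irreducible_def by blast
  then show False using BC(5) SZ f(2) g(2) by blast
qed

section \<open>Principal minors\<close>

lemma polynomial_function_vec:
  assumes "\<And>i. polynomial_function (\<lambda>x. f x $ i)"
  shows "polynomial_function (f :: 'a::real_normed_vector \<Rightarrow> 'b::euclidean_space ^ 'n)"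
  unfolding polynomial_function_iff_Basis_inner
proof
  fix b :: "'b ^ 'n" assume "b \<in> Basis"
  then obtain i u where b: "b = axis i u" "u \<in> Basis" by (auto simp: Basis_vec_def)
  have "real_polynomial_function (\<lambda>x. f x $ i \<bullet> u)"
    using assms[of i, unfolded polynomial_function_iff_Basis_inner] b(2) by (rule bspec)
  then show "real_polynomial_function (\<lambda>x. f x \<bullet> b)" by (simp add: b(1) inner_axis)
qed

lemma real_polynomial_function_det:
  fixes A :: "'a::real_normed_vector \<Rightarrow> real^'n^'n"
  assumes "\<And>i j. real_polynomial_function (\<lambda>x. A x $ i $ j)"
  shows "real_polynomial_function (\<lambda>x. det (A x))"
  unfolding det_def
  by (intro real_polynomial_function_sum real_polynomial_function.intros(2,4) real_polynomial_function_prod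
      assms finite_permutations finite)

lemma polynomial_function_entry:
  fixes f :: "'a::real_normed_vector \<Rightarrow> 'b::euclidean_space ^ 'n"
  assumes "polynomial_function f" shows "polynomial_function (\<lambda>x. f x $ i)"
  using polynomial_function_compose[OF assms polynomial_function_bounded_linear[OF bounded_linear_vec_nth[of i]]]
  by (simp add: o_def)

lemma real_polynomial_function_nth:
  fixes f :: "'a::real_normed_vector \<Rightarrow> real ^ 'n"
  assumes "polynomial_function f" shows "real_polynomial_function (\<lambda>x. f x $ i)"
  using polynomial_function_entry[OF assms] by (simp add: real_polynomial_function_eq)

lemma real_polynomial_function_matrix_vector_nth:
  fixes A :: "'a::real_normed_vector \<Rightarrow> real^'n^'m"
  assumes "polynomial_function A" "polynomial_function x"
  shows "real_polynomial_function (\<lambda>p. (A p *v x p) $ i)"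
  unfolding matrix_vector_mult_def
  by (simp, intro real_polynomial_function_sum real_polynomial_function.intros(4)
      real_polynomial_function_nth polynomial_function_entry assms finite)

lemma polynomial_function_fst: "polynomial_function fst"
  and polynomial_function_snd: "polynomial_function snd"
  by (intro polynomial_function_bounded_linear bounded_linear_fst bounded_linear_snd)+

lemma polynomial_function_vecI:
  fixes f :: "'a::real_normed_vector \<Rightarrow> real ^ 'n"
  assumes "\<And>i. real_polynomial_function (\<lambda>x. f x $ i)" shows "polynomial_function f"
  using polynomial_function_vec[of f] assms by (simp add: real_polynomial_function_eq)

lemma polynomial_function_matrixI:
  fixes f :: "'a::real_normed_vector \<Rightarrow> real ^ 'n ^ 'm"
  assumes "\<And>i j. real_polynomial_function (\<lambda>x. f x $ i $ j)" shows "polynomial_function f"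
  by (intro polynomial_function_vec polynomial_function_vecI assms)

text \<open>A system with this matrix prescribes the rows of \<open>\<Omega> *v x\<close> in
  \<open>S\<close> and the coordinates of \<open>x\<close> outside \<open>S\<close>, so submatrices
  are handled without changing the index type.\<close>

definition bordered :: "'v::finite set \<Rightarrow> real^'v^'v \<Rightarrow> real^'v^'v" where
  "bordered S \<Omega> = (\<chi> i j. if i \<in> S then \<Omega> $ i $ j else if i = j then 1 else 0)"

text \<open>Expanding along the unit rows gives the minor on the rows and columns in \<open>S\<close>.\<close>

definition principal_minor :: "'v::finite set \<Rightarrow> real^'v^'v \<Rightarrow> real" where
  "principal_minor S \<Omega> = det (bordered S \<Omega>)"

text \<open>The numerators of Cramer's rule, so that the entries are polynomial in \<open>\<Omega>\<close>.\<close>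

definition cramer_vec :: "'v::finite set \<Rightarrow> real^'v^'v \<Rightarrow> real^'v \<Rightarrow> real^'v" where
  "cramer_vec S \<Omega> c = (\<chi> k. det (\<chi> i j. if j = k then c $ i else bordered S \<Omega> $ i $ j))"

lemma bordered_mult: "(bordered S \<Omega> *v x) $ i = (if i \<in> S then (\<Omega> *v x) $ i else x $ i)"
  by (auto simp: bordered_def matrix_vector_mult_def if_distrib[of "\<lambda>y. y * _"] cong: if_cong)

lemma principal_minor_nz_iff_bordered:
  "principal_minor S \<Omega> \<noteq> 0 \<longleftrightarrow> (\<forall>x. bordered S \<Omega> *v x = 0 \<longrightarrow> x = 0)"
  unfolding principal_minor_def
  by (metis invertible_det_nz invertible_left_inverse matrix_left_invertible_ker)

lemma principal_minor_nz_iff: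
  "principal_minor S \<Omega> \<noteq> 0 \<longleftrightarrow>
     (\<forall>x. (\<forall>i\<in>S. (\<Omega> *v x) $ i = 0) \<and> (\<forall>i. i \<notin> S \<longrightarrow> x $ i = 0) \<longrightarrow> x = 0)"
proof -
  have "bordered S \<Omega> *v x = 0 \<longleftrightarrow> (\<forall>i\<in>S. (\<Omega> *v x) $ i = 0) \<and> (\<forall>i. i \<notin> S \<longrightarrow> x $ i = 0)" for x
    unfolding vec_eq_iff bordered_mult by auto
  then show ?thesis by (simp add: principal_minor_nz_iff_bordered)
qed

lemma matrix_vector_mult_supported:
  assumes "\<And>i. i \<notin> S \<Longrightarrow> x $ i = (0::real)"
  shows "(\<Omega> *v x) $ i = (\<Sum>j\<in>S. \<Omega> $ i $ j * x $ j)"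
proof -
  have "(\<Omega> *v x) $ i = (\<Sum>j\<in>UNIV. \<Omega> $ i $ j * x $ j)" by (simp add: matrix_vector_mult_def)
  also have "\<dots> = (\<Sum>j\<in>S. \<Omega> $ i $ j * x $ j)"
    using assms by (intro sum.mono_neutral_right) auto
  finally show ?thesis .
qed

lemma principal_minor_nz_cong:
  assumes "\<And>i j. i \<in> S \<Longrightarrow> j \<in> S \<Longrightarrow> A $ i $ j = B $ i $ j"
  shows "principal_minor S A \<noteq> 0 \<longleftrightarrow> principal_minor S B \<noteq> 0"
proof -
  have "(A *v x) $ i = (B *v x) $ i" if "i \<in> S" "\<forall>i. i \<notin> S \<longrightarrow> x $ i = 0" for x i
    using matrix_vector_mult_supported[of S x A i] matrix_vector_mult_supported[of S x B i] that assms
    by simp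
  then show ?thesis unfolding principal_minor_nz_iff by metis
qed

lemma bordered_cramer_vec:
  assumes "principal_minor S \<Omega> \<noteq> 0"
  shows "bordered S \<Omega> *v cramer_vec S \<Omega> c = principal_minor S \<Omega> *s c"
proof -
  define z :: "real^'a" where
    "z = (\<chi> k. det (\<chi> i j. if j = k then c $ i else bordered S \<Omega> $ i $ j) / det (bordered S \<Omega>))"
  have "bordered S \<Omega> *v z = c"
    using cramer[of "bordered S \<Omega>" z c] assms by (simp add: principal_minor_def z_def)
  moreover have "cramer_vec S \<Omega> c = principal_minor S \<Omega> *s z"
    using assms by (simp add: cramer_vec_def z_def principal_minor_def vec_eq_iff)
  ultimately show ?thesis by (simp add: matrix_vector_mult_scaleR vector_scalar_commute)
qed

lemma cramer_vec_unique:
  assumes "principal_minor S \<Omega> \<noteq> 0" "bordered S \<Omega> *v x = principal_minor S \<Omega> *s c"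
  shows "cramer_vec S \<Omega> c = x"
proof -
  have "bordered S \<Omega> *v (cramer_vec S \<Omega> c - x) = 0"
    using assms bordered_cramer_vec[OF assms(1)] by (simp add: matrix_vector_mult_diff_distrib)
  then have "cramer_vec S \<Omega> c - x = 0"
    using assms(1) principal_minor_nz_iff_bordered by blast
  then show ?thesis by simp
qed

lemma real_polynomial_function_bordered:
  assumes "polynomial_function M"
  shows "real_polynomial_function (\<lambda>x. bordered S (M x) $ i $ j)"
  by (cases "i \<in> S"; cases "i = j")
    (simp_all add: bordered_def real_polynomial_function_nth polynomial_function_entry assms
      real_polynomial_function.intros(2))

lemma real_polynomial_function_principal_minor:
  "polynomial_function M \<Longrightarrow> real_polynomial_function (\<lambda>x. principal_minor S (M x))"
  unfolding principal_minor_def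
  by (intro real_polynomial_function_det real_polynomial_function_bordered)

lemma polynomial_function_cramer_vec:
  assumes "polynomial_function M" shows "polynomial_function (\<lambda>x. cramer_vec S (M x) c)"
proof (rule polynomial_function_vecI)
  fix k
  have "real_polynomial_function (\<lambda>x. det (\<chi> i j. if j = k then c $ i else bordered S (M x) $ i $ j))"
  proof (rule real_polynomial_function_det)
    fix i j
    show "real_polynomial_function (\<lambda>x. (\<chi> i j. if j = k then c $ i else bordered S (M x) $ i $ j) $ i $ j)"
      by (cases "j = k")
        (simp_all add: real_polynomial_function_bordered assms real_polynomial_function.intros(2))
  qed
  then show "real_polynomial_function (\<lambda>x. cramer_vec S (M x) c $ k)"
    by (simp add: cramer_vec_def)
qed

text \<open>A nonzero minor on \<open>S\<close> makes the equations indexed by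
  \<open>N \<subseteq> S\<close> independent, and Cramer numerators with a right-hand side that is
  zero on \<open>N\<close> give polynomial sections of the solution spaces.\<close>

lemma poly_irreducible_kernel_bundle:
  assumes T: "poly_irreducible T" and M: "polynomial_function M"
    and N: "N \<subseteq> S" and nz: "\<And>p. p \<in> T \<Longrightarrow> principal_minor S (M p) \<noteq> 0"
  shows "poly_irreducible (SIGMA p:T. {y. \<forall>i\<in>N. (M p *v y) $ i = 0})"
proof (rule poly_irreducible_bundle[OF T])
  show "convex {y. \<forall>i\<in>N. (M p *v y) $ i = 0}" for p
    by (auto simp: convex_def matrix_vector_right_distrib matrix_vector_mult_scaleR)
  fix p0 y0 assume p0: "p0 \<in> T" "y0 \<in> {y. \<forall>i\<in>N. (M p0 *v y) $ i = 0}"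
  \<comment> \<open>The section must pass through \<open>y0\<close> at \<open>p0\<close>; the
    division cancels the factor \<open>principal_minor S (M p0)\<close> carried by
    \<open>cramer_vec\<close>.\<close>
  define c where "c = (1 / principal_minor S (M p0)) *s (bordered S (M p0) *v y0)"
  have c0: "c $ i = 0" if "i \<in> N" for i
    using p0(2) N that by (auto simp: c_def bordered_mult)
  have "cramer_vec S (M p0) c = y0"
    using nz[OF p0(1)] by (intro cramer_vec_unique) (auto simp: c_def vec_eq_iff)
  moreover have "(M p *v cramer_vec S (M p) c) $ i = 0" if "p \<in> T" "i \<in> N" for p i
  proof -
    have "(M p *v cramer_vec S (M p) c) $ i = (bordered S (M p) *v cramer_vec S (M p) c) $ i"
      using that N by (auto simp: bordered_mult)
    then show ?thesis using bordered_cramer_vec[OF nz[OF that(1)]] c0[OF that(2)] by simp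
  qed
  ultimately show "\<exists>s. polynomial_function s \<and> s p0 = y0 \<and> (\<forall>p\<in>T. s p \<in> {y. \<forall>i\<in>N. (M p *v y) $ i = 0})"
    using polynomial_function_cramer_vec[OF M] by (intro exI[of _ "\<lambda>p. cramer_vec S (M p) c"]) auto
qed

text \<open>The existence principle for generic points: conditions are combined one by one through
  their product.\<close>

lemma poly_irreducible_finite_family:
  assumes T: "poly_irreducible T" "T \<noteq> {}" and "finite A"
    and f: "\<And>a. a \<in> A \<Longrightarrow> real_polynomial_function (f a)" "\<And>a. a \<in> A \<Longrightarrow> \<exists>x\<in>T. f a x \<noteq> 0"
  shows "\<exists>x\<in>T. \<forall>a\<in>A. f a x \<noteq> 0"
proof -
  have "\<exists>x\<in>T. (\<Prod>a\<in>A. f a x) \<noteq> 0"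
    using \<open>finite A\<close> f
  proof (induction A)
    case empty
    then show ?case using T(2) by auto
  next
    case (insert b A)
    have "real_polynomial_function (\<lambda>x. \<Prod>a\<in>A. f a x)"
      using insert by (intro real_polynomial_function_prod) auto
    moreover have "real_polynomial_function (f b)" using insert.prems by simp
    moreover have "\<exists>x\<in>T. (\<Prod>a\<in>A. f a x) \<noteq> 0"
      using insert.prems by (intro insert.IH) simp_all
    moreover have "\<exists>y\<in>T. f b y \<noteq> 0" using insert.prems by simp
    ultimately obtain z where "z \<in> T" "(\<Prod>a\<in>A. f a z) \<noteq> 0" "f b z \<noteq> 0"
      using poly_irreducibleD[OF T(1)] by blast
    then show ?case using insert.hyps by auto
  qed
  then show ?thesis using \<open>finite A\<close> by auto
qed

lemma poly_irreducible_open_family: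
  assumes "poly_irreducible T" "finite A" "\<And>a. a \<in> A \<Longrightarrow> real_polynomial_function (f a)"
  shows "poly_irreducible {x\<in>T. \<forall>a\<in>A. f a x \<noteq> 0}"
proof -
  have "real_polynomial_function (\<lambda>x. \<Prod>a\<in>A. f a x)"
    using assms by (intro real_polynomial_function_prod) auto
  from poly_irreducible_open[OF assms(1) this] show ?thesis
    using \<open>finite A\<close> by (simp add: prod_zero_iff)
qed

section \<open>Low rank matrices supported on a graph\<close>

definition sparse_sym :: "'v::finite set set \<Rightarrow> (real^'v^'v) set" where
  "sparse_sym E = {X. \<forall>i j. X $ i $ j = X $ j $ i \<and> (i \<noteq> j \<and> {i, j} \<notin> E \<longrightarrow> X $ i $ j = 0)}"

text \<open>Two vertex sets are tracked because attaching a vertex enlarges the support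
  \<open>V\<close>, while nonzero minors remain known only on the earlier vertices
  \<open>V'\<close>. The rank is only bounded above; a nonzero \<open>r\<close>-minor forces
  equality once \<open>V'\<close> has \<open>r\<close> elements.\<close>

definition low_rank :: "'v::finite set set \<Rightarrow> nat \<Rightarrow> 'v set \<Rightarrow> 'v set \<Rightarrow> (real^'v^'v) set" where
  "low_rank E r V V' = {\<Omega> \<in> sparse_sym E. (\<forall>i j. i \<notin> V \<longrightarrow> \<Omega> $ i $ j = 0) \<and> rank \<Omega> \<le> r \<and>
     (\<forall>S\<subseteq>V'. card S = r \<longrightarrow> principal_minor S \<Omega> \<noteq> 0)}"

section \<open>Columns and kernels of symmetric matrices of bounded rank\<close>

lemma symmetric_inner:
  fixes \<Omega> :: "real^'v::finite^'v"
  assumes "\<And>i j. \<Omega> $ i $ j = \<Omega> $ j $ i"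
  shows "(\<Omega> *v x) \<bullet> y = x \<bullet> (\<Omega> *v y)"
proof -
  have "transpose \<Omega> = \<Omega>" using assms by (simp add: transpose_def vec_eq_iff)
  then show ?thesis
    by (metis dot_lmul_matrix vector_transpose_matrix)
qed

lemma rank_le_columns:
  fixes \<Omega> :: "real^'n::finite^'m::finite"
  assumes "\<And>z. \<exists>y. (\<forall>i. i \<notin> S \<longrightarrow> y $ i = 0) \<and> \<Omega> *v z = \<Omega> *v y"
  shows "rank \<Omega> \<le> card S"
proof -
  let ?V = "{y :: real^'n. \<forall>i. i \<notin> S \<longrightarrow> y $ i = 0}"
  have "range ((*v) \<Omega>) \<subseteq> (*v) \<Omega> ` ?V" using assms by blast
  then have "dim (range ((*v) \<Omega>)) \<le> dim ((*v) \<Omega> ` ?V)" by (rule dim_subset)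
  also have "\<dots> \<le> dim ?V" by (rule dim_image_le) (rule matrix_vector_mul_linear)
  also have "\<dots> = card S" using dim_substandard_cart[of S, where 'a=real] by (simp add: dim_vec_eq)
  finally show ?thesis by (simp add: rank_dim_range)
qed

text \<open>By injectivity the image of the vectors supported on \<open>S\<close> has dimension
  \<open>card S\<close>, at least the rank, so it is the whole range.\<close>

lemma column_span_independent_columns:
  fixes \<Omega> :: "real^'n::finite^'m::finite"
  assumes "rank \<Omega> \<le> card S" and inj: "\<And>x. (\<forall>i. i \<notin> S \<longrightarrow> x $ i = 0) \<Longrightarrow> \<Omega> *v x = 0 \<Longrightarrow> x = 0"
  shows "\<exists>y. (\<forall>i. i \<notin> S \<longrightarrow> y $ i = 0) \<and> \<Omega> *v z = \<Omega> *v y"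
proof -
  let ?V = "{y :: real^'n. \<forall>i. i \<notin> S \<longrightarrow> y $ i = 0}"
  have subV: "subspace ?V" by (auto simp: subspace_def)
  have "inj_on ((*v) \<Omega>) ?V"
  proof (rule inj_onI)
    fix x y assume "x \<in> ?V" "y \<in> ?V" "\<Omega> *v x = \<Omega> *v y"
    then have "x - y = 0" by (intro inj) (auto simp: matrix_vector_mult_diff_distrib)
    then show "x = y" by simp
  qed
  then have "dim ((*v) \<Omega> ` ?V) = dim ?V"
    using subV by (intro dim_image_eq matrix_vector_mul_linear) (simp add: span_eq_iff[THEN iffD2])
  also have "\<dots> = card S" using dim_substandard_cart[of S, where 'a=real] by (simp add: dim_vec_eq)
  finally have "dim (range ((*v) \<Omega>)) \<le> dim ((*v) \<Omega> ` ?V)"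
    using assms(1) by (simp add: rank_dim_range)
  then have "(*v) \<Omega> ` ?V = range ((*v) \<Omega>)"
    by (intro subspace_dim_equal linear_subspace_image[OF matrix_vector_mul_linear] subV subspace_UNIV) auto
  then have "\<Omega> *v z \<in> (*v) \<Omega> ` ?V" by simp
  then show ?thesis by (auto simp only: image_iff mem_Collect_eq)
qed

lemma supported_kernel_trivial:
  assumes "principal_minor S \<Omega> \<noteq> 0" "\<forall>i. i \<notin> S \<longrightarrow> x $ i = 0" "\<Omega> *v x = 0"
  shows "x = 0"
  using assms unfolding principal_minor_nz_iff by simp

text \<open>Modulo the kernel every vector can be moved to one supported on \<open>S\<close>; by
  symmetry \<open>\<Omega> *v x\<close> pairs with both in the same way, and with the second one to
  zero.\<close>

lemma kernel_if_zero_on_columns: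
  fixes \<Omega> :: "real^'v::finite^'v"
  assumes sym: "\<And>i j. \<Omega> $ i $ j = \<Omega> $ j $ i" and rk: "rank \<Omega> \<le> card S"
    and inj: "\<And>x. (\<forall>i. i \<notin> S \<longrightarrow> x $ i = 0) \<Longrightarrow> \<Omega> *v x = 0 \<Longrightarrow> x = 0"
    and x: "\<And>i. i \<in> S \<Longrightarrow> (\<Omega> *v x) $ i = 0"
  shows "\<Omega> *v x = 0"
proof -
  have "(\<Omega> *v x) \<bullet> z = 0" for z
  proof -
    obtain y where y: "\<forall>i. i \<notin> S \<longrightarrow> y $ i = 0" "\<Omega> *v z = \<Omega> *v y"
      using column_span_independent_columns[OF rk inj] by metis
    have "(\<Omega> *v x) \<bullet> z = x \<bullet> (\<Omega> *v z)" by (rule symmetric_inner[OF sym])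
    also have "\<dots> = (\<Omega> *v x) \<bullet> y" using y(2) symmetric_inner[OF sym] by simp
    also have "\<dots> = 0"
      unfolding inner_vec_def using x y(1) by (intro sum.neutral) auto
    finally show ?thesis .
  qed
  then show ?thesis using inner_eq_zero_iff by blast
qed

lemma kernel_if_zero_on_minor:
  fixes \<Omega> :: "real^'v::finite^'v"
  assumes "\<And>i j. \<Omega> $ i $ j = \<Omega> $ j $ i" "rank \<Omega> \<le> card S" "principal_minor S \<Omega> \<noteq> 0"
    and "\<And>i. i \<in> S \<Longrightarrow> (\<Omega> *v x) $ i = 0"
  shows "\<Omega> *v x = 0"
  by (rule kernel_if_zero_on_columns[OF assms(1,2) supported_kernel_trivial[OF assms(3)] assms(4)])

section \<open>Attaching and detaching a vertex\<close>

definition restrict_matrix :: "'v::finite set \<Rightarrow> real^'v^'v \<Rightarrow> real^'v^'v" where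
  "restrict_matrix V \<Omega> = (\<chi> i j. if i \<in> V \<and> j \<in> V then \<Omega> $ i $ j else 0)"

lemma restrict_matrix_nth:
  "restrict_matrix V \<Omega> $ i $ j = (if i \<in> V \<and> j \<in> V then \<Omega> $ i $ j else 0)"
  by (simp add: restrict_matrix_def)

text \<open>
  The vertex \<open>u\<close> is attached by the congruence with \<open>mat 1 + y e\<^sub>u\<^sup>T\<close>: its column becomes
  \<open>\<Omega> *v y\<close>, and the rank does not grow.
\<close>

definition attach :: "'v::finite \<Rightarrow> real^'v^'v \<Rightarrow> real^'v \<Rightarrow> real^'v^'v" where
  "attach u \<Omega> y = (\<chi> i j. \<Omega> $ i $ j + (if i = u then (\<Omega> *v y) $ j else 0) +
     (if j = u then (\<Omega> *v y) $ i else 0) + (if i = u \<and> j = u then y \<bullet> (\<Omega> *v y) else 0))"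

text \<open>Restriction is compression by a coordinate projection, so the rank does not grow, and
  the entries on \<open>V'\<close> stay the same.\<close>

lemma restrict_matrix_in_low_rank:
  assumes "\<Omega> \<in> low_rank E r W V'" "V' \<subseteq> V"
  shows "restrict_matrix V \<Omega> \<in> low_rank E r V V'"
proof -
  define P :: "real^'a \<Rightarrow> real^'a" where "P = (\<lambda>z. \<chi> i. if i \<in> V then z $ i else 0)"
  have linP: "linear P" by (auto simp: P_def linear_iff vec_eq_iff)
  have "restrict_matrix V \<Omega> *v z = P (\<Omega> *v P z)" for z
    unfolding vec_eq_iff
  proof
    fix i
    show "(restrict_matrix V \<Omega> *v z) $ i = P (\<Omega> *v P z) $ i"
      by (auto simp: restrict_matrix_def P_def matrix_vector_mult_def intro!: sum.cong)
  qed
  then have "range ((*v) (restrict_matrix V \<Omega>)) \<subseteq> P ` range ((*v) \<Omega>)" by auto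
  then have "dim (range ((*v) (restrict_matrix V \<Omega>))) \<le> dim (P ` range ((*v) \<Omega>))" by (rule dim_subset)
  also have "\<dots> \<le> dim (range ((*v) \<Omega>))" by (rule dim_image_le[OF linP])
  finally have "rank (restrict_matrix V \<Omega>) \<le> r"
    using assms(1) by (simp add: rank_dim_range low_rank_def)
  moreover have "principal_minor S (restrict_matrix V \<Omega>) \<noteq> 0" if "S \<subseteq> V'" "card S = r" for S
  proof -
    have "principal_minor S \<Omega> \<noteq> 0" using assms(1) that by (simp add: low_rank_def)
    moreover have "restrict_matrix V \<Omega> $ i $ j = \<Omega> $ i $ j" if "i \<in> S" "j \<in> S" for i j
      using that \<open>S \<subseteq> V'\<close> assms(2) by (auto simp: restrict_matrix_def)
    ultimately show ?thesis using principal_minor_nz_cong by metis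
  qed
  ultimately show ?thesis
    using assms(1) by (auto simp: low_rank_def sparse_sym_def restrict_matrix_def)
qed

lemma attach_in_low_rank:
  assumes \<Omega>: "\<Omega> \<in> low_rank E r V V'" and u: "u \<notin> V'"
    and y: "\<And>i. i \<in> V \<Longrightarrow> {i, u} \<notin> E \<Longrightarrow> (\<Omega> *v y) $ i = 0" and "u \<notin> V"
  shows "attach u \<Omega> y \<in> low_rank E r (insert u V) V'"
proof -
  have sym: "\<And>i j. \<Omega> $ i $ j = \<Omega> $ j $ i" and off: "\<And>i j. i \<notin> V \<Longrightarrow> \<Omega> $ i $ j = 0"
    and E: "\<And>i j. i \<noteq> j \<Longrightarrow> {i, j} \<notin> E \<Longrightarrow> \<Omega> $ i $ j = 0"
    using \<Omega> by (auto simp: low_rank_def sparse_sym_def)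
  have off': "\<Omega> $ i $ j = 0" if "j \<notin> V" for i j using sym off that by metis
  have offy: "(\<Omega> *v y) $ i = 0" if "i \<notin> V" for i
    using off[OF that] by (simp add: matrix_vector_mult_def)
  have y': "(\<Omega> *v y) $ i = 0" if "{i, u} \<notin> E" for i using y offy that by blast
  \<comment> \<open>The transpose of \<open>mat 1 + y e\<^sub>u\<^sup>T\<close>, that is, the left
    factor of the congruence.\<close>
  define L :: "real^'a \<Rightarrow> real^'a" where "L = (\<lambda>w. w + (y \<bullet> w) *s axis u 1)"
  have linL: "linear L"
    by (auto simp: L_def linear_iff inner_add_right algebra_simps vec_eq_iff)
  have eq: "attach u \<Omega> y *v z = L (\<Omega> *v (z + z $ u *s y))" for z
    unfolding vec_eq_iff
  proof
    fix i
    have *: "y \<bullet> (\<Omega> *v z) = (\<Omega> *v y) \<bullet> z" using symmetric_inner[OF sym] by simp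
    have "(attach u \<Omega> y *v z) $ i = (\<Omega> *v z) $ i + (if i = u then (\<Omega> *v y) \<bullet> z else 0)
        + (\<Omega> *v y) $ i * z $ u + (if i = u then (y \<bullet> (\<Omega> *v y)) * z $ u else 0)"
      by (simp add: attach_def matrix_vector_mult_def inner_vec_def sum.distrib distrib_right
          if_distrib[of "\<lambda>x. x * _"] if_distribR cong: if_cong)
    then show "(attach u \<Omega> y *v z) $ i = L (\<Omega> *v (z + z $ u *s y)) $ i"
      by (simp add: L_def matrix_vector_right_distrib vector_scalar_commute inner_add_right
          axis_def * scalar_mult_eq_scaleR algebra_simps)
  qed
  have "range ((*v) (attach u \<Omega> y)) \<subseteq> L ` range ((*v) \<Omega>)" using eq by auto
  then have "dim (range ((*v) (attach u \<Omega> y))) \<le> dim (L ` range ((*v) \<Omega>))" by (rule dim_subset)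
  also have "\<dots> \<le> dim (range ((*v) \<Omega>))" by (rule dim_image_le[OF linL])
  finally have "rank (attach u \<Omega> y) \<le> r"
    using \<Omega> by (simp add: rank_dim_range low_rank_def)
  moreover have "principal_minor S (attach u \<Omega> y) \<noteq> 0" if S: "S \<subseteq> V'" "card S = r" for S
  proof -
    have "principal_minor S \<Omega> \<noteq> 0" using \<Omega> S by (simp add: low_rank_def)
    moreover have "attach u \<Omega> y $ i $ j = \<Omega> $ i $ j" if "i \<in> S" "j \<in> S" for i j
      using that S u by (auto simp: attach_def)
    ultimately show ?thesis using principal_minor_nz_cong by metis
  qed
  moreover have "attach u \<Omega> y \<in> sparse_sym E"
    unfolding sparse_sym_def
  proof (intro CollectI allI conjI impI)
    fix i j
    show "attach u \<Omega> y $ i $ j = attach u \<Omega> y $ j $ i" using sym by (auto simp: attach_def)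
    assume "i \<noteq> j \<and> {i, j} \<notin> E"
    then show "attach u \<Omega> y $ i $ j = 0"
      using E y'[of i] y'[of j] by (auto simp: attach_def insert_commute)
  qed
  moreover have "attach u \<Omega> y $ i $ j = 0" if "i \<notin> insert u V" for i j
    using that off offy by (auto simp: attach_def)
  ultimately show ?thesis by (simp add: low_rank_def)
qed

text \<open>The rank bound makes column \<open>u\<close> a combination of \<open>r\<close>
  independent columns indexed inside \<open>V'\<close>; its coefficients are the required
  \<open>y\<close>.\<close>

lemma attach_surjective:
  assumes \<Omega>: "\<Omega> \<in> low_rank E r (insert u V) V'" and V: "V' \<subseteq> V" "u \<notin> V" "r \<le> card V'"
  shows "\<exists>y. attach u (restrict_matrix V \<Omega>) y = \<Omega> \<and>
    (\<forall>i\<in>V. {i, u} \<notin> E \<longrightarrow> (restrict_matrix V \<Omega> *v y) $ i = 0)"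
proof -
  have sym: "\<And>i j. \<Omega> $ i $ j = \<Omega> $ j $ i" and off: "\<And>i j. i \<notin> insert u V \<Longrightarrow> \<Omega> $ i $ j = 0"
    and E: "\<And>i j. i \<noteq> j \<Longrightarrow> {i, j} \<notin> E \<Longrightarrow> \<Omega> $ i $ j = 0" and rk: "rank \<Omega> \<le> r"
    using \<Omega> by (auto simp: low_rank_def sparse_sym_def)
  have off': "\<Omega> $ i $ j = 0" if "j \<notin> insert u V" for i j using sym off that by metis
  obtain S where S: "S \<subseteq> V'" "card S = r" using V(3) by (meson obtain_subset_with_card_n)
  have nz: "principal_minor S \<Omega> \<noteq> 0" using \<Omega> S by (simp add: low_rank_def)
  obtain y where y: "\<And>i. i \<notin> S \<Longrightarrow> y $ i = 0" "\<Omega> *v axis u 1 = \<Omega> *v y"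
    using column_span_independent_columns[of \<Omega> S "axis u 1"] rk S(2) supported_kernel_trivial[OF nz] by metis
  have col: "(\<Omega> *v y) $ i = \<Omega> $ i $ u" for i
    using y(2) by (metis matrix_vector_mul_component matrix_vector_mult_basis column_def vec_lambda_beta)
  have ry: "(restrict_matrix V \<Omega> *v y) $ i = (if i \<in> V then \<Omega> $ i $ u else 0)" for i
  proof (cases "i \<in> V")
    case True
    have "(restrict_matrix V \<Omega> *v y) $ i = (\<Sum>j\<in>S. restrict_matrix V \<Omega> $ i $ j * y $ j)"
      by (rule matrix_vector_mult_supported) (rule y(1))
    also have "\<dots> = (\<Sum>j\<in>S. \<Omega> $ i $ j * y $ j)"
      using True S(1) V(1) by (intro sum.cong) (auto simp: restrict_matrix_def)
    also have "\<dots> = (\<Omega> *v y) $ i" by (rule matrix_vector_mult_supported[symmetric]) (rule y(1))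
    finally show ?thesis using col True by simp
  qed (simp add: restrict_matrix_def matrix_vector_mult_def)
  \<comment> \<open>The diagonal entry is forced as well: row \<open>u\<close> satisfies the same
    column relation.\<close>
  have yy: "y \<bullet> (restrict_matrix V \<Omega> *v y) = \<Omega> $ u $ u"
  proof -
    have "y \<bullet> (restrict_matrix V \<Omega> *v y) = (\<Sum>i\<in>UNIV. y $ i * (if i \<in> V then \<Omega> $ i $ u else 0))"
      by (simp add: inner_vec_def ry)
    also have "\<dots> = (\<Sum>i\<in>S. y $ i * (if i \<in> V then \<Omega> $ i $ u else 0))"
      using y(1) by (intro sum.mono_neutral_right) auto
    also have "\<dots> = (\<Sum>i\<in>S. \<Omega> $ u $ i * y $ i)"
      using S(1) V(1) sym[of u] by (intro sum.cong) auto
    also have "\<dots> = (\<Omega> *v y) $ u" by (rule matrix_vector_mult_supported[symmetric]) (rule y(1))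
    finally show ?thesis using col by simp
  qed
  have "attach u (restrict_matrix V \<Omega>) y = \<Omega>"
    unfolding vec_eq_iff
  proof (intro allI)
    fix i j
    show "attach u (restrict_matrix V \<Omega>) y $ i $ j = \<Omega> $ i $ j"
      using off[of i j] off'[of j i] V(2) sym[of i u] sym[of u j]
      by (auto simp: attach_def ry yy restrict_matrix_nth)
  qed
  moreover have "(restrict_matrix V \<Omega> *v y) $ i = 0" if "i \<in> V" "{i, u} \<notin> E" for i
    using ry[of i] E[of i u] that V(2) by auto
  ultimately show ?thesis by blast
qed

text \<open>\<open>y\<close> is determined only modulo the kernel of \<open>\<Omega>\<close>; a
  surjective polynomial map is enough to transfer irreducibility.\<close>

lemma low_rank_insert_eq:
  assumes V: "V' \<subseteq> V" "u \<notin> V" "r \<le> card V'"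
  shows "low_rank E r (insert u V) V' = (\<lambda>p. attach u (fst p) (snd p)) `
    (SIGMA \<Omega>:low_rank E r V V'. {y. \<forall>i\<in>{i\<in>V. {i, u} \<notin> E}. (\<Omega> *v y) $ i = 0})" (is "?L = ?f ` ?R")
proof
  have "attach u \<Omega> y \<in> ?L" if "\<Omega> \<in> low_rank E r V V'" "\<forall>i\<in>{i\<in>V. {i, u} \<notin> E}. (\<Omega> *v y) $ i = 0" for \<Omega> y
    by (rule attach_in_low_rank[OF that(1)]) (use that(2) V in auto)
  then show "?f ` ?R \<subseteq> ?L" by auto
  show "?L \<subseteq> ?f ` ?R"
  proof
    fix \<Omega> assume \<Omega>: "\<Omega> \<in> ?L"
    obtain y where y: "attach u (restrict_matrix V \<Omega>) y = \<Omega>"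
      "\<forall>i\<in>V. {i, u} \<notin> E \<longrightarrow> (restrict_matrix V \<Omega> *v y) $ i = 0"
      using attach_surjective[OF \<Omega> V] by blast
    have "(restrict_matrix V \<Omega>, y) \<in> ?R"
      using restrict_matrix_in_low_rank[OF \<Omega> V(1)] y(2) by auto
    then show "\<Omega> \<in> ?f ` ?R" using y(1) by force
  qed
qed

lemma polynomial_function_attach: "polynomial_function (\<lambda>p. attach u (fst p) (snd p))"
proof (rule polynomial_function_matrixI)
  fix i j
  have mv: "real_polynomial_function (\<lambda>p :: (real^'a^'a) \<times> (real^'a). (fst p *v snd p) $ k)" for k :: 'a
    by (rule real_polynomial_function_matrix_vector_nth[OF polynomial_function_fst polynomial_function_snd])
  have e: "real_polynomial_function (\<lambda>p :: (real^'a^'a) \<times> (real^'a). fst p $ i $ j)"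
    by (rule real_polynomial_function_nth[OF polynomial_function_entry[OF polynomial_function_fst]])
  have s: "real_polynomial_function (\<lambda>p :: (real^'a^'a) \<times> (real^'a). snd p $ k)" for k
    by (rule real_polynomial_function_nth[OF polynomial_function_snd])
  have q: "real_polynomial_function (\<lambda>p :: (real^'a^'a) \<times> (real^'a). snd p \<bullet> (fst p *v snd p))"
    by (simp add: inner_vec_def, intro real_polynomial_function_sum real_polynomial_function.intros(4) finite s mv)
  have if0: "real_polynomial_function (\<lambda>p. if b then f p else 0)" if "real_polynomial_function f"
    for b and f :: "(real^'a^'a) \<times> (real^'a) \<Rightarrow> real" using that real_polynomial_function.intros(2) by (cases b) auto
  show "real_polynomial_function (\<lambda>p. attach u (fst p) (snd p) $ i $ j)"
    unfolding attach_def by (simp, intro real_polynomial_function.intros(3) e if0 mv q)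
qed

text \<open>The earlier non-neighbours of \<open>u\<close> extend to an \<open>r\<close>-subset of
  \<open>V'\<close>, whose nonzero minor makes the equations for the new vertex independent.\<close>

lemma poly_irreducible_low_rank_insert:
  assumes V: "V' \<subseteq> V" "u \<notin> V" "r \<le> card V'" and irr: "poly_irreducible (low_rank E r V V')"
    and N: "{i\<in>V. {i, u} \<notin> E} \<subseteq> V'" "card {i\<in>V. {i, u} \<notin> E} \<le> r"
  shows "poly_irreducible (low_rank E r (insert u V) V')"
proof -
  obtain S where S: "{i\<in>V. {i, u} \<notin> E} \<subseteq> S" "S \<subseteq> V'" "card S = r"
    using exists_subset_between[OF N(2) V(3) N(1)] by auto
  show ?thesis
    unfolding low_rank_insert_eq[OF V]
    by (intro poly_irreducible_image[OF poly_irreducible_kernel_bundle[OF irr polynomial_function_id S(1)]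
          polynomial_function_attach])
      (use S in \<open>auto simp: low_rank_def\<close>)
qed

section \<open>Irreducibility and general position by induction on the vertex set\<close>

lemma low_rank_antimono: "V' \<subseteq> V'' \<Longrightarrow> low_rank E r V V'' \<subseteq> low_rank E r V V'"
  by (auto simp: low_rank_def)

lemma low_rank_mono_support: "V \<subseteq> W \<Longrightarrow> low_rank E r V V' \<subseteq> low_rank E r W V'"
  by (auto simp: low_rank_def)

lemma low_rank_refine:
  assumes "V' \<subseteq> V''"
  shows "low_rank E r V V'' = {\<Omega>\<in>low_rank E r V V'. \<forall>S\<in>{S. S \<subseteq> V'' \<and> card S = r}. principal_minor S \<Omega> \<noteq> 0}"
  using assms by (auto simp: low_rank_def)

lemma poly_irreducible_low_rank_refine:
  assumes "poly_irreducible (low_rank E r V V')" "V' \<subseteq> V''"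
  shows "poly_irreducible (low_rank E r V V'')"
  unfolding low_rank_refine[OF assms(2)]
  by (rule poly_irreducible_open_family[OF assms(1)])
    (auto intro: real_polynomial_function_principal_minor)

lemma low_rank_minors_nonzero:
  assumes T: "poly_irreducible (low_rank E r V V')" "low_rank E r V V' \<noteq> {}"
    and A: "\<And>S. S \<in> A \<Longrightarrow> \<exists>\<Omega>\<in>low_rank E r V V'. principal_minor S \<Omega> \<noteq> 0"
  shows "\<exists>\<Omega>\<in>low_rank E r V V'. \<forall>S\<in>A. principal_minor S \<Omega> \<noteq> 0"
  by (rule poly_irreducible_finite_family[OF T])
    (auto intro: real_polynomial_function_principal_minor A)

text \<open>On exactly \<open>r\<close> vertices the rank bound is automatic, so the set is a linear
  space minus the zeros of one minor; the diagonal matrix of ones on \<open>V\<close> belongs to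
  it.\<close>

lemma low_rank_base:
  fixes V :: "'v::finite set"
  assumes V: "card V = r"
  shows "poly_irreducible (low_rank E r V V)" "low_rank E r V V \<noteq> {}"
proof -
  define C where "C = {\<Omega> \<in> sparse_sym E. \<forall>i j. i \<notin> V \<longrightarrow> \<Omega> $ i $ j = 0}"
  have rk: "rank \<Omega> \<le> r" if "\<Omega> \<in> C" for \<Omega>
  proof -
    have off: "\<Omega> $ i $ j = 0" if "j \<notin> V" for i j
    proof -
      have "\<Omega> $ i $ j = \<Omega> $ j $ i" using \<open>\<Omega> \<in> C\<close> by (simp add: C_def sparse_sym_def)
      then show ?thesis using \<open>\<Omega> \<in> C\<close> that by (simp add: C_def)
    qed
    have "\<exists>y. (\<forall>i. i \<notin> V \<longrightarrow> y $ i = 0) \<and> \<Omega> *v z = \<Omega> *v y" for z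
      by (intro exI[of _ "\<chi> i. if i \<in> V then z $ i else 0"])
        (auto simp: matrix_vector_mult_def vec_eq_iff off intro!: sum.cong)
    then show ?thesis using rank_le_columns V by blast
  qed
  have eq: "low_rank E r V V = {\<Omega>\<in>C. principal_minor V \<Omega> \<noteq> 0}"
  proof -
    have "S = V" if "S \<subseteq> V" "card S = r" for S
      using that V by (simp add: card_subset_eq)
    then show ?thesis using rk V by (auto simp: low_rank_def C_def)
  qed
  have "convex C" by (auto simp: C_def sparse_sym_def convex_def)
  then show "poly_irreducible (low_rank E r V V)"
    unfolding eq
    by (intro poly_irreducible_open poly_irreducible_convex real_polynomial_function_principal_minor
        polynomial_function_id)
  define D :: "real^'v^'v" where "D = (\<chi> i j. if i = j \<and> i \<in> V then 1 else 0)"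
  have "(D *v x) $ i = x $ i" if "i \<in> V" for x i
    using that by (simp add: D_def matrix_vector_mult_def if_distrib[of "\<lambda>y. y * _"] cong: if_cong)
  then have "principal_minor V D \<noteq> 0"
    unfolding principal_minor_nz_iff by (auto simp: vec_eq_iff)
  moreover have "D \<in> C" by (auto simp: C_def D_def sparse_sym_def)
  ultimately show "low_rank E r V V \<noteq> {}" unfolding eq by blast
qed

text \<open>With \<open>Suc r\<close> vertices, removing both \<open>u\<close> and \<open>w\<close>
  leaves too few for an \<open>r\<close>-minor, so a matrix is written down: the identity on
  \<open>V\<close> with extra ones at the edge. Its block on \<open>u\<close>, \<open>w\<close> has
  rank one, and deleting either vertex leaves an identity block.\<close>

lemma low_rank_meet_small:
  fixes V :: "'v::finite set"
  assumes V: "card V = Suc r" and uw: "u \<in> V" "w \<in> V" "u \<noteq> w" "{u, w} \<in> E"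
  shows "\<exists>\<Omega>. \<Omega> \<in> low_rank E r V (V - {u}) \<and> \<Omega> \<in> low_rank E r V (V - {w})"
proof -
  define D :: "real^'v^'v" where
    "D = (\<chi> i j. (if i \<in> V then if j = i then 1 else 0 else 0) + (if i = u then if j = w then 1 else 0 else 0)
      + (if i = w then if j = u then 1 else 0 else 0))"
  have cV: "card (V - {u}) = r" "card (V - {w}) = r" using V uw by auto
  have Dmult: "(D *v x) $ i = (if i \<notin> V then 0 else if i = u \<or> i = w then x $ u + x $ w else x $ i)" for x i
    using uw
    by (simp add: D_def matrix_vector_mult_def distrib_right sum.distrib
        if_distrib[of "\<lambda>y. y * _"] cong: if_cong)
  have "\<exists>y. (\<forall>i. i \<notin> V - {u} \<longrightarrow> y $ i = 0) \<and> D *v z = D *v y" for z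
    using uw
    by (intro exI[of _ "\<chi> i. if i = u \<or> i \<notin> V then 0 else if i = w then z $ u + z $ w else z $ i"])
      (auto simp: vec_eq_iff Dmult)
  then have rk: "rank D \<le> r" using rank_le_columns[of "V - {u}" D] cV by simp
  have "x = 0" if v: "v = u \<or> v = w" and D0: "\<forall>i\<in>V - {v}. (D *v x) $ i = 0"
    and x0: "\<forall>i. i \<notin> V - {v} \<longrightarrow> x $ i = 0" for v x
    unfolding vec_eq_iff
  proof
    fix i
    show "x $ i = 0 $ i"
    proof (cases "i \<in> V - {v}")
      case True
      have "(D *v x) $ i = 0" using D0 True by blast
      moreover have "x $ v = 0" using x0 by blast
      ultimately show ?thesis using True v by (auto simp: Dmult split: if_splits)
    qed (use x0 in simp)
  qed
  then have minor: "principal_minor (V - {v}) D \<noteq> 0" if "v = u \<or> v = w" for v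
    unfolding principal_minor_nz_iff using that by blast
  have Seq: "S = V - {v}" if "S \<subseteq> V - {v}" "card S = r" "v = u \<or> v = w" for S v
    by (rule card_subset_eq) (use that cV in auto)
  have sp: "D \<in> sparse_sym E" using uw by (auto simp: D_def sparse_sym_def insert_commute)
  have off: "\<forall>i j. i \<notin> V \<longrightarrow> D $ i $ j = 0" using uw by (auto simp: D_def)
  have "D \<in> low_rank E r V (V - {v})" if v: "v = u \<or> v = w" for v
  proof -
    have "\<forall>S\<subseteq>V - {v}. card S = r \<longrightarrow> principal_minor S D \<noteq> 0"
      using Seq[OF _ _ v] minor[OF v] by metis
    then show ?thesis unfolding low_rank_def using rk sp off by simp
  qed
  then show ?thesis by blast
qed

text \<open>Both sets arise from the irreducible set with minors controlled on
  \<open>V - {u, w}\<close> by requiring further minors to be nonzero; nonempty open subsets of an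
  irreducible set intersect.\<close>

lemma low_rank_meet:
  assumes V: "card V \<ge> r + 2" and uw: "u \<in> V" "w \<in> V" "u \<noteq> w" "{u, w} \<in> E"
    and deg: "\<And>u. card {i. i \<noteq> u \<and> {i, u} \<notin> E} \<le> r"
    and irr: "poly_irreducible (low_rank E r (V - {u, w}) (V - {u, w}))"
    and ne: "low_rank E r V (V - {u}) \<noteq> {}" "low_rank E r V (V - {w}) \<noteq> {}"
  shows "\<exists>\<Omega>. \<Omega> \<in> low_rank E r V (V - {u}) \<and> \<Omega> \<in> low_rank E r V (V - {w})"
proof -
  let ?Q = "V - {u, w}"
  have cQ: "r \<le> card ?Q" using V uw by (simp add: card_Diff_subset)
  have N: "card {i\<in>Z. {i, x} \<notin> E} \<le> r" if "x \<notin> Z" for x Z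
  proof -
    have "{i\<in>Z. {i, x} \<notin> E} \<subseteq> {i. i \<noteq> x \<and> {i, x} \<notin> E}" using that by auto
    then have "card {i\<in>Z. {i, x} \<notin> E} \<le> card {i. i \<noteq> x \<and> {i, x} \<notin> E}" by (intro card_mono) auto
    then show ?thesis using deg[of x] by simp
  qed
  have irr1: "poly_irreducible (low_rank E r (insert u ?Q) ?Q)"
    by (rule poly_irreducible_low_rank_insert[OF _ _ cQ irr _ N]) auto
  \<comment> \<open>As \<open>u\<close> and \<open>w\<close> are adjacent, the equations for
    \<open>w\<close> involve only vertices of \<open>?Q\<close>, where the minors are known to be
    nonzero.\<close>
  have "poly_irreducible (low_rank E r (insert w (insert u ?Q)) ?Q)"
    by (rule poly_irreducible_low_rank_insert[OF _ _ cQ irr1 _ N]) (use uw in auto)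
  moreover have "insert w (insert u ?Q) = V" using uw by auto
  ultimately have irrX: "poly_irreducible (low_rank E r V ?Q)" by simp
  have sub: "low_rank E r V (V - {u}) \<subseteq> low_rank E r V ?Q" "low_rank E r V (V - {w}) \<subseteq> low_rank E r V ?Q"
    by (intro low_rank_antimono; auto)+
  let ?A = "{S. (S \<subseteq> V - {u} \<or> S \<subseteq> V - {w}) \<and> card S = r}"
  have "\<exists>\<Omega>\<in>low_rank E r V ?Q. \<forall>S\<in>?A. principal_minor S \<Omega> \<noteq> 0"
  proof (rule low_rank_minors_nonzero[OF irrX])
    show "low_rank E r V ?Q \<noteq> {}" using ne sub by blast
    fix S assume S: "S \<in> ?A"
    obtain a b where "a \<in> low_rank E r V (V - {u})" "b \<in> low_rank E r V (V - {w})" using ne by blast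
    then have "a \<in> low_rank E r V ?Q" "b \<in> low_rank E r V ?Q"
      "principal_minor S a \<noteq> 0 \<or> principal_minor S b \<noteq> 0"
      using sub S by (auto simp: low_rank_def)
    then show "\<exists>\<Omega>\<in>low_rank E r V ?Q. principal_minor S \<Omega> \<noteq> 0" by blast
  qed
  then show ?thesis by (auto simp: low_rank_def)
qed

text \<open>
  This is the core of the Lovasz--Saks--Schrijver theorem. Each \<open>low_rank E r V (V - {u})\<close> is irreducible, as
  it arises by attaching \<open>u\<close> last, and those of adjacent \<open>u\<close> share a point; since the graph induced
  on \<open>V\<close> is connected, all of them do.
\<close>

theorem low_rank_generic:
  fixes V :: "'v::finite set"
  assumes E: "simple_graph E"
    and deg: "\<And>u. card {i. i \<noteq> u \<and> {i, u} \<notin> E} \<le> r"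
    and conn: "\<And>W. card W > r \<Longrightarrow> connected_induced E W"
    and "card V \<ge> r"
  shows "poly_irreducible (low_rank E r V V) \<and> low_rank E r V V \<noteq> {}"
  using assms(4)
proof (induction "card V" arbitrary: V rule: less_induct)
  case less
  show ?case
  proof (cases "card V = r")
    case True
    then show ?thesis using low_rank_base by blast
  next
    case False
    then have cV: "card V > r" using less.prems by simp
    have IH: "poly_irreducible (low_rank E r W W)" "low_rank E r W W \<noteq> {}" if "W \<subset> V" "card W \<ge> r" for W
      using less.hyps[of W] that by (simp_all add: psubset_card_mono)
    have sub: "V - {u} \<subset> V" "card (V - {u}) \<ge> r" if "u \<in> V" for u
      using that cV by auto
    have irrU: "poly_irreducible (low_rank E r V (V - {u}))" if "u \<in> V" for u
    proof -
      have "{i\<in>V - {u}. {i, u} \<notin> E} \<subseteq> {i. i \<noteq> u \<and> {i, u} \<notin> E}" by auto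
      then have "card {i\<in>V - {u}. {i, u} \<notin> E} \<le> card {i. i \<noteq> u \<and> {i, u} \<notin> E}" by (intro card_mono) auto
      then have "poly_irreducible (low_rank E r (insert u (V - {u})) (V - {u}))"
        using sub[OF that] IH[OF sub[OF that]] deg[of u]
        by (intro poly_irreducible_low_rank_insert) auto
      then show ?thesis using that by (simp add: insert_absorb)
    qed
    \<comment> \<open>A matrix on \<open>V - {u}\<close> also counts as one on \<open>V\<close>,
      with zero row and column at \<open>u\<close>.\<close>
    have neU: "low_rank E r V (V - {u}) \<noteq> {}" if "u \<in> V" for u
      using IH(2)[OF sub[OF that]] low_rank_mono_support[of "V - {u}" V E r "V - {u}"] by blast
    have meet: "\<exists>\<Omega>. \<Omega> \<in> low_rank E r V (V - {u}) \<and> \<Omega> \<in> low_rank E r V (V - {w})"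
      if uw: "u \<in> V" "w \<in> V" "{u, w} \<in> E" for u w
    proof -
      have "u \<noteq> w" using E uw(3) by (auto simp: simple_graph_def)
      show ?thesis
      proof (cases "card V = Suc r")
        case True
        then show ?thesis using low_rank_meet_small uw \<open>u \<noteq> w\<close> by blast
      next
        case False
        then have c: "card V \<ge> r + 2" using cV by simp
        then have "card (V - {u, w}) \<ge> r" using uw \<open>u \<noteq> w\<close> by (simp add: card_Diff_subset)
        moreover have "V - {u, w} \<subset> V" using uw by auto
        ultimately show ?thesis
          using low_rank_meet[OF c uw(1,2) \<open>u \<noteq> w\<close> uw(3) deg] IH(1) neU[OF uw(1)] neU[OF uw(2)] by blast
      qed
    qed
    obtain u0 where u0: "u0 \<in> V" using cV by (metis card.empty ex_in_conv not_less_zero)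
    have all_meet: "\<exists>\<Omega>. \<Omega> \<in> low_rank E r V (V - {u0}) \<and> \<Omega> \<in> low_rank E r V (V - {w})" if w: "w \<in> V" for w
    proof -
      have "(u0, w) \<in> {(x, y). x \<in> V \<and> y \<in> V \<and> {x, y} \<in> E}\<^sup>*"
        using conn[OF cV] u0 w by (simp add: connected_induced_def)
      then show ?thesis
      proof (induction rule: rtrancl_induct)
        case base
        then show ?case using neU[OF u0] by blast
      next
        case (step y z)
        then have yz: "y \<in> V" "z \<in> V" "{y, z} \<in> E" by auto
        obtain a where a: "a \<in> low_rank E r V (V - {u0})" "a \<in> low_rank E r V (V - {y})"
          using step.IH by blast
        obtain b where b: "b \<in> low_rank E r V (V - {y})" "b \<in> low_rank E r V (V - {z})"
          using meet[OF yz] by blast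
        let ?A = "{S. (S \<subseteq> V - {u0} \<or> S \<subseteq> V - {z}) \<and> card S = r}"
        \<comment> \<open>\<open>a\<close> witnesses the minors that avoid \<open>u0\<close> and
          \<open>b\<close> those that avoid \<open>z\<close>; both lie in the irreducible set for
          \<open>y\<close>, where one matrix then serves for all.\<close>
        have "\<exists>\<Omega>\<in>low_rank E r V (V - {y}). \<forall>S\<in>?A. principal_minor S \<Omega> \<noteq> 0"
        proof (rule low_rank_minors_nonzero[OF irrU[OF yz(1)] neU[OF yz(1)]])
          fix S assume "S \<in> ?A"
          then have "principal_minor S a \<noteq> 0 \<or> principal_minor S b \<noteq> 0"
            using a b by (auto simp: low_rank_def)
          then show "\<exists>\<Omega>\<in>low_rank E r V (V - {y}). principal_minor S \<Omega> \<noteq> 0" using a b by blast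
        qed
        then show ?case by (auto simp: low_rank_def)
      qed
    qed
    \<comment> \<open>Each \<open>r\<close>-subset omits some \<open>w\<close> in \<open>V\<close>,
      and the point shared by the sets for \<open>u0\<close> and \<open>w\<close> witnesses its
      minor.\<close>
    have "\<exists>\<Omega>\<in>low_rank E r V (V - {u0}). \<forall>S\<in>{S. S \<subseteq> V \<and> card S = r}. principal_minor S \<Omega> \<noteq> 0"
    proof (rule low_rank_minors_nonzero[OF irrU[OF u0] neU[OF u0]])
      fix S assume S: "S \<in> {S. S \<subseteq> V \<and> card S = r}"
      then have "S \<noteq> V" using cV by auto
      then obtain w where w: "w \<in> V" "w \<notin> S" using S by blast
      obtain a where "a \<in> low_rank E r V (V - {u0})" "a \<in> low_rank E r V (V - {w})"
        using all_meet[OF w(1)] by blast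
      moreover have "S \<subseteq> V - {w}" "card S = r" using S w by auto
      then have "principal_minor S a \<noteq> 0" if "a \<in> low_rank E r V (V - {w})" for a
        using that by (simp add: low_rank_def)
      ultimately show "\<exists>\<Omega>\<in>low_rank E r V (V - {u0}). principal_minor S \<Omega> \<noteq> 0" by blast
    qed
    then have "low_rank E r V V \<noteq> {}" by (auto simp: low_rank_def)
    then show ?thesis using poly_irreducible_low_rank_refine[OF irrU[OF u0]] by blast
  qed
qed

section \<open>General position stress matrices\<close>

lemma columns_independent_iff:
  fixes \<Omega> :: "real^'n::finite^'m::finite"
  shows "inj_on (\<lambda>j. column j \<Omega>) S \<and> independent ((\<lambda>j. column j \<Omega>) ` S) \<longleftrightarrow>
     (\<forall>x. (\<forall>i. i \<notin> S \<longrightarrow> x $ i = 0) \<and> \<Omega> *v x = 0 \<longrightarrow> x = 0)" (is "?L \<longleftrightarrow> ?R")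
proof -
  have mult: "\<Omega> *v x = (\<Sum>j\<in>S. x $ j *\<^sub>R column j \<Omega>)" if "\<forall>i. i \<notin> S \<longrightarrow> x $ i = 0" for x
  proof -
    have "\<Omega> *v x = (\<Sum>j\<in>UNIV. x $ j *\<^sub>R column j \<Omega>)"
      by (simp add: matrix_mult_sum scalar_mult_eq_scaleR)
    also have "\<dots> = (\<Sum>j\<in>S. x $ j *\<^sub>R column j \<Omega>)"
      using that by (intro sum.mono_neutral_right) auto
    finally show ?thesis .
  qed
  show ?thesis
  proof
    assume L: ?L
    show ?R
    proof (intro allI impI, elim conjE)
      fix x assume x: "\<forall>i. i \<notin> S \<longrightarrow> x $ i = 0" "\<Omega> *v x = 0"
      have inv: "inv_into S (\<lambda>j. column j \<Omega>) (column j \<Omega>) = j" if "j \<in> S" for j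
        using inv_into_f_f[OF conjunct1[OF L] that] by simp
      let ?g = "\<lambda>v. x $ (inv_into S (\<lambda>j. column j \<Omega>) v)"
      have "(\<Sum>v\<in>(\<lambda>j. column j \<Omega>) ` S. ?g v *\<^sub>R v) = (\<Sum>j\<in>S. x $ j *\<^sub>R column j \<Omega>)"
        using L by (subst sum.reindex) (auto simp: inv intro!: sum.cong)
      then have 0: "(\<Sum>v\<in>(\<lambda>j. column j \<Omega>) ` S. ?g v *\<^sub>R v) = 0" using mult[OF x(1)] x(2) by simp
      have "x $ j = 0" if "j \<in> S" for j
      proof -
        have "?g (column j \<Omega>) = 0"
          using independentD[OF conjunct2[OF L] _ subset_refl 0, of "column j \<Omega>"] that by simp
        then show ?thesis using inv[OF that] by simp
      qed
      then show "x = 0" using x(1) by (auto simp: vec_eq_iff)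
    qed
  next
    assume R: ?R
    have inj: "inj_on (\<lambda>j. column j \<Omega>) S"
    proof (rule inj_onI, rule ccontr)
      fix i j assume ij: "i \<in> S" "j \<in> S" "column i \<Omega> = column j \<Omega>" "i \<noteq> j"
      have "\<Omega> *v (axis i 1 - axis j 1) = 0"
        using ij(3) by (simp add: matrix_vector_mult_diff_distrib matrix_vector_mult_basis)
      then have "axis i 1 - axis j (1::real) = 0"
        using ij(1,2) by (intro R[rule_format]) (auto simp: axis_def)
      then have "(axis i 1 - axis j (1::real)) $ i = 0" by simp
      then show False using ij(4) by (simp add: axis_def)
    qed
    moreover have "independent ((\<lambda>j. column j \<Omega>) ` S)"
    proof (rule independent_if_scalars_zero)
      fix f v assume f: "(\<Sum>v\<in>(\<lambda>j. column j \<Omega>) ` S. f v *\<^sub>R v) = 0" and v: "v \<in> (\<lambda>j. column j \<Omega>) ` S"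
      define x :: "real^'n" where "x = (\<chi> j. if j \<in> S then f (column j \<Omega>) else 0)"
      have "\<Omega> *v x = (\<Sum>j\<in>S. f (column j \<Omega>) *\<^sub>R column j \<Omega>)"
        using mult[of x] by (simp add: x_def)
      also have "\<dots> = 0" using f inj by (simp add: sum.reindex)
      finally have "x = 0" using R by (simp add: x_def)
      moreover obtain j where j: "j \<in> S" "v = column j \<Omega>" using v by blast
      ultimately have "x $ j = 0" by simp
      then show "f v = 0" using j by (simp add: x_def)
    qed simp
    ultimately show ?L by blast
  qed
qed

text \<open>For a symmetric matrix of rank at most r, r columns are independent exactly when the
  principal minor on the same indices is nonzero; independent columns in turn force the rank to be
  r.\<close>

lemma Gstr_eq:
  fixes E :: "'v::finite set set"
  shows "Gstr d E = {\<Omega> \<in> low_rank E (CARD('v) - d - 1) UNIV UNIV. \<Omega> *v (\<chi> i. 1) = 0}"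
proof (intro set_eqI iffI)
  let ?r = "CARD('v) - d - 1"
  fix \<Omega> assume \<Omega>: "\<Omega> \<in> Gstr d E"
  then have tr: "transpose \<Omega> = \<Omega>" by (simp add: Gstr_def)
  then have sym: "\<Omega> $ i $ j = \<Omega> $ j $ i" for i j by (metis transpose_def vec_lambda_beta)
  have rk: "rank \<Omega> = ?r" using \<Omega> by (simp add: Gstr_def)
  have "principal_minor S \<Omega> \<noteq> 0" if S: "card S = ?r" for S
    unfolding principal_minor_nz_iff
  proof (intro allI impI, elim conjE)
    fix x assume x: "\<forall>i\<in>S. (\<Omega> *v x) $ i = 0" "\<forall>i. i \<notin> S \<longrightarrow> x $ i = 0"
    have inj: "x = 0" if "\<forall>i. i \<notin> S \<longrightarrow> x $ i = 0" "\<Omega> *v x = 0" for x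
      using \<Omega> S columns_independent_iff[of \<Omega> S] that by (auto simp: Gstr_def)
    have "\<Omega> *v x = 0"
      by (rule kernel_if_zero_on_columns[OF sym _ inj]) (use rk S x in auto)
    then show "x = 0" using inj x(2) by blast
  qed
  then show "\<Omega> \<in> {\<Omega> \<in> low_rank E ?r UNIV UNIV. \<Omega> *v (\<chi> i. 1) = 0}"
    using \<Omega> sym by (auto simp: Gstr_def low_rank_def sparse_sym_def)
next
  let ?r = "CARD('v) - d - 1"
  fix \<Omega> assume "\<Omega> \<in> {\<Omega> \<in> low_rank E ?r UNIV UNIV. \<Omega> *v (\<chi> i. 1) = 0}"
  then have \<Omega>: "\<Omega> \<in> low_rank E ?r UNIV UNIV" "\<Omega> *v (\<chi> i. 1) = 0" by auto
  have ind: "inj_on (\<lambda>j. column j \<Omega>) S \<and> independent ((\<lambda>j. column j \<Omega>) ` S)" if "card S = ?r" for S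
    unfolding columns_independent_iff
    using supported_kernel_trivial[of S \<Omega>] \<Omega>(1) that by (auto simp: low_rank_def)
  obtain S :: "'v set" where S: "card S = ?r"
    using obtain_subset_with_card_n[of ?r "UNIV :: 'v set"] by auto
  have "?r = card ((\<lambda>j. column j \<Omega>) ` S)" using ind[OF S] S by (simp add: card_image)
  also have "\<dots> \<le> dim (range ((*v) \<Omega>))"
  proof (rule independent_card_le_dim)
    show "(\<lambda>j. column j \<Omega>) ` S \<subseteq> range ((*v) \<Omega>)"
      using matrix_vector_mult_basis[of \<Omega>] by (metis (mono_tags, lifting) image_subsetI rangeI)
  qed (use ind[OF S] in blast)
  finally have "rank \<Omega> = ?r" using \<Omega>(1) by (simp add: rank_dim_range low_rank_def)
  then show "\<Omega> \<in> Gstr d E"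
    using \<Omega> ind by (auto simp: Gstr_def low_rank_def sparse_sym_def transpose_def vec_eq_iff)
qed

section \<open>Emptiness when few vertices separate the graph\<close>

lemma kernel_vector_exists:
  fixes \<Omega> :: "real^'v::finite^'v"
  assumes "rank \<Omega> \<le> card S" "principal_minor S \<Omega> \<noteq> 0" "u \<notin> S"
  obtains x where "\<Omega> *v x = 0" "x $ u = 1" "\<And>i. i \<notin> insert u S \<Longrightarrow> x $ i = 0"
proof -
  obtain y where y: "\<forall>i. i \<notin> S \<longrightarrow> y $ i = 0" "\<Omega> *v axis u 1 = \<Omega> *v y"
    using column_span_independent_columns[OF assms(1) supported_kernel_trivial[OF assms(2)]] by metis
  show ?thesis
    by (rule that[of "axis u 1 - y"])
      (use y assms(3) in \<open>auto simp: matrix_vector_mult_diff_distrib axis_def\<close>)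
qed

lemma low_rank_empty_if_not_connected:
  fixes E :: "'v::finite set set"
  assumes n: "CARD('v) \<ge> d + 2" and "\<not> k_connected (d + 1) E"
  shows "low_rank E (CARD('v) - d - 1) UNIV UNIV = {}"
proof (rule ccontr)
  let ?r = "CARD('v) - d - 1"
  assume "low_rank E ?r UNIV UNIV \<noteq> {}"
  then obtain \<Omega> where \<Omega>: "\<Omega> \<in> low_rank E ?r UNIV UNIV" by blast
  then have sym: "\<Omega> $ i $ j = \<Omega> $ j $ i" and rk: "rank \<Omega> \<le> ?r"
    and nz: "card S = ?r \<Longrightarrow> principal_minor S \<Omega> \<noteq> 0"
    and E: "i \<noteq> j \<Longrightarrow> {i, j} \<notin> E \<Longrightarrow> \<Omega> $ i $ j = 0" for i j S
    by (auto simp: low_rank_def sparse_sym_def)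
  obtain S where S: "card S < d + 1" "\<not> connected_induced E (UNIV - S)"
    using assms by (auto simp: k_connected_def)
  let ?R = "{(x, y). x \<in> UNIV - S \<and> y \<in> UNIV - S \<and> {x, y} \<in> E}"
  obtain u v where uv: "u \<notin> S" "v \<notin> S" "(u, v) \<notin> ?R\<^sup>*"
    using S(2) unfolding connected_induced_def by blast
  \<comment> \<open>The component of \<open>u\<close> after deleting \<open>S\<close>;
    \<open>\<Omega>\<close> has no entries between it and the other remaining vertices.\<close>
  define A where "A = {x. x \<notin> S \<and> (u, x) \<in> ?R\<^sup>*}"
  have uA: "u \<in> A" and vA: "v \<notin> A" using uv by (auto simp: A_def)
  have sep: "\<Omega> $ i $ j = 0" if "i \<notin> S" "i \<notin> A" "j \<in> A" for i j
  proof (rule E)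
    show "i \<noteq> j" using that by auto
    show "{i, j} \<notin> E"
    proof
      assume "{i, j} \<in> E"
      then have "(j, i) \<in> ?R" using that by (auto simp: A_def insert_commute)
      moreover have "(u, j) \<in> ?R\<^sup>*" using that(3) by (simp add: A_def)
      ultimately have "(u, i) \<in> ?R\<^sup>*" by (rule rtrancl_into_rtrancl[rotated])
      then show False using that by (simp add: A_def)
    qed
  qed
  have "u \<noteq> v" using uv by auto
  then have "card (UNIV - S - {u, v}) = CARD('v) - card S - 2"
    using uv by (simp add: card_Diff_subset)
  \<comment> \<open>Room for a kernel vector supported off \<open>S\<close> on r + 1 vertices
    including \<open>u\<close> and \<open>v\<close>: n - |S| - 2 is at least n - d - 2 = r - 1, and
    r is positive.\<close>
  then have "?r - 1 \<le> card (UNIV - S - {u, v})" using S(1) n by linarith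
  then obtain Z where Z: "Z \<subseteq> UNIV - S - {u, v}" "card Z = ?r - 1"
    by (meson obtain_subset_with_card_n)
  have card_Z: "card (insert u Z) = ?r" "card (insert v Z) = ?r"
    using Z n by (auto simp: card_insert_if)
  have uZ: "u \<notin> insert v Z" using Z(1) \<open>u \<noteq> v\<close> by auto
  obtain x where x: "\<Omega> *v x = 0" "x $ u = 1" "\<And>i. i \<notin> insert u (insert v Z) \<Longrightarrow> x $ i = 0"
    using kernel_vector_exists[of \<Omega> "insert v Z" u] rk nz card_Z uZ by metis
  \<comment> \<open>The part of \<open>x\<close> in the component of \<open>u\<close>. Since
    \<open>v\<close> lies outside, its support has at most r elements, too few for a nonzero kernel
    vector.\<close>
  define y where "y = (\<chi> i. if i \<in> A then x $ i else 0)"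
  have "(\<Omega> *v y) $ i = 0" if "i \<notin> S" for i
  proof (cases "i \<in> A")
    case True
    have "(\<Omega> *v y) $ i = (\<Omega> *v x) $ i"
      unfolding matrix_vector_mult_def vec_lambda_beta
    proof (rule sum.cong[OF refl])
      fix j
      have "x $ j = 0" if "j \<in> S" by (intro x(3)) (use that Z(1) uv in auto)
      moreover have "\<Omega> $ i $ j = 0" if "j \<notin> S" "j \<notin> A" using sep[OF that True] sym by metis
      ultimately show "\<Omega> $ i $ j * y $ j = \<Omega> $ i $ j * x $ j" by (auto simp: y_def)
    qed
    then show ?thesis using x(1) by simp
  next
    case False
    show ?thesis
      unfolding matrix_vector_mult_def vec_lambda_beta
      by (rule sum.neutral) (use sep[OF that False] in \<open>auto simp: y_def\<close>)
  qed
  \<comment> \<open>The rows in \<open>S\<close> have not been checked; vanishing on the r rows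
    \<open>insert u Z\<close> off \<open>S\<close> forces all rows to vanish.\<close>
  moreover have "insert u Z \<subseteq> UNIV - S" using Z uv by auto
  ultimately have "\<Omega> *v y = 0"
    using kernel_if_zero_on_minor[OF sym, of "insert u Z" y] rk nz card_Z by auto
  moreover have "\<forall>i. i \<notin> insert u Z \<longrightarrow> y $ i = 0" using x(3) vA by (auto simp: y_def)
  ultimately have "y = 0" using supported_kernel_trivial[OF nz[OF card_Z(1)]] by blast
  then have "y $ u = 0" by simp
  then show False using x(2) uA by (simp add: y_def)
qed

text \<open>The minimum degree is at least d + 1: deleting at most d neighbours of \<open>u\<close>
  would isolate it while another vertex remains.\<close>

lemma k_connected_nonneighbours:
  fixes E :: "'v::finite set set"
  assumes n: "CARD('v) \<ge> d + 2" and k: "k_connected (d + 1) E" and E: "simple_graph E"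
  shows "card {i. i \<noteq> u \<and> {i, u} \<notin> E} \<le> CARD('v) - d - 1"
proof -
  let ?N = "{i. i \<noteq> u \<and> {i, u} \<in> E}"
  have "card ?N \<ge> d + 1"
  proof (rule ccontr)
    assume "\<not> card ?N \<ge> d + 1"
    then have conn: "connected_induced E (UNIV - ?N)" and c: "card ?N \<le> d" using k by (auto simp: k_connected_def)
    have "card (insert u ?N) < card (UNIV :: 'v set)" using c n by (simp add: card_insert_if)
    then have "insert u ?N \<noteq> UNIV" by (metis less_irrefl)
    then obtain v where v: "v \<notin> insert u ?N" by blast
    have "(u, v) \<in> {(x, y). x \<in> UNIV - ?N \<and> y \<in> UNIV - ?N \<and> {x, y} \<in> E}\<^sup>*"
      using conn v by (auto simp: connected_induced_def)
    then show False
    proof (cases rule: converse_rtranclE)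
      case base
      then show ?thesis using v by auto
    next
      case (step y)
      then have "{y, u} \<in> E" "y \<notin> ?N" by (auto simp: insert_commute)
      moreover have "y \<noteq> u" using \<open>{y, u} \<in> E\<close> E by (auto simp: simple_graph_def)
      ultimately show ?thesis by auto
    qed
  qed
  moreover have "card {i. i \<noteq> u \<and> {i, u} \<notin> E} + card ?N \<le> CARD('v)"
    by (subst card_Un_disjoint[symmetric]) (auto intro: card_mono)
  ultimately show ?thesis by linarith
qed

lemma k_connected_large_subset:
  fixes E :: "'v::finite set set"
  assumes "k_connected (d + 1) E" "card W > CARD('v) - d - 1"
  shows "connected_induced E W"
proof -
  have "card (UNIV - W) < d + 1" using assms(2) by (simp add: card_Diff_subset)
  then have "connected_induced E (UNIV - (UNIV - W))" using assms(1) unfolding k_connected_def by blast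
  then show ?thesis by (simp add: double_diff)
qed



section \<open>Diagonal congruence and the all-ones kernel vector\<close>

definition scale_matrix :: "real^'v^'v \<Rightarrow> real^'v \<Rightarrow> real^'v^'v" where
  "scale_matrix \<Omega> x = (\<chi> i j. x $ i * \<Omega> $ i $ j * x $ j)"

lemma scale_matrix_mult:
  "scale_matrix \<Omega> x *v z = (\<chi> i. x $ i * (\<Omega> *v (\<chi> j. x $ j * z $ j)) $ i)"
  by (simp add: scale_matrix_def matrix_vector_mult_def vec_eq_iff sum_distrib_left mult.assoc)

lemma scale_matrix_in_low_rank:
  assumes \<Omega>: "\<Omega> \<in> low_rank E r V V'" and x: "\<And>i. x $ i \<noteq> 0"
  shows "scale_matrix \<Omega> x \<in> low_rank E r V V'"
proof -
  define L :: "real^'a \<Rightarrow> real^'a" where "L w = (\<chi> i. x $ i * w $ i)" for w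
  have linL: "linear L" by (auto simp: L_def linear_iff vec_eq_iff algebra_simps)
  have "range ((*v) (scale_matrix \<Omega> x)) \<subseteq> L ` range ((*v) \<Omega>)"
    by (auto simp: scale_matrix_mult L_def)
  then have "dim (range ((*v) (scale_matrix \<Omega> x))) \<le> dim (L ` range ((*v) \<Omega>))" by (rule dim_subset)
  also have "\<dots> \<le> dim (range ((*v) \<Omega>))" by (rule dim_image_le[OF linL])
  finally have "rank (scale_matrix \<Omega> x) \<le> r" using \<Omega> by (simp add: rank_dim_range low_rank_def)
  moreover have "principal_minor S (scale_matrix \<Omega> x) \<noteq> 0" if "S \<subseteq> V'" "card S = r" for S
    unfolding principal_minor_nz_iff
  proof (intro allI impI, elim conjE)
    fix z assume z: "\<forall>i\<in>S. (scale_matrix \<Omega> x *v z) $ i = 0" "\<forall>i. i \<notin> S \<longrightarrow> z $ i = 0"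
    have "principal_minor S \<Omega> \<noteq> 0" using \<Omega> that by (simp add: low_rank_def)
    then have "(\<chi> j. x $ j * z $ j) = 0"
      unfolding principal_minor_nz_iff using z x by (auto simp: scale_matrix_mult)
    then show "z = 0" using x by (auto simp: vec_eq_iff)
  qed
  moreover have "scale_matrix \<Omega> x \<in> sparse_sym E"
    using \<Omega> by (auto simp: low_rank_def sparse_sym_def scale_matrix_def)
  ultimately show ?thesis using \<Omega> by (auto simp: low_rank_def scale_matrix_def)
qed

text \<open>
  Rescaling by a kernel vector without zero entries turns that vector into the all-ones vector.
\<close>

lemma Gstr_irreducible_nonempty:
  fixes E :: "'v::finite set set"
  assumes irr: "poly_irreducible (low_rank E (CARD('v) - d - 1) UNIV UNIV)"
    and ne: "low_rank E (CARD('v) - d - 1) UNIV UNIV \<noteq> {}"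
  shows "poly_irreducible (Gstr d E)" "Gstr d E \<noteq> {}"
proof -
  let ?r = "CARD('v) - d - 1"
  let ?T = "low_rank E ?r UNIV UNIV"
  obtain S :: "'v set" where S: "card S = ?r"
    using obtain_subset_with_card_n[of ?r "UNIV :: 'v set"] by auto
  \<comment> \<open>The r rows in \<open>S\<close> already define the kernel, so the kernels form a
    bundle with polynomial sections.\<close>
  let ?B = "SIGMA \<Omega>:?T. {x. \<forall>i\<in>S. (\<Omega> *v x) $ i = 0}"
  let ?B' = "{p \<in> ?B. \<forall>i\<in>UNIV. snd p $ i \<noteq> 0}"
  have nz: "principal_minor S \<Omega> \<noteq> 0" if "\<Omega> \<in> ?T" for \<Omega> using that S by (simp add: low_rank_def)
  have irrB: "poly_irreducible ?B'"
    by (intro poly_irreducible_open_family poly_irreducible_kernel_bundle[OF irr polynomial_function_id subset_refl nz]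
        real_polynomial_function_nth polynomial_function_snd) auto
  have ker: "\<Omega> *v x = 0" if "\<Omega> \<in> ?T" "\<forall>i\<in>S. (\<Omega> *v x) $ i = 0" for \<Omega> x
    by (rule kernel_if_zero_on_minor[OF _ _ nz[OF that(1)]])
      (use that S in \<open>auto simp: low_rank_def sparse_sym_def\<close>)
  have eq: "Gstr d E = (\<lambda>p. scale_matrix (fst p) (snd p)) ` ?B'"
  proof
    show "Gstr d E \<subseteq> (\<lambda>p. scale_matrix (fst p) (snd p)) ` ?B'"
    proof
      fix \<Omega> assume \<Omega>: "\<Omega> \<in> Gstr d E"
      then have "(\<Omega>, \<chi> i. 1) \<in> ?B'" by (auto simp: Gstr_eq)
      moreover have "\<Omega> = scale_matrix \<Omega> (\<chi> i. 1)" by (simp add: scale_matrix_def vec_eq_iff)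
      ultimately show "\<Omega> \<in> (\<lambda>p. scale_matrix (fst p) (snd p)) ` ?B'" by force
    qed
    show "(\<lambda>p. scale_matrix (fst p) (snd p)) ` ?B' \<subseteq> Gstr d E"
    proof (rule image_subsetI)
      fix p assume p: "p \<in> ?B'"
      obtain \<Omega> x where px: "p = (\<Omega>, x)" by fastforce
      have x: "\<And>i. x $ i \<noteq> 0" "\<Omega> \<in> ?T" "\<forall>i\<in>S. (\<Omega> *v x) $ i = 0" using p px by auto
      have "scale_matrix \<Omega> x \<in> ?T" by (rule scale_matrix_in_low_rank[OF x(2,1)])
      moreover have "scale_matrix \<Omega> x *v (\<chi> i. 1) = 0"
        using ker[OF x(2,3)] by (simp add: scale_matrix_mult vec_eq_iff)
      ultimately show "scale_matrix (fst p) (snd p) \<in> Gstr d E" by (simp add: Gstr_eq px)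
    qed
  qed
  have "polynomial_function (\<lambda>p. scale_matrix (fst p) (snd p :: real^'v))"
  proof (rule polynomial_function_matrixI)
    fix i j
    show "real_polynomial_function (\<lambda>p. scale_matrix (fst p) (snd p :: real^'v) $ i $ j)"
      unfolding scale_matrix_def
      by (simp, intro real_polynomial_function.intros(4) real_polynomial_function_nth
          polynomial_function_entry polynomial_function_fst polynomial_function_snd)
  qed
  then show "poly_irreducible (Gstr d E)"
    unfolding eq by (rule poly_irreducible_image[OF irrB])
  obtain \<Omega> where \<Omega>: "\<Omega> \<in> ?T" using ne by blast
  let ?K = "{x. \<forall>i\<in>S. (\<Omega> *v x) $ i = 0}"
  \<comment> \<open>Each single coordinate is nonzero on some kernel vector; irreducibility of the
    kernel as a convex set makes all of them nonzero at once.\<close>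
  have "\<exists>x\<in>?K. \<forall>i\<in>UNIV. x $ i \<noteq> 0"
  proof (rule poly_irreducible_finite_family)
    show "poly_irreducible ?K"
      by (rule poly_irreducible_convex)
        (auto simp: convex_def matrix_vector_right_distrib matrix_vector_mult_scaleR)
    have "0 \<in> ?K" by simp
    then show "?K \<noteq> {}" by blast
    show "real_polynomial_function (\<lambda>x :: real^'v. x $ i)" for i
      by (intro real_polynomial_function_nth polynomial_function_id)
    fix u :: 'v
    have "?r \<le> card (UNIV - {u})" by simp
    then obtain S' where S': "S' \<subseteq> UNIV - {u}" "card S' = ?r" by (meson obtain_subset_with_card_n)
    have "principal_minor S' \<Omega> \<noteq> 0" "rank \<Omega> \<le> card S'" using \<Omega> S' by (auto simp: low_rank_def)
    then obtain x where "\<Omega> *v x = 0" "x $ u = 1" using kernel_vector_exists S'(1) by (metis Diff_iff insertI1 subsetD)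
    then show "\<exists>x\<in>?K. x $ u \<noteq> 0" by (intro bexI[of _ x]) auto
  qed simp
  then obtain x where "x \<in> ?K" "\<forall>i\<in>UNIV. x $ i \<noteq> 0" by blast
  then have "(\<Omega>, x) \<in> ?B'" using \<Omega> by auto
  then show "Gstr d E \<noteq> {}" unfolding eq by blast
qed

text \<open>
  The vectors \<open>cramer_vec S \<Omega> e\<^sub>j\<close> with \<open>j \<notin> S\<close> span the kernel of the rows in \<open>S\<close>; the form \<open>\<Omega>\<close>
  vanishes on them precisely when the Schur complement of the block \<open>S\<close> does.
\<close>

definition schur_residual :: "'v::finite set \<Rightarrow> 'v \<Rightarrow> 'v \<Rightarrow> real^'v^'v \<Rightarrow> real" where
  "schur_residual S i j \<Omega> = cramer_vec S \<Omega> (axis i 1) \<bullet> (\<Omega> *v cramer_vec S \<Omega> (axis j 1))"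

section \<open>Polynomial equations for the stress matrices\<close>

lemma cramer_vec_axis:
  assumes "principal_minor S \<Omega> \<noteq> 0" "j \<notin> S"
  shows "i \<in> S \<Longrightarrow> (\<Omega> *v cramer_vec S \<Omega> (axis j 1)) $ i = 0"
    and "i \<notin> S \<Longrightarrow> cramer_vec S \<Omega> (axis j 1) $ i = (if i = j then principal_minor S \<Omega> else 0)"
proof -
  have *: "(bordered S \<Omega> *v cramer_vec S \<Omega> (axis j 1)) $ i = (if i = j then principal_minor S \<Omega> else 0)"
    using bordered_cramer_vec[OF assms(1)] by (simp add: axis_def)
  then show "i \<in> S \<Longrightarrow> (\<Omega> *v cramer_vec S \<Omega> (axis j 1)) $ i = 0"
    "i \<notin> S \<Longrightarrow> cramer_vec S \<Omega> (axis j 1) $ i = (if i = j then principal_minor S \<Omega> else 0)"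
    using assms(2) * unfolding bordered_mult by (cases "i = j"; simp)+
qed

lemma rank_le_iff_schur_residual:
  fixes \<Omega> :: "real^'v::finite^'v"
  assumes sym: "\<And>i j. \<Omega> $ i $ j = \<Omega> $ j $ i" and nz: "principal_minor S \<Omega> \<noteq> 0"
  shows "rank \<Omega> \<le> card S \<longleftrightarrow> (\<forall>i j. i \<notin> S \<and> j \<notin> S \<longrightarrow> schur_residual S i j \<Omega> = 0)"
    and "rank \<Omega> \<le> card S \<Longrightarrow> j \<notin> S \<Longrightarrow> \<Omega> *v cramer_vec S \<Omega> (axis j 1) = 0"
proof -
  let ?k = "\<lambda>j. cramer_vec S \<Omega> (axis j 1)"
  show *: "\<Omega> *v ?k j = 0" if "rank \<Omega> \<le> card S" "j \<notin> S" for j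
    by (rule kernel_if_zero_on_minor[OF sym that(1) nz]) (rule cramer_vec_axis(1)[OF nz that(2)])
  show "rank \<Omega> \<le> card S \<longleftrightarrow> (\<forall>i j. i \<notin> S \<and> j \<notin> S \<longrightarrow> schur_residual S i j \<Omega> = 0)"
  proof
    assume "rank \<Omega> \<le> card S"
    then show "\<forall>i j. i \<notin> S \<and> j \<notin> S \<longrightarrow> schur_residual S i j \<Omega> = 0"
      using * by (simp add: schur_residual_def)
  next
    assume res: "\<forall>i j. i \<notin> S \<and> j \<notin> S \<longrightarrow> schur_residual S i j \<Omega> = 0"
    have k0: "\<Omega> *v ?k j = 0" if j: "j \<notin> S" for j
      unfolding vec_eq_iff
    proof
      fix i
      show "(\<Omega> *v ?k j) $ i = 0 $ i"
      proof (cases "i \<in> S")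
        case True
        then show ?thesis using cramer_vec_axis(1)[OF nz j] by simp
      next
        case False
        have "schur_residual S i j \<Omega> = (\<Sum>l\<in>UNIV. ?k i $ l * (\<Omega> *v ?k j) $ l)"
          by (simp add: schur_residual_def inner_vec_def)
        \<comment> \<open>\<open>\<Omega> *v ?k j\<close> vanishes on \<open>S\<close>, and off
          \<open>S\<close> the vector \<open>?k i\<close> has a single nonzero entry, so the pairing
          isolates coordinate \<open>i\<close>.\<close>
        also have "\<dots> = (\<Sum>l\<in>UNIV. if l = i then principal_minor S \<Omega> * (\<Omega> *v ?k j) $ l else 0)"
        proof (rule sum.cong[OF refl])
          fix l
          show "?k i $ l * (\<Omega> *v ?k j) $ l = (if l = i then principal_minor S \<Omega> * (\<Omega> *v ?k j) $ l else 0)"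
            using cramer_vec_axis(1)[OF nz j, of l] cramer_vec_axis(2)[OF nz False, of l] False
            by (cases "l \<in> S") auto
        qed
        finally show ?thesis using res False j nz by simp
      qed
    qed
    show "rank \<Omega> \<le> card S"
    proof (rule rank_le_columns)
      fix z
      \<comment> \<open>Off \<open>S\<close> the kernel vector \<open>?k j\<close> is
        \<open>principal_minor S \<Omega>\<close> times a unit vector, so these multiples clear
        \<open>z\<close> there.\<close>
      define y where "y = z - (\<Sum>j\<in>-S. (z $ j / principal_minor S \<Omega>) *\<^sub>R ?k j)"
      have "\<Omega> *v (\<Sum>j\<in>-S. (z $ j / principal_minor S \<Omega>) *\<^sub>R ?k j)
          = (\<Sum>j\<in>-S. (z $ j / principal_minor S \<Omega>) *\<^sub>R (\<Omega> *v ?k j))"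
        by (simp add: linear_sum[OF matrix_vector_mul_linear] matrix_vector_mult_scaleR)
      also have "\<dots> = 0" using k0 by simp
      finally have "\<Omega> *v z = \<Omega> *v y" by (simp add: y_def matrix_vector_mult_diff_distrib)
      moreover have "y $ i = 0" if i: "i \<notin> S" for i
      proof -
        have "(\<Sum>j\<in>-S. (z $ j / principal_minor S \<Omega>) * ?k j $ i)
            = (\<Sum>j\<in>-S. if j = i then z $ j else 0)"
          using cramer_vec_axis(2)[OF nz _ i] nz by (intro sum.cong) auto
        then show ?thesis using i by (simp add: y_def)
      qed
      ultimately show "\<exists>y. (\<forall>i. i \<notin> S \<longrightarrow> y $ i = 0) \<and> \<Omega> *v z = \<Omega> *v y" by blast
    qed
  qed
qed

lemma real_polynomial_function_schur_residual: "real_polynomial_function (schur_residual S i j)"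
proof -
  have k: "polynomial_function (\<lambda>\<Omega>. cramer_vec S \<Omega> c)" for c :: "real^'a"
    by (rule polynomial_function_cramer_vec[OF polynomial_function_id])
  have "real_polynomial_function (\<lambda>\<Omega>. \<Sum>l\<in>UNIV. cramer_vec S \<Omega> (axis i 1) $ l *
      (\<Omega> *v cramer_vec S \<Omega> (axis j 1)) $ l)"
    by (intro real_polynomial_function_sum real_polynomial_function.intros(4) real_polynomial_function_nth
        real_polynomial_function_matrix_vector_nth polynomial_function_id k finite)
  then show ?thesis by (simp add: schur_residual_def[abs_def] inner_vec_def)
qed

text \<open>Where the minor on \<open>S\<close> is nonzero, the Schur residuals express the rank
  bound, and the row sums in \<open>S\<close> then imply the remaining ones.\<close>

lemma Gstr_eq_polynomial:
  fixes E :: "'v::finite set set"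
  assumes S: "card S = CARD('v) - d - 1"
  shows "Gstr d E = {\<Omega> \<in> sparse_sym E. (\<forall>i\<in>S. (\<Omega> *v (\<chi> i. 1)) $ i = 0) \<and>
     (\<forall>i j. i \<notin> S \<and> j \<notin> S \<longrightarrow> schur_residual S i j \<Omega> = 0) \<and>
     (\<forall>S'. card S' = card S \<longrightarrow> principal_minor S' \<Omega> \<noteq> 0)}" (is "_ = ?R")
proof -
  have sym: "\<Omega> $ i $ j = \<Omega> $ j $ i" if "\<Omega> \<in> sparse_sym E" for \<Omega> i j
    using that by (simp add: sparse_sym_def)
  have "\<Omega> \<in> ?R" if "\<Omega> \<in> Gstr d E" for \<Omega>
    using that rank_le_iff_schur_residual(1)[of \<Omega> S] S sym[of \<Omega>]
    unfolding Gstr_eq low_rank_def by simp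
  moreover have "\<Omega> \<in> Gstr d E" if \<Omega>: "\<Omega> \<in> ?R" for \<Omega>
  proof -
    have nz: "principal_minor S \<Omega> \<noteq> 0" using \<Omega> by simp
    have rk: "rank \<Omega> \<le> card S" using rank_le_iff_schur_residual(1)[OF sym nz] \<Omega> by simp
    have "\<Omega> *v (\<chi> i. 1) = 0"
      by (rule kernel_if_zero_on_minor[OF sym rk nz]) (use \<Omega> in auto)
    then show ?thesis unfolding Gstr_eq low_rank_def using \<Omega> rk S by simp
  qed
  ultimately show ?thesis by blast
qed

lemma algebraic_set_family:
  assumes "finite I" "\<And>i. i \<in> I \<Longrightarrow> real_polynomial_function (f i)"
  shows "algebraic_set {x. \<forall>i\<in>I. f i x = 0}"
  unfolding algebraic_set_def by (rule exI[of _ "f ` I"]) (use assms in auto)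

lemma algebraic_set_Int:
  assumes "algebraic_set A" "algebraic_set B" shows "algebraic_set (A \<inter> B)"
proof -
  obtain F G where "finite F" "\<forall>f\<in>F. real_polynomial_function f" "A = {x. \<forall>f\<in>F. f x = 0}"
    "finite G" "\<forall>f\<in>G. real_polynomial_function f" "B = {x. \<forall>f\<in>G. f x = 0}"
    using assms unfolding algebraic_set_def by blast
  then show ?thesis unfolding algebraic_set_def by (intro exI[of _ "F \<union> G"]) auto
qed

lemma quasi_projective_Gstr:
  fixes E :: "'v::finite set set"
  shows "quasi_projective_variety (Gstr d E)"
proof -
  obtain S :: "'v set" where S: "card S = CARD('v) - d - 1"
    using obtain_subset_with_card_n[of "CARD('v) - d - 1" "UNIV :: 'v set"] by auto
  have entry: "real_polynomial_function (\<lambda>\<Omega> :: real^'v^'v. \<Omega> $ i $ j)" for i j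
    by (intro real_polynomial_function_nth polynomial_function_entry polynomial_function_id)
  let ?A1 = "{\<Omega> :: real^'v^'v. \<forall>p\<in>UNIV. \<Omega> $ fst p $ snd p - \<Omega> $ snd p $ fst p = 0}"
  let ?A2 = "{\<Omega> :: real^'v^'v. \<forall>p\<in>{(i, j). i \<noteq> j \<and> {i, j} \<notin> E}. \<Omega> $ fst p $ snd p = 0}"
  let ?A3 = "{\<Omega> :: real^'v^'v. \<forall>i\<in>S. (\<Omega> *v (\<chi> i. 1)) $ i = 0}"
  let ?A4 = "{\<Omega> :: real^'v^'v. \<forall>p\<in>(-S)\<times>(-S). schur_residual S (fst p) (snd p) \<Omega> = 0}"
  let ?B = "{\<Omega> :: real^'v^'v. (\<Prod>S'\<in>{S'. card S' = card S}. principal_minor S' \<Omega>) = 0}"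
  have "algebraic_set ?A1" "algebraic_set ?A2"
    by (rule algebraic_set_family; simp add: entry real_polynomial_function_diff)+
  moreover have "algebraic_set ?A3"
    by (rule algebraic_set_family)
      (auto intro: real_polynomial_function_matrix_vector_nth)
  moreover have "algebraic_set ?A4"
    by (rule algebraic_set_family) (auto intro: real_polynomial_function_schur_residual)
  ultimately have A: "algebraic_set (?A1 \<inter> ?A2 \<inter> ?A3 \<inter> ?A4)" by (intro algebraic_set_Int)
  have B: "algebraic_set ?B"
    by (intro algebraic_set_zero real_polynomial_function_prod real_polynomial_function_principal_minor
        polynomial_function_id finite)
  have "Gstr d E = (?A1 \<inter> ?A2 \<inter> ?A3 \<inter> ?A4) - ?B"
    unfolding Gstr_eq_polynomial[OF S] by (auto simp: sparse_sym_def)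
  then show ?thesis unfolding quasi_projective_variety_def using A B by blast
qed

section \<open>Dimension\<close>

text \<open>Positions are unordered pairs, a singleton in \<open>F\<close> standing for a diagonal
  entry; this treats graph-supported matrices and full symmetric blocks alike.\<close>

definition pattern_space :: "'v::finite set set \<Rightarrow> (real^'v^'v) set" where
  "pattern_space F = {X. \<forall>i j. X $ i $ j = X $ j $ i \<and> ({i, j} \<notin> F \<longrightarrow> X $ i $ j = 0)}"

lemma subspace_pattern_space: "subspace (pattern_space F)"
  by (auto simp: subspace_def pattern_space_def)

text \<open>The symmetric 0/1 matrices of the single positions form an orthogonal basis.\<close>

lemma dim_pattern_space:
  fixes F :: "'v::finite set set"
  assumes F: "\<And>e. e \<in> F \<Longrightarrow> \<exists>i j. e = {i, j}"
  shows "dim (pattern_space F) = card F"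
proof -
  define M :: "'v set \<Rightarrow> real^'v^'v" where "M e = (\<chi> i j. if {i, j} = e then 1 else 0)" for e
  have Mne: "M e $ i $ j = 1" if "e = {i, j}" for e i j using that by (simp add: M_def)
  have inj: "inj_on M F"
  proof (rule inj_onI)
    fix e f assume ef: "e \<in> F" "f \<in> F" "M e = M f"
    obtain i j where ij: "e = {i, j}" using F[OF ef(1)] by blast
    have "M f $ i $ j = 1" using Mne[OF ij] ef(3) by simp
    then show "e = f" using ij by (simp add: M_def split: if_splits)
  qed
  have ind: "independent (M ` F)"
  proof (rule pairwise_orthogonal_independent)
    show "pairwise orthogonal (M ` F)"
      by (auto simp: pairwise_def orthogonal_def inner_vec_def M_def intro!: sum.neutral)
    show "0 \<notin> M ` F"
    proof
      assume "0 \<in> M ` F"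
      then obtain e where e: "e \<in> F" "M e = 0" by force
      obtain i j where "e = {i, j}" using F[OF e(1)] by blast
      from Mne[OF this] e(2) show False by simp
    qed
  qed
  have MF: "M e \<in> pattern_space F" if "e \<in> F" for e
    using that by (auto simp: pattern_space_def M_def insert_commute)
  have "X \<in> span (M ` F)" if X: "X \<in> pattern_space F" for X
  proof -
    have "\<exists>c. \<forall>i j. {i, j} = e \<longrightarrow> X $ i $ j = c" for e
    proof (cases "\<exists>i j. e = {i, j}")
      case True
      then obtain i j where "e = {i, j}" by blast
      then show ?thesis
        using X by (intro exI[of _ "X $ i $ j"]) (auto simp: pattern_space_def doubleton_eq_iff)
    qed auto
    then obtain c where c: "\<And>e i j. {i, j} = e \<Longrightarrow> X $ i $ j = c e" by metis
    have "X = (\<Sum>e\<in>F. c e *\<^sub>R M e)"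
      unfolding vec_eq_iff
    proof (intro allI)
      fix i j
      have "(\<Sum>e\<in>F. c e *\<^sub>R M e) $ i $ j = (\<Sum>e\<in>F. c e * M e $ i $ j)" by simp
      also have "\<dots> = (\<Sum>e\<in>F. if e = {i, j} then c e else 0)"
        by (rule sum.cong) (auto simp: M_def)
      also have "\<dots> = X $ i $ j"
        using c[of i j] X by (auto simp: pattern_space_def)
      finally show "X $ i $ j = (\<Sum>e\<in>F. c e *\<^sub>R M e) $ i $ j" by simp
    qed
    then show ?thesis by (metis (no_types, lifting) imageI span_base span_scale span_sum)
  qed
  moreover have "span (M ` F) \<subseteq> pattern_space F"
    using MF by (intro span_minimal subspace_pattern_space) auto
  ultimately have "pattern_space F = span (M ` F)" by blast
  moreover have "dim (span (M ` F)) = card (M ` F)" by (rule dim_span_eq_card_independent[OF ind])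
  ultimately show ?thesis using inj by (simp only: card_image)
qed

lemma dim_sparse_sym:
  fixes E :: "'v::finite set set"
  assumes E: "simple_graph E"
  shows "dim (sparse_sym E) = CARD('v) + card E" "subspace (sparse_sym E)"
proof -
  let ?F = "E \<union> range (\<lambda>i. {i})"
  have eq: "sparse_sym E = pattern_space ?F"
    by (auto simp: sparse_sym_def pattern_space_def singleton_insert_inj_eq')
  have "card ?F = card E + card (range (\<lambda>i :: 'v. {i}))"
    using E by (intro card_Un_disjoint) (auto simp: simple_graph_def)
  also have "card (range (\<lambda>i :: 'v. {i})) = CARD('v)" by (intro card_image) auto
  finally have "card ?F = CARD('v) + card E" by simp
  moreover have "\<exists>i j. e = {i, j}" if "e \<in> ?F" for e
    using that E unfolding simple_graph_def card_2_iff by blast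
  ultimately show "dim (sparse_sym E) = CARD('v) + card E"
    unfolding eq using dim_pattern_space[of ?F] by presburger
  show "subspace (sparse_sym E)" unfolding eq by (rule subspace_pattern_space)
qed

definition block_sym :: "'v::finite set \<Rightarrow> (real^'v^'v) set" where
  "block_sym T = {X. \<forall>i j. X $ i $ j = X $ j $ i \<and> (i \<notin> T \<longrightarrow> X $ i $ j = 0)}"

lemma dim_block_sym:
  fixes T :: "'v::finite set"
  shows "dim (block_sym T) = card T + (card T choose 2)" "subspace (block_sym T)"
proof -
  let ?F = "{e. e \<subseteq> T \<and> card e = 1} \<union> {e. e \<subseteq> T \<and> card e = 2}"
  have pairs: "{i, j} \<in> ?F \<longleftrightarrow> i \<in> T \<and> j \<in> T" for i j by (cases "i = j") auto
  have eq: "block_sym T = pattern_space ?F"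
    unfolding block_sym_def pattern_space_def pairs by (rule Collect_cong) metis
  have "card ?F = card {e. e \<subseteq> T \<and> card e = 1} + card {e. e \<subseteq> T \<and> card e = 2}"
    by (intro card_Un_disjoint) auto
  then have "card ?F = card T + (card T choose 2)" by (simp add: n_subsets)
  moreover have "\<exists>i j. e = {i, j}" if "e \<in> ?F" for e
    using that by (auto simp: card_1_singleton_iff card_2_iff)
  ultimately show "dim (block_sym T) = card T + (card T choose 2)"
    unfolding eq using dim_pattern_space[of ?F] by presburger
  show "subspace (block_sym T)" unfolding eq by (rule subspace_pattern_space)
qed

text \<open>The terms that differentiate \<open>cramer_vec\<close> pair with \<open>\<Omega>\<close>
  applied to a kernel vector and drop out, leaving the form of the tangent matrix \<open>X\<close>
  on the kernel.\<close>

lemma schur_residual_has_derivative: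
  fixes \<Omega> :: "real^'v::finite^'v"
  assumes "\<Omega> *v cramer_vec S \<Omega> (axis i 1) = 0" "\<Omega> *v cramer_vec S \<Omega> (axis j 1) = 0"
    and sym: "\<And>i j. \<Omega> $ i $ j = \<Omega> $ j $ i"
  shows "(schur_residual S i j has_derivative
      (\<lambda>X. cramer_vec S \<Omega> (axis i 1) \<bullet> (X *v cramer_vec S \<Omega> (axis j 1)))) (at \<Omega>)"
proof -
  let ?k = "\<lambda>j \<Omega>. cramer_vec S \<Omega> (axis j 1)"
  have "\<exists>k'. (?k j has_derivative k') (at \<Omega>)" for j
    using polynomial_has_derivative[OF polynomial_function_cramer_vec[OF polynomial_function_id]] by metis
  then obtain k' where k': "\<And>j. (?k j has_derivative k' j) (at \<Omega>)" by metis
  have bil: "bounded_bilinear ((*v) :: real^'v^'v \<Rightarrow> _)"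
    by (simp add: bilinear_conv_bounded_bilinear[symmetric] bilinear_def linear_iff
        matrix_vector_mult_add_rdistrib matrix_vector_right_distrib matrix_vector_mult_scaleR
        scaleR_matrix_vector_assoc)
  have "((\<lambda>\<Omega>. \<Omega> *v ?k j \<Omega>) has_derivative (\<lambda>X. \<Omega> *v k' j X + X *v ?k j \<Omega>)) (at \<Omega>)"
    by (rule bounded_bilinear.FDERIV[OF bil has_derivative_ident k'])
  then have "(schur_residual S i j has_derivative
      (\<lambda>X. ?k i \<Omega> \<bullet> (\<Omega> *v k' j X + X *v ?k j \<Omega>) + k' i X \<bullet> (\<Omega> *v ?k j \<Omega>))) (at \<Omega>)"
    unfolding schur_residual_def[abs_def]
    by (rule bounded_bilinear.FDERIV[OF bounded_bilinear_inner k'])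
  moreover have "?k i \<Omega> \<bullet> (\<Omega> *v k' j X + X *v ?k j \<Omega>) + k' i X \<bullet> (\<Omega> *v ?k j \<Omega>) = ?k i \<Omega> \<bullet> (X *v ?k j \<Omega>)" for X
    using symmetric_inner[OF sym, of "?k i \<Omega>" "k' j X"] assms(1,2) by (simp add: inner_add_right)
  ultimately show ?thesis by simp
qed

text \<open>Padding by zeros keeps the index type fixed; on symmetric matrices the values lie in a
  subspace whose dimension is the number of independent equations.\<close>

definition residual_map :: "'v::finite set \<Rightarrow> real^'v^'v \<Rightarrow> (real^'v^'v) \<times> (real^'v)" where
  "residual_map S \<Omega> = ((\<chi> i j. if i \<notin> S \<and> j \<notin> S then schur_residual S i j \<Omega> else 0),
     (\<chi> i. if i \<in> S then (\<Omega> *v (\<chi> i. 1)) $ i else 0))"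

definition residual_derivative ::
    "'v::finite set \<Rightarrow> real^'v^'v \<Rightarrow> real^'v^'v \<Rightarrow> (real^'v^'v) \<times> (real^'v)" where
  "residual_derivative S \<Omega> X =
     ((\<chi> i j. if i \<notin> S \<and> j \<notin> S
        then cramer_vec S \<Omega> (axis i 1) \<bullet> (X *v cramer_vec S \<Omega> (axis j 1)) else 0),
      (\<chi> i. if i \<in> S then (X *v (\<chi> i. 1)) $ i else 0))"

lemma polynomial_function_residual_map: "polynomial_function (residual_map S)"
  unfolding residual_map_def[abs_def]
proof (intro polynomial_function_Pair polynomial_function_matrixI polynomial_function_vecI)
  fix i j
  show "real_polynomial_function (\<lambda>x. (\<chi> i j. if i \<notin> S \<and> j \<notin> S then schur_residual S i j x else 0) $ i $ j)"
    using real_polynomial_function_schur_residual[of S i j] by (cases "i \<notin> S \<and> j \<notin> S") auto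
  show "real_polynomial_function (\<lambda>x :: real^'a^'a. (\<chi> i. if i \<in> S then (x *v (\<chi> i. 1)) $ i else 0) $ i)"
    using real_polynomial_function_matrix_vector_nth[OF polynomial_function_id polynomial_function_const]
    by (cases "i \<in> S") auto
qed

lemma has_derivative_vec_lambda:
  fixes f :: "'a::real_normed_vector \<Rightarrow> 'n::finite \<Rightarrow> 'b::euclidean_space"
  assumes "\<And>i. ((\<lambda>x. f x i) has_derivative (\<lambda>x. f' x i)) (at a within S)"
  shows "((\<lambda>x. \<chi> i. f x i) has_derivative (\<lambda>x. \<chi> i. f' x i)) (at a within S)"
  unfolding has_derivative_componentwise_within[of "\<lambda>x. \<chi> i. f x i"]
proof
  fix b :: "'b ^ 'n" assume "b \<in> Basis"
  then obtain i u where b: "b = axis i u" by (auto simp: Basis_vec_def)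
  show "((\<lambda>x. (\<chi> i. f x i) \<bullet> b) has_derivative (\<lambda>x. (\<chi> i. f' x i) \<bullet> b)) (at a within S)"
    using has_derivative_inner_left[OF assms[of i], of u] by (simp add: b inner_axis)
qed

lemma residual_map_has_derivative:
  fixes \<Omega> :: "real^'v::finite^'v"
  assumes ker: "\<And>j. j \<notin> S \<Longrightarrow> \<Omega> *v cramer_vec S \<Omega> (axis j 1) = 0"
    and sym: "\<And>i j. \<Omega> $ i $ j = \<Omega> $ j $ i"
  shows "(residual_map S has_derivative residual_derivative S \<Omega>) (at \<Omega>)"
  unfolding residual_map_def[abs_def] residual_derivative_def[abs_def]
proof (intro has_derivative_Pair has_derivative_vec_lambda)
  fix i j
  show "((\<lambda>x. if i \<notin> S \<and> j \<notin> S then schur_residual S i j x else 0) has_derivative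
      (\<lambda>x. if i \<notin> S \<and> j \<notin> S then cramer_vec S \<Omega> (axis i 1) \<bullet> (x *v cramer_vec S \<Omega> (axis j 1)) else 0)) (at \<Omega>)"
    using schur_residual_has_derivative[of \<Omega> S i j, OF ker ker sym] by (cases "i \<notin> S \<and> j \<notin> S") auto
  have "bounded_linear (\<lambda>x :: real^'v^'v. (x *v (\<chi> i. 1)) $ i)"
    unfolding linear_conv_bounded_linear[symmetric]
    by (auto simp: linear_iff matrix_vector_mult_add_rdistrib scaleR_matrix_vector_assoc[symmetric])
  then show "((\<lambda>x. if i \<in> S then (x *v (\<chi> i. 1)) $ i else 0) has_derivative
      (\<lambda>x. if i \<in> S then (x *v (\<chi> i. 1)) $ i else 0)) (at \<Omega>)"
    by (cases "i \<in> S") (auto intro: bounded_linear_imp_has_derivative)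
qed

text \<open>
  Transversality: if \<open>(Q, a)\<close> is orthogonal to the image, then the tangent vectors
  \<open>diag \<delta> \<Omega> + \<Omega> diag \<delta>\<close> force \<open>a = 0\<close>, and the elementary matrices at a vertex \<open>l\<close> and its
  neighbours give a kernel vector of \<open>\<Omega>\<close> supported on the non-neighbours of \<open>l\<close>, which must vanish.
\<close>

lemma residual_derivative_image:
  fixes E :: "'v::finite set set"
  assumes \<Omega>: "\<Omega> \<in> Gstr d E" and S: "card S = CARD('v) - d - 1"
    and deg: "\<And>u. card {i. i \<noteq> u \<and> {i, u} \<notin> E} \<le> card S"
  shows "residual_derivative S \<Omega> ` sparse_sym E = block_sym (- S) \<times> {a. \<forall>i. i \<notin> S \<longrightarrow> a $ i = 0}"
    (is "?D ` ?H = ?R")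
proof -
  let ?k = "\<lambda>j. cramer_vec S \<Omega> (axis j 1)"
  let ?T = "- S"
  have T: "\<Omega> \<in> low_rank E (card S) UNIV UNIV" and one: "\<Omega> *v (\<chi> i. 1) = 0"
    using \<Omega> S unfolding Gstr_eq by simp_all
  have sym: "\<And>i j. \<Omega> $ i $ j = \<Omega> $ j $ i" and rk: "rank \<Omega> \<le> card S"
    and E: "\<And>i j. i \<noteq> j \<Longrightarrow> {i, j} \<notin> E \<Longrightarrow> \<Omega> $ i $ j = 0"
    using T by (auto simp: low_rank_def sparse_sym_def)
  have nz: "principal_minor S' \<Omega> \<noteq> 0" if "card S' = card S" for S'
    using T that by (simp add: low_rank_def)
  note nzS = nz[OF refl]
  have ker: "\<Omega> *v ?k j = 0" if "j \<notin> S" for j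
    by (rule rank_le_iff_schur_residual(2)[OF sym nzS rk that])
  have kT: "?k j $ i = (if i = j then principal_minor S \<Omega> else 0)" if "i \<notin> S" "j \<notin> S" for i j
    using cramer_vec_axis(2)[OF nzS that(2,1)] .
  have lin: "linear ?D"
  proof -
    have "(residual_map S has_derivative ?D) (at \<Omega>)"
      by (rule residual_map_has_derivative[OF ker sym])
    then show ?thesis by (rule has_derivative_linear)
  qed
  have subH: "subspace ?H"
    by (auto simp: subspace_def sparse_sym_def)
  have subDH: "subspace (?D ` ?H)" by (rule linear_subspace_image[OF lin subH])
  have subR: "subspace ?R"
    by (intro subspace_Times dim_block_sym(2)) (auto simp: subspace_def)
  have DHR: "?D ` ?H \<subseteq> ?R"
  proof (rule image_subsetI)
    fix X assume X: "X \<in> ?H"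
    have "?k i \<bullet> (X *v ?k j) = ?k j \<bullet> (X *v ?k i)" for i j
      using symmetric_inner[of X "?k i" "?k j"] X by (simp add: sparse_sym_def inner_commute)
    then show "?D X \<in> ?R" by (auto simp: residual_derivative_def block_sym_def)
  qed
  have "?R \<subseteq> ?D ` ?H"
  proof (rule ccontr)
    assume "\<not> ?R \<subseteq> ?D ` ?H"
    then have "?D ` ?H \<subset> ?R" using DHR by blast
    moreover have "span (?D ` ?H) = ?D ` ?H" "span ?R = ?R"
      using subDH subR by (simp_all only: span_eq_iff)
    ultimately have "span (?D ` ?H) \<subset> span ?R" by (simp only:)
    then obtain p where p: "p \<noteq> 0" "p \<in> span ?R" "\<And>y. y \<in> span (?D ` ?H) \<Longrightarrow> orthogonal p y"
      by (rule orthogonal_to_subspace_exists_gen) blast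
    obtain Q a where Qa: "p = (Q, a)" by fastforce
    have "(Q, a) \<in> ?R" using p(2) Qa \<open>span ?R = ?R\<close> by (simp only:)
    then have Qsym: "\<And>i j. Q $ i $ j = Q $ j $ i" and Q0: "\<And>i j. i \<in> S \<Longrightarrow> Q $ i $ j = 0"
      and a0: "\<And>i. i \<notin> S \<Longrightarrow> a $ i = 0"
      by (auto simp: block_sym_def)
    have Q0': "Q $ i $ j = 0" if "j \<in> S" for i j using Q0[OF that] Qsym by metis
    have orth: "(\<Sum>i\<in>?T. \<Sum>j\<in>?T. Q $ i $ j * (?k i \<bullet> (X *v ?k j))) + (\<Sum>i\<in>UNIV. a $ i * (X *v (\<chi> i. 1)) $ i) = 0"
      if X: "X \<in> ?H" for X
    proof -
      have "(Q, a) \<bullet> ?D X = 0"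
        using p(3)[of "?D X"] X Qa by (simp add: orthogonal_def span_base)
      then have "(\<Sum>i\<in>UNIV. \<Sum>j\<in>UNIV. Q $ i $ j * (if i \<notin> S \<and> j \<notin> S then ?k i \<bullet> (X *v ?k j) else 0))
          + (\<Sum>i\<in>UNIV. a $ i * (if i \<in> S then (X *v (\<chi> i. 1)) $ i else 0)) = 0"
        by (simp add: residual_derivative_def inner_vec_def)
      moreover have "(\<Sum>i\<in>UNIV. a $ i * (if i \<in> S then (X *v (\<chi> i. 1)) $ i else 0))
          = (\<Sum>i\<in>UNIV. a $ i * (X *v (\<chi> i. 1)) $ i)"
        using a0 by (intro sum.cong) auto
      moreover have "(\<Sum>i\<in>UNIV. \<Sum>j\<in>UNIV. Q $ i $ j * (if i \<notin> S \<and> j \<notin> S then ?k i \<bullet> (X *v ?k j) else 0))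
          = (\<Sum>i\<in>?T. \<Sum>j\<in>UNIV. Q $ i $ j * (if i \<notin> S \<and> j \<notin> S then ?k i \<bullet> (X *v ?k j) else 0))"
        by (rule sum.mono_neutral_right) auto
      moreover have "\<dots> = (\<Sum>i\<in>?T. \<Sum>j\<in>?T. Q $ i $ j * (?k i \<bullet> (X *v ?k j)))"
        by (intro sum.cong refl sum.mono_neutral_cong_right) auto
      ultimately show ?thesis by simp
    qed
    have "\<Omega> *v a = 0"
    proof -
      have "(\<Omega> *v a) \<bullet> \<delta> = 0" for \<delta>
      proof -
        \<comment> \<open>Tangent to the diagonal rescalings of \<open>\<Omega>\<close>: these
          preserve rank, so the Schur part does not see \<open>X\<close>, and its row sums are
          \<open>\<Omega> *v \<delta>\<close> because the all-ones vector is in the kernel.\<close>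
        define X :: "real^'v^'v" where "X = (\<chi> i j. (\<delta> $ i + \<delta> $ j) * \<Omega> $ i $ j)"
        have XH: "X \<in> ?H" using sym E by (auto simp: X_def sparse_sym_def algebra_simps)
        have Xv: "X *v v = (\<chi> i. \<delta> $ i * (\<Omega> *v v) $ i) + \<Omega> *v (\<chi> i. \<delta> $ i * v $ i)" for v
          by (simp add: X_def matrix_vector_mult_def vec_eq_iff sum_distrib_left sum.distrib[symmetric] algebra_simps)
        have "?k i \<bullet> (X *v ?k j) = 0" if "i \<notin> S" "j \<notin> S" for i j
          using symmetric_inner[OF sym, of "?k i"] ker that
          by (simp add: Xv inner_add_right) (simp add: inner_vec_def)
        then have "(\<Sum>i\<in>UNIV. a $ i * (X *v (\<chi> i. 1)) $ i) = 0"
          using orth[OF XH] by simp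
        moreover have "X *v (\<chi> i. 1) = \<Omega> *v \<delta>"
          using one by (simp add: Xv) (simp add: vec_eq_iff)
        ultimately have "a \<bullet> (\<Omega> *v \<delta>) = 0" by (simp add: inner_vec_def)
        then show ?thesis using symmetric_inner[OF sym] by simp
      qed
      then show ?thesis using inner_eq_zero_iff by blast
    qed
    then have a: "a = 0" using supported_kernel_trivial[OF nzS] a0 by blast
    \<comment> \<open>Row \<open>l\<close> of the symmetric matrix K Q K^T, where K has the kernel
      vectors \<open>?k j\<close> as columns; orthogonality to the image says that this matrix is
      orthogonal to \<open>sparse_sym E\<close>.\<close>
    define z where "z l = (\<Sum>j\<in>?T. (\<Sum>i\<in>?T. Q $ i $ j * ?k i $ l) *\<^sub>R ?k j)" for l
    have zm: "z l $ m = (\<Sum>i\<in>?T. \<Sum>j\<in>?T. Q $ i $ j * (?k i $ l * ?k j $ m))" for l m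
      by (subst sum.swap) (simp add: z_def sum_distrib_right mult.assoc)
    have zsym: "z l $ m = z m $ l" for l m
    proof -
      have "z l $ m = (\<Sum>j\<in>?T. \<Sum>i\<in>?T. Q $ i $ j * (?k i $ l * ?k j $ m))"
        unfolding zm by (rule sum.swap)
      also have "\<dots> = z m $ l" unfolding zm using Qsym by (intro sum.cong refl) (simp add: mult.commute)
      finally show ?thesis .
    qed
    have zero: "z l $ m = 0" if lm: "m = l \<or> {m, l} \<in> E" for l m
    proof -
      define X :: "real^'v^'v" where
        "X = (\<chi> i j. (if i = l then if j = m then 1 else 0 else 0) + (if i = m then if j = l then 1 else 0 else 0))"
      have XH: "X \<in> ?H" using lm by (auto simp: X_def sparse_sym_def insert_commute)
      have Xv: "(X *v v) $ i = (if i = l then v $ m else 0) + (if i = m then v $ l else 0)" for v i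
        by (simp add: X_def matrix_vector_mult_def distrib_right sum.distrib if_distrib[of "\<lambda>y. y * _"] cong: if_cong)
      have "u \<bullet> (X *v v) = u $ l * v $ m + u $ m * v $ l" for u v :: "real^'v"
      proof -
        have "X *v v = v $ m *\<^sub>R axis l 1 + v $ l *\<^sub>R axis m 1"
          by (simp add: vec_eq_iff Xv axis_def)
        then show ?thesis by (simp add: inner_add_right inner_axis mult.commute)
      qed
      then have "(\<Sum>i\<in>?T. \<Sum>j\<in>?T. Q $ i $ j * (?k i $ l * ?k j $ m + ?k i $ m * ?k j $ l)) = 0"
        using orth[OF XH] a by simp
      then have "z l $ m + z m $ l = 0"
        unfolding zm by (simp add: distrib_left sum.distrib)
      then show ?thesis using zsym[of l m] by simp
    qed
    have z0: "z l = 0" for l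
    proof -
      \<comment> \<open>The support of \<open>z l\<close> is enlarged to exactly r vertices, where
        general position supplies a nonzero minor.\<close>
      obtain S' where S': "{i. i \<noteq> l \<and> {i, l} \<notin> E} \<subseteq> S'" "card S' = card S"
        using exists_subset_between[OF deg[of l] card_mono[OF finite subset_UNIV] subset_UNIV] by auto
      have "\<Omega> *v z l = (\<Sum>j\<in>?T. (\<Sum>i\<in>?T. Q $ i $ j * ?k i $ l) *\<^sub>R (\<Omega> *v ?k j))"
        by (simp add: z_def linear_sum[OF matrix_vector_mul_linear] matrix_vector_mult_scaleR)
      also have "\<dots> = 0" using ker by simp
      finally show ?thesis
        using supported_kernel_trivial[OF nz[OF S'(2)], of "z l"] zero S'(1) by blast
    qed
    have "Q $ l $ m = 0" if "l \<in> ?T" "m \<in> ?T" for l m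
    proof -
      \<comment> \<open>Off \<open>S\<close> each \<open>?k i\<close> is the minor times a unit
        vector, so \<open>Q\<close> can be read off from the vectors \<open>z l\<close>.\<close>
      have "z l $ m = (\<Sum>i\<in>?T. \<Sum>j\<in>?T. if j = m then if i = l then Q $ i $ j * (principal_minor S \<Omega>)\<^sup>2 else 0 else 0)"
        unfolding zm using kT that by (intro sum.cong refl) (auto simp: power2_eq_square)
      also have "\<dots> = Q $ l $ m * (principal_minor S \<Omega>)\<^sup>2"
        using that by simp
      finally show ?thesis using z0 nzS by simp
    qed
    then have "Q = 0" using Q0 Q0' by (metis (no_types, lifting) ComplI vec_eq_iff zero_index)
    then show False using p(1) Qa a by (simp add: zero_prod_def)
  qed
  then show ?thesis using DHR by blast
qed

lemma residual_map_zero_iff: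
  "residual_map S \<Omega> = 0 \<longleftrightarrow> (\<forall>i\<in>S. (\<Omega> *v (\<chi> i. 1)) $ i = 0) \<and>
     (\<forall>i j. i \<notin> S \<and> j \<notin> S \<longrightarrow> schur_residual S i j \<Omega> = 0)"
  by (auto simp: residual_map_def zero_prod_def vec_eq_iff)

text \<open>A level set chart for \<open>residual_map\<close> inside the open set of nonzero minors.
  Both claims come from \<open>dim L + ((d + 1) choose 2) = card E\<close>: the inequality makes the
  subtraction in the dimension an honest one.\<close>

lemma Gstr_chart:
  fixes E :: "'v::finite set set"
  assumes E: "simple_graph E" and n: "CARD('v) \<ge> d + 2" and \<Omega>: "\<Omega> \<in> Gstr d E"
    and deg: "\<And>u. card {i. i \<noteq> u \<and> {i, u} \<notin> E} \<le> CARD('v) - d - 1"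
  shows "(d + 1) choose 2 \<le> card E"
    and "\<exists>U V (\<phi> :: real^'v^'v \<Rightarrow> real^'v^'v) \<psi> L. \<Omega> \<in> U \<and> homeomorphism U V \<phi> \<psi> \<and>
      smooth_on_open \<phi> U \<and> smooth_on_open \<psi> V \<and> subspace L \<and>
      dim L = card E - ((d + 1) choose 2) \<and> \<phi> ` (Gstr d E \<inter> U) = L \<inter> V"
proof -
  obtain S :: "'v set" where S: "card S = CARD('v) - d - 1"
    using obtain_subset_with_card_n[of "CARD('v) - d - 1" "UNIV :: 'v set"] by auto
  let ?O = "{\<Omega> :: real^'v^'v. \<forall>S'\<in>{S'. card S' = card S}. principal_minor S' \<Omega> \<noteq> 0}"
  let ?H = "sparse_sym E"
  have Geq: "Gstr d E = {\<Omega>\<in>?H. residual_map S \<Omega> = 0} \<inter> ?O"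
    unfolding Gstr_eq_polynomial[OF S] residual_map_zero_iff by blast
  have "open {\<Omega> :: real^'v^'v. principal_minor S' \<Omega> \<noteq> 0}" for S'
  proof -
    have "polynomial_function (principal_minor S' :: real^'v^'v \<Rightarrow> real)"
      using real_polynomial_function_principal_minor[OF polynomial_function_id, of S']
      by (simp add: real_polynomial_function_eq)
    then have "continuous_on UNIV (principal_minor S' :: real^'v^'v \<Rightarrow> real)"
      by (rule continuous_on_polymonial_function)
    from open_Collect_neq[OF this continuous_on_const] show ?thesis .
  qed
  then have "open (\<Inter>S'\<in>{S'. card S' = card S}. {\<Omega> :: real^'v^'v. principal_minor S' \<Omega> \<noteq> 0})"
    by (intro open_INT) auto
  moreover have "(\<Inter>S'\<in>{S'. card S' = card S}. {\<Omega> :: real^'v^'v. principal_minor S' \<Omega> \<noteq> 0}) = ?O"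
    by blast
  ultimately have openO: "open ?O" by (simp only:)
  have \<Omega>': "\<Omega> \<in> ?H" "\<Omega> \<in> ?O" "rank \<Omega> \<le> card S"
    using \<Omega> S unfolding Gstr_eq low_rank_def by auto
  have sym: "\<Omega> $ i $ j = \<Omega> $ j $ i" for i j using \<Omega>'(1) by (simp add: sparse_sym_def)
  have nzS: "principal_minor S \<Omega> \<noteq> 0" using \<Omega>'(2) by simp
  have D: "(residual_map S has_derivative residual_derivative S \<Omega>) (at \<Omega>)"
    by (rule residual_map_has_derivative[OF rank_le_iff_schur_residual(2)[OF sym nzS \<Omega>'(3)] sym])
  have img: "residual_derivative S \<Omega> ` ?H = block_sym (- S) \<times> {a. \<forall>i. i \<notin> S \<longrightarrow> a $ i = 0}"
    by (rule residual_derivative_image[OF \<Omega> S]) (unfold S, rule deg)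
  have FH: "residual_map S ` ?H \<subseteq> residual_derivative S \<Omega> ` ?H"
  proof (rule image_subsetI)
    fix X assume X: "X \<in> ?H"
    have "schur_residual S i j X = schur_residual S j i X" for i j
      using symmetric_inner[of X "cramer_vec S X (axis i 1)" "cramer_vec S X (axis j 1)"] X
      by (simp add: schur_residual_def sparse_sym_def inner_commute)
    then show "residual_map S X \<in> residual_derivative S \<Omega> ` ?H"
      unfolding img by (auto simp: residual_map_def block_sym_def)
  qed
  obtain U V and \<phi> :: "real^'v^'v \<Rightarrow> real^'v^'v" and \<psi> L where c: "\<Omega> \<in> U" "U \<subseteq> ?O" "homeomorphism U V \<phi> \<psi>"
      "smooth_on_open \<phi> U" "smooth_on_open \<psi> V" "subspace L"
      "dim L + dim (residual_derivative S \<Omega> ` ?H) = dim ?H"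
      "\<phi> ` ({x\<in>?H. residual_map S x = 0} \<inter> U) = L \<inter> V"
    using level_set_chart[OF dim_sparse_sym(2)[OF E] polynomial_function_residual_map openO \<Omega>'(2) D FH]
    by (elim exE conjE) (rule that)
  have cT: "card (- S) = d + 1" using S n by (simp add: Compl_eq_Diff_UNIV card_Diff_subset)
  have "dim {a :: real^'v. \<forall>i. i \<notin> S \<longrightarrow> a $ i = 0} = card S"
    using dim_substandard_cart[of S, where 'a=real] by (simp add: dim_vec_eq)
  then have "dim (residual_derivative S \<Omega> ` ?H) = (d + 1 + ((d + 1) choose 2)) + (CARD('v) - d - 1)"
    unfolding img using dim_block_sym[of "- S"] cT S
    by (subst dim_Times) (auto simp: subspace_def)
  then have dimL: "dim L + ((d + 1) choose 2) = card E"
    using c(7) n dim_sparse_sym(1)[OF E] by linarith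
  then show "(d + 1) choose 2 \<le> card E" by linarith
  have "Gstr d E \<inter> U = {x\<in>?H. residual_map S x = 0} \<inter> U" unfolding Geq using c(2) by blast
  then have "\<phi> ` (Gstr d E \<inter> U) = L \<inter> V" using c(8) by simp
  moreover have "dim L = card E - ((d + 1) choose 2)" using dimL by linarith
  ultimately show "\<exists>U V (\<phi> :: real^'v^'v \<Rightarrow> real^'v^'v) \<psi> L. \<Omega> \<in> U \<and> homeomorphism U V \<phi> \<psi> \<and>
      smooth_on_open \<phi> U \<and> smooth_on_open \<psi> V \<and> subspace L \<and>
      dim L = card E - ((d + 1) choose 2) \<and> \<phi> ` (Gstr d E \<inter> U) = L \<inter> V"
    using c by blast
qed

theorem theorem4p2:
  fixes E :: "'v::finite set set" and d :: nat
  assumes "d \<ge> 1" and "simple_graph E" and "CARD('v) \<ge> d + 2"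
  shows "(k_connected (d + 1) E \<longrightarrow>
            quasi_projective_variety (Gstr d E) \<and>
            zariski_irreducible (Gstr d E) \<and>
            (d + 1) choose 2 \<le> card E \<and>
            has_dimension (Gstr d E) (card E - ((d + 1) choose 2))) \<and>
         (\<not> k_connected (d + 1) E \<longrightarrow> Gstr d E = {})"
proof (intro conjI impI)
  assume k: "k_connected (d + 1) E"
  note deg = k_connected_nonneighbours[OF assms(3) k assms(2)]
  have gen: "poly_irreducible (low_rank E (CARD('v) - d - 1) UNIV UNIV)"
    "low_rank E (CARD('v) - d - 1) UNIV UNIV \<noteq> {}"
    using low_rank_generic[OF assms(2) deg k_connected_large_subset[OF k], of UNIV] by auto
  note G = Gstr_irreducible_nonempty[OF gen]
  show "quasi_projective_variety (Gstr d E)" by (rule quasi_projective_Gstr)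
  show "zariski_irreducible (Gstr d E)"
    by (rule zariski_irreducible_if_poly_irreducible[OF G(1)])
  obtain \<Omega> where "\<Omega> \<in> Gstr d E" using G(2) by blast
  then show "(d + 1) choose 2 \<le> card E"
    by (rule Gstr_chart(1)[OF assms(2,3) _ deg])
  \<comment> \<open>All of \<open>Gstr d E\<close> is a submanifold, so it serves as its own open
    piece and bounds the dimension of every other one.\<close>
  have sub: "smooth_submanifold (card E - ((d + 1) choose 2)) (Gstr d E)"
    unfolding smooth_submanifold_def
    by (intro ballI Gstr_chart(2)[OF assms(2,3) _ deg])
  show "has_dimension (Gstr d E) (card E - ((d + 1) choose 2))"
    unfolding has_dimension_def contains_open_submanifold_def
  proof (intro conjI allI impI; (elim exE conjE)?)
    show "\<exists>W. W \<noteq> {} \<and> openin (top_of_set (Gstr d E)) W \<and>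
        smooth_submanifold (card E - ((d + 1) choose 2)) W"
      using sub G(2) by (intro exI[of _ "Gstr d E"]) simp
  qed (rule submanifold_dim_le[OF sub])
next
  assume "\<not> k_connected (d + 1) E"
  then show "Gstr d E = {}"
    using low_rank_empty_if_not_connected[OF assms(3)] unfolding Gstr_eq by simp
qed

end
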